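(* Let $n>7$, let $G_n=S_{n+1}\times\mathbb{Z}/2$, let $\Delta$ be the generator of the central factor $\mathbb{Z}/2$, and let $B=A_{n+1}<S_{n+1}$. Let $Y$ be a $G_n$-minimal admissible graph of genus at most $2n$, and let $Y_B$ be the subgraph of $Y$ spanned by the edges with non-trivial $B$-orbits (so that $Y_B$ is isomorphic to $R_{n+1}$ or $C_{n+1}$, or $Y=Y_B=C_{n+1}\vee C_{n+1}$). Then $Y_B$ is invariant under all of $G_n$. If the central element $\Delta\in G_n$ acts on $Y_B$ non-trivially, then it flips all edges (if $Y_B=R_{n+1}$), interchanges the two vertices (if $Y_B=C_{n+1}$), or interchanges the two copies of $C_{n+1}$ (if $Y=C_{n+1}\vee C_{n+1}$), without permuting the edges. The odd permutations of $S_{n+1}$ act on $Y_B$ by permuting the edges in the standard way, or else each acts by the permutation composed with the action of $\Delta$.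
   Context: Graphs are one-dimensional CW complexes (loops and multiple edges allowed); genus means rank of $H_1$. A graph is admissible if it is finite, connected, has no vertices of valence 1 or 2, and has no non-trivial forest (subgraph without cycles containing at least one edge) invariant under its full automorphism group. An admissible graph with an action of a group $G$ by automorphisms is $G$-minimal if the action is faithful and there are no non-trivial forests invariant under the $G$-action. $R_k$ is the $k$-rose (one vertex, $k$ loops); $C_k$ is the $k$-cage (two vertices joined by $k$ edges); $C_k\vee C_k$ is obtained from two copies of $C_k$ by identifying one vertex of the first with one vertex of the second. The group $B=A_{n+1}$ acts on $R_{n+1}$ or $C_{n+1}$ by permuting the $n+1$ edges in the standard way, and on $C_{n+1}\vee C_{n+1}$ diagonally (in the standard way on each copy), which gives a correspondence between edges of the two copies. In the case $Y=C_{n+1}\vee C_{n+1}$, "without permuting the edges" means that each edge is exchanged with the corresponding edge of the other copy.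
   Formalization: If Δ acts trivially on Y_B, "composed with the action of Δ" is replaced by composition with the standard involution (flip all edges, swap the vertices or swap the copies); read literally the last claim then fails, e.g. on R_{n+2} with Δ flipping only the fixed loop. *)

theory Defs
  imports
    Complex_Main
    "HOL-Algebra.Bij"
    "HOL-Algebra.Sym_Groups"
    "HOL-Algebra.Elementary_Groups"
    "HOL-Library.Function_Algebras"
begin

section \<open>Graphs\<close>

text \<open>
  A one-dimensional CW complex is encoded combinatorially: every edge is represented by its two
  orientations (darts), which are exchanged by the fixed-point free involution \<open>opp\<close>; \<open>org\<close> is the
  initial vertex of a dart. Loops and multiple edges are allowed, and an automorphism may reverse
  a loop.
\<close>

record ('v, 'e) pregraph =
  verts :: "'v set"
  darts :: "'e set"
  org :: "'e \<Rightarrow> 'v"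
  opp :: "'e \<Rightarrow> 'e"

definition graph :: "('v, 'e) pregraph \<Rightarrow> bool" where
  "graph Y \<longleftrightarrow> (\<forall>d\<in>darts Y. org Y d \<in> verts Y \<and> opp Y d \<in> darts Y
                              \<and> opp Y (opp Y d) = d \<and> opp Y d \<noteq> d)"

definition finite_graph :: "('v, 'e) pregraph \<Rightarrow> bool" where
  "finite_graph Y \<longleftrightarrow> graph Y \<and> finite (verts Y) \<and> finite (darts Y)"

definition connected_graph :: "('v, 'e) pregraph \<Rightarrow> bool" where
  "connected_graph Y \<longleftrightarrow> graph Y \<and> verts Y \<noteq> {} \<and>
     (\<forall>u\<in>verts Y. \<forall>v\<in>verts Y. (u, v) \<in> {(org Y d, org Y (opp Y d)) | d. d \<in> darts Y}\<^sup>*)"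

definition valence :: "('v, 'e) pregraph \<Rightarrow> 'v \<Rightarrow> nat" where
  "valence Y v = card {d \<in> darts Y. org Y d = v}"

definition subgraph :: "('v, 'e) pregraph \<Rightarrow> ('v, 'e) pregraph \<Rightarrow> bool" where
  "subgraph H Y \<longleftrightarrow> graph H \<and> verts H \<subseteq> verts Y \<and> darts H \<subseteq> darts Y
                     \<and> org H = org Y \<and> opp H = opp Y"

text \<open>
  The first homology of a graph is its group of cellular 1-cycles. Cellular 1-chains with integer
  coefficients are regarded as integer valued functions on the darts that change sign under
  reversal; they sit inside the rational vector space of all functions to the rationals.
\<close>

definition H1 :: "('v, 'e) pregraph \<Rightarrow> ('e \<Rightarrow> rat) set" where
  "H1 Y = {c. (\<forall>d. c d \<in> \<int>) \<and> (\<forall>d. d \<notin> darts Y \<longrightarrow> c d = 0)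
            \<and> (\<forall>d\<in>darts Y. c (opp Y d) = - c d)
            \<and> (\<forall>v\<in>verts Y. (\<Sum>d | d \<in> darts Y \<and> org Y d = v. c d) = 0)}"

text \<open>\<open>dim\<close> is the dimension of the rational span, so this is the rank of the abelian group.\<close>

definition genus :: "('v, 'e) pregraph \<Rightarrow> nat" where
  "genus Y = vector_space.dim (\<lambda>(q::rat) c d. q * c d) (H1 Y)"

text \<open>An embedded circle, listed as the cyclic sequence of its (coherently oriented) darts.\<close>

definition is_cycle :: "('v, 'e) pregraph \<Rightarrow> 'e list \<Rightarrow> bool" where
  "is_cycle Y ds \<longleftrightarrow> ds \<noteq> [] \<and> set ds \<subseteq> darts Y
     \<and> (\<forall>i<length ds. org Y (opp Y (ds ! i)) = org Y (ds ! (Suc i mod length ds)))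
     \<and> distinct (map (org Y) ds) \<and> (\<forall>d\<in>set ds. opp Y d \<notin> set ds)"

definition nontrivial_forest :: "('v, 'e) pregraph \<Rightarrow> ('v, 'e) pregraph \<Rightarrow> bool" where
  "nontrivial_forest F Y \<longleftrightarrow> subgraph F Y \<and> (\<nexists>ds. is_cycle F ds) \<and> darts F \<noteq> {}"

section \<open>Automorphisms and actions\<close>

text \<open>Graph maps are pairs consisting of a map on vertices and a map on darts.\<close>

type_synonym ('v, 'e, 'w, 'f) gmap = "('v \<Rightarrow> 'w) \<times> ('e \<Rightarrow> 'f)"

definition graph_iso ::
    "('v, 'e) pregraph \<Rightarrow> ('w, 'f) pregraph \<Rightarrow> ('v, 'e, 'w, 'f) gmap \<Rightarrow> bool" where
  "graph_iso X Y \<phi> \<longleftrightarrow> bij_betw (fst \<phi>) (verts X) (verts Y) \<and> bij_betw (snd \<phi>) (darts X) (darts Y)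
     \<and> (\<forall>d\<in>darts X. fst \<phi> (org X d) = org Y (snd \<phi> d) \<and> snd \<phi> (opp X d) = opp Y (snd \<phi> d))"

definition aut_group :: "('v, 'e) pregraph \<Rightarrow> ('v, 'e, 'v, 'e) gmap monoid" where
  "aut_group Y = (BijGroup (verts Y) \<times>\<times> BijGroup (darts Y))
     \<lparr>carrier := {\<phi> \<in> Bij (verts Y) \<times> Bij (darts Y). graph_iso Y Y \<phi>}\<rparr>"

definition invariant_under :: "('v, 'e, 'v, 'e) gmap set \<Rightarrow> ('v, 'e) pregraph \<Rightarrow> bool" where
  "invariant_under A H \<longleftrightarrow> (\<forall>\<alpha>\<in>A. fst \<alpha> ` verts H = verts H \<and> snd \<alpha> ` darts H = darts H)"

definition admissible :: "('v, 'e) pregraph \<Rightarrow> bool" where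
  "admissible Y \<longleftrightarrow> finite_graph Y \<and> connected_graph Y
     \<and> (\<forall>v\<in>verts Y. valence Y v \<noteq> 1 \<and> valence Y v \<noteq> 2)
     \<and> (\<nexists>F. nontrivial_forest F Y \<and> invariant_under (carrier (aut_group Y)) F)"

definition minimal_action ::
    "('g, 'm) monoid_scheme \<Rightarrow> ('v, 'e) pregraph \<Rightarrow> ('g \<Rightarrow> ('v, 'e, 'v, 'e) gmap) \<Rightarrow> bool" where
  "minimal_action G Y \<rho> \<longleftrightarrow> \<rho> \<in> hom G (aut_group Y) \<and> inj_on \<rho> (carrier G)
     \<and> (\<nexists>F. nontrivial_forest F Y \<and> invariant_under (\<rho> ` carrier G) F)"

definition edge :: "('v, 'e) pregraph \<Rightarrow> 'e \<Rightarrow> 'e set" where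
  "edge Y d = {d, opp Y d}"

text \<open>
  The subgraph spanned by the (unoriented) edges whose orbit under the set \<open>B\<close> of group elements
  is non-trivial.
\<close>

definition moved_subgraph ::
    "('v, 'e) pregraph \<Rightarrow> ('g \<Rightarrow> ('v, 'e, 'v, 'e) gmap) \<Rightarrow> 'g set \<Rightarrow> ('v, 'e) pregraph" where
  "moved_subgraph Y \<rho> B =
     (let D = {d \<in> darts Y. (\<lambda>b. snd (\<rho> b) ` edge Y d) ` B \<noteq> {edge Y d}}
      in Y\<lparr>verts := org Y ` D, darts := D\<rparr>)"

definition gcomp ::
    "('w, 'f, 'x, 'g) gmap \<Rightarrow> ('v, 'e, 'w, 'f) gmap \<Rightarrow> ('v, 'e, 'x, 'g) gmap"  (infixr \<open>\<circ>\<^sub>g\<close> 55) where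
  "\<phi> \<circ>\<^sub>g \<psi> = (fst \<phi> \<circ> fst \<psi>, snd \<phi> \<circ> snd \<psi>)"

definition agree_on ::
    "('v, 'e) pregraph \<Rightarrow> ('v, 'e, 'w, 'f) gmap \<Rightarrow> ('v, 'e, 'w, 'f) gmap \<Rightarrow> bool" where
  "agree_on X \<phi> \<psi> \<longleftrightarrow>
     (\<forall>v\<in>verts X. fst \<phi> v = fst \<psi> v) \<and> (\<forall>d\<in>darts X. snd \<phi> d = snd \<psi> d)"

definition acts_trivially_on :: "('v, 'e, 'v, 'e) gmap \<Rightarrow> ('v, 'e) pregraph \<Rightarrow> bool" where
  "acts_trivially_on \<alpha> H \<longleftrightarrow> agree_on H \<alpha> (id, id)"

section \<open>The group and the standard graphs\<close>

definition Gn :: "nat \<Rightarrow> ((nat \<Rightarrow> nat) \<times> int) monoid" where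
  "Gn n = sym_group (n + 1) \<times>\<times> integer_mod_group 2"

definition Delta :: "(nat \<Rightarrow> nat) \<times> int" where
  "Delta = (id, 1)"

definition perm_elt :: "(nat \<Rightarrow> nat) \<Rightarrow> (nat \<Rightarrow> nat) \<times> int" where
  "perm_elt p = (p, 0)"

definition Bn :: "nat \<Rightarrow> ((nat \<Rightarrow> nat) \<times> int) set" where
  "Bn n = perm_elt ` carrier (alt_group (n + 1))"

text \<open>
  The dart \<open>(c, i, s)\<close> is the edge labelled \<open>i \<in> {1..k}\<close> in the copy \<open>c\<close>, with orientation \<open>s\<close>.
  Roses and single cages have only the copy \<open>1\<close>.
\<close>

type_synonym std_graph = "(nat, nat \<times> nat \<times> bool) pregraph"
type_synonym std_map = "(nat, nat \<times> nat \<times> bool, nat, nat \<times> nat \<times> bool) gmap"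

definition rose :: "nat \<Rightarrow> std_graph" where
  "rose k = \<lparr>verts = {0}, darts = {1} \<times> {1..k} \<times> UNIV,
             org = (\<lambda>_. 0), opp = (\<lambda>(c, i, s). (c, i, \<not> s))\<rparr>"

definition cage :: "nat \<Rightarrow> std_graph" where
  "cage k = \<lparr>verts = {0, 1}, darts = {1} \<times> {1..k} \<times> UNIV,
             org = (\<lambda>(c, i, s). if s then c else 0), opp = (\<lambda>(c, i, s). (c, i, \<not> s))\<rparr>"

text \<open>Two cages, on the vertices \<open>0, 1\<close> and \<open>0, 2\<close>, glued at the vertex \<open>0\<close>.\<close>

definition double_cage :: "nat \<Rightarrow> std_graph" where
  "double_cage k = \<lparr>verts = {0, 1, 2}, darts = {1, 2} \<times> {1..k} \<times> UNIV,
             org = (\<lambda>(c, i, s). if s then c else 0), opp = (\<lambda>(c, i, s). (c, i, \<not> s))\<rparr>"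

text \<open>
  The standard action of a permutation: on the double cage it is the diagonal one, and \<open>(1, i, s)\<close>
  and \<open>(2, i, s)\<close> are corresponding edges.
\<close>

definition std_perm :: "(nat \<Rightarrow> nat) \<Rightarrow> std_map" where
  "std_perm p = (id, \<lambda>(c, i, s). (c, p i, s))"

definition rose_flip :: std_map where
  "rose_flip = (id, \<lambda>(c, i, s). (c, i, \<not> s))"

text \<open>Exchanging the two vertices while mapping each edge to itself reverses each edge.\<close>

definition cage_swap :: std_map where
  "cage_swap = (\<lambda>v. 1 - v, \<lambda>(c, i, s). (c, i, \<not> s))"

definition double_cage_swap :: std_map where
  "double_cage_swap = (\<lambda>v. if v = 0 then 0 else 3 - v, \<lambda>(c, i, s). (3 - c, i, s))"

text \<open>
  An identification of a subgraph \<open>H\<close> with the standard graph \<open>M\<close> under which the alternating group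
  acts in the standard way.
\<close>

definition marking ::
    "nat \<Rightarrow> ((nat \<Rightarrow> nat) \<times> int \<Rightarrow> ('v, 'e, 'v, 'e) gmap) \<Rightarrow> std_graph \<Rightarrow> ('v, 'e) pregraph
      \<Rightarrow> (nat, nat \<times> nat \<times> bool, 'v, 'e) gmap \<Rightarrow> bool" where
  "marking n \<rho> M H \<iota> \<longleftrightarrow> graph_iso M H \<iota> \<and>
     (\<forall>b\<in>carrier (alt_group (n + 1)). agree_on M (\<rho> (perm_elt b) \<circ>\<^sub>g \<iota>) (\<iota> \<circ>\<^sub>g std_perm b))"

definition odd_perms :: "nat \<Rightarrow> (nat \<Rightarrow> nat) set" where
  "odd_perms n = carrier (sym_group (n + 1)) - carrier (alt_group (n + 1))"

text \<open>
  With respect to the marking \<open>\<iota>\<close>, the odd permutations all act in the standard way, or all act as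
  the standard permutation composed with a further map. The latter is given in the form of
  \<open>\<kappa> = \<delta> \<circ>\<^sub>g \<iota>\<close> for an automorphism \<open>\<delta>\<close> of the ambient graph, or \<open>\<kappa> = \<iota> \<circ>\<^sub>g \<tau>\<close> for an automorphism \<open>\<tau>\<close>
  of the standard graph.
\<close>

definition odd_std_or_twisted ::
    "nat \<Rightarrow> ((nat \<Rightarrow> nat) \<times> int \<Rightarrow> ('v, 'e, 'v, 'e) gmap) \<Rightarrow> std_graph
      \<Rightarrow> (nat, nat \<times> nat \<times> bool, 'v, 'e) gmap \<Rightarrow> (nat, nat \<times> nat \<times> bool, 'v, 'e) gmap \<Rightarrow> bool" where
  "odd_std_or_twisted n \<rho> M \<iota> \<kappa> \<longleftrightarrow>
     (\<forall>p\<in>odd_perms n. agree_on M (\<rho> (perm_elt p) \<circ>\<^sub>g \<iota>) (\<iota> \<circ>\<^sub>g std_perm p)) \<or>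
     (\<forall>p\<in>odd_perms n. agree_on M (\<rho> (perm_elt p) \<circ>\<^sub>g \<iota>) (\<kappa> \<circ>\<^sub>g std_perm p))"

end

theory Submission
  imports Defs "HOL.Binomial_Plus"
begin

text \<open>
  A subgroup \<open>H\<close> of index at most \<open>4N - 3\<close> in \<open>A\<^sub>N\<close>, \<open>N \<ge> 9\<close>, is \<open>A\<^sub>N\<close> or a point stabilizer: by
  Bochert's commutator argument \<open>H\<close> contains three-cycles, which cut the \<open>N\<close> points into classes
  permuted by \<open>H\<close>, and counting the translates of a class shows that it contains at least \<open>N - 1\<close>
  points. Valences at least 3 and genus at most \<open>2n\<close> bound the number of vertices and the size of
  each edge orbit, so every vertex and dart is either fixed by \<open>A\<^sub>N\<close>, \<open>N = n + 1\<close>, or labelled by the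
  point with the same stabilizer. Hence the moved part of \<open>Y\<close> consists of \<open>N\<close> copies of a small
  graph glued at fixed vertices. A genus count leaves few possibilities; those other than the rose,
  the cage and the double cage contain a separating edge or an invariant star, both excluded by
  minimality. Finally, an element of \<open>G\<^sub>n\<close> carries labels to labels, hence acts on the moved part as
  the standard permutation followed by an automorphism commuting with \<open>A\<^sub>N\<close>.
\<close>

section \<open>Permutation groups\<close>

text \<open>The constant \<open>4 * N - 3\<close> comes from edges. Any non-empty set of E edges
  with V ends satisfies E + 1 \<le> genus + V. Once every vertex orbit is known to have at most N
  points, an edge orbit has at most 2N ends, hence at most 2n + 2N - 1 = 4N - 3 members. Vertices
  must therefore be treated before edges; for them the valence condition 3V \<le> 2E gives V \<le>
  4n - 2.

  Homology enters only through its rational dimension: darts minus linear conditions bounds the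
  genus from below, so no spanning tree and no explicit basis of cycles is constructed. This also
  works for disconnected subgraphs, such as a union of orbits.

  The obstacle on the group side is N = 9, where the counting still allows three classes of three
  points. On the graph side, the orbit bound concerns unoriented edges while the conclusion concerns
  orientations; that three-cycles have odd order closes the gap.

  A label records a stabilizer. Distinct points have distinct stabilizers and \<open>Gn n\<close>
  normalizes the alternating group, so labels are intrinsic and every group element respects them.
  This is what extends the description from the alternating group to all of
  \<open>Gn n\<close>.\<close>

definition even_perms :: "'a set \<Rightarrow> ('a \<Rightarrow> 'a) set" where
  "even_perms S = {p. p permutes S \<and> evenperm p}"

definition three_cycle :: "'a \<Rightarrow> 'a \<Rightarrow> 'a \<Rightarrow> 'a \<Rightarrow> 'a" where
  "three_cycle a b c = transpose a b \<circ> transpose b c"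

lemma three_cycle_apply:
  assumes "distinct [a, b, c]"
  shows "three_cycle a b c x = (if x = a then b else if x = b then c else if x = c then a else x)"
  using assms by (auto simp: three_cycle_def transpose_def)

lemma three_cycle_eqI:
  assumes "distinct [a, b, c]" "f a = b" "f b = c" "f c = a" "\<And>x. x \<notin> {a, b, c} \<Longrightarrow> f x = x"
  shows "f = three_cycle a b c"
  using assms by (auto simp: fun_eq_iff three_cycle_apply)

lemma three_cycle_rotate: "distinct [a, b, c] \<Longrightarrow> three_cycle a b c = three_cycle b c a"
  by (rule three_cycle_eqI) (auto simp: three_cycle_apply)

lemma inv_three_cycle: "distinct [a, b, c] \<Longrightarrow> inv' (three_cycle a b c) = three_cycle b a c"
  by (rule inv_unique_comp) (auto simp: fun_eq_iff three_cycle_apply split: if_splits)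

lemma conj_three_cycle:
  assumes "bij h" "distinct [a, b, c]"
  shows "h \<circ> three_cycle a b c \<circ> inv' h = three_cycle (h a) (h b) (h c)"
proof (rule three_cycle_eqI)
  have i: "inv' h (h x) = x" for x using assms(1) by (simp add: bij_is_inj)
  have s: "h (inv' h x) = x" for x using assms(1) by (simp add: bij_is_surj surj_f_inv_f)
  show "distinct [h a, h b, h c]" using assms by (auto dest: bij_is_inj injD)
  show "(h \<circ> three_cycle a b c \<circ> inv' h) x = x" if "x \<notin> {h a, h b, h c}" for x
  proof -
    have "inv' h x \<notin> {a, b, c}" using that s by force
    then show ?thesis using assms(2) s by (simp add: three_cycle_apply)
  qed
qed (use assms in \<open>auto simp: three_cycle_apply bij_is_inj\<close>)

lemma three_cycle_even_perms:
  assumes "distinct [a, b, c]" "{a, b, c} \<subseteq> S"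
  shows "three_cycle a b c \<in> even_perms S"
  using assms
  by (auto simp: even_perms_def three_cycle_def evenperm_comp permutation_swap_id evenperm_swap
      intro!: permutes_compose permutes_swap_id)

lemma even_perms_id [simp]: "id \<in> even_perms S"
  by (simp add: even_perms_def)

lemma even_perms_comp:
  "finite S \<Longrightarrow> p \<in> even_perms S \<Longrightarrow> q \<in> even_perms S \<Longrightarrow> p \<circ> q \<in> even_perms S"
  unfolding even_perms_def by (auto simp: permutes_compose evenperm_comp permutes_imp_permutation)

lemma even_perms_inv: "finite S \<Longrightarrow> p \<in> even_perms S \<Longrightarrow> inv' p \<in> even_perms S"
  unfolding even_perms_def by (auto simp: permutes_inv evenperm_inv permutes_imp_permutation)

lemma even_perms_mono: "S \<subseteq> T \<Longrightarrow> even_perms S \<subseteq> even_perms T"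
  unfolding even_perms_def by (auto intro: permutes_subset)

lemma finite_even_perms: "finite S \<Longrightarrow> finite (even_perms S)"
  unfolding even_perms_def by (rule finite_subset[OF _ finite_permutations]) auto

lemma even_perms_bij: "p \<in> even_perms S \<Longrightarrow> bij p"
  by (auto simp: even_perms_def permutes_bij)

lemma card_even_perms:
  assumes "finite S" "2 \<le> card S"
  shows "2 * card (even_perms S) = fact (card S)"
proof -
  obtain T where "T \<subseteq> S" "card T = 2" using obtain_subset_with_card_n[OF assms(2)] by metis
  then obtain a b where ab: "a \<in> S" "b \<in> S" "a \<noteq> b" by (auto simp: card_2_iff)
  define t where "t = transpose a b"
  let ?P = "{p. p permutes S}" and ?O = "{p. p permutes S \<and> \<not> evenperm p}"
  have t: "t permutes S" "permutation t" "\<not> evenperm t"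
    using ab by (auto simp: t_def permutes_swap_id permutation_swap_id evenperm_swap)
  have tt: "t \<circ> (t \<circ> p) = p" for p by (auto simp: t_def fun_eq_iff)
  have perm: "permutation p" if "p permutes S" for p
    using that assms(1) permutes_imp_permutation by blast
  have "bij_betw ((\<circ>) t) (even_perms S) ?O"
    by (rule bij_betw_byWitness[where f' = "(\<circ>) t"])
       (use t in \<open>auto simp: tt even_perms_def permutes_compose evenperm_comp perm\<close>)
  then have "card (even_perms S) = card ?O" by (rule bij_betw_same_card)
  moreover have "?P = even_perms S \<union> ?O" "even_perms S \<inter> ?O = {}" by (auto simp: even_perms_def)
  moreover have "finite ?O" using finite_permutations[OF assms(1)] by (rule rev_finite_subset) auto
  ultimately show ?thesis
    using card_Un_disjoint[of "even_perms S" ?O] card_permutations[OF refl assms(1)]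
      finite_even_perms[OF assms(1)] by simp
qed

lemma even_perms_le_2:
  assumes "finite S" "card S \<le> 2" "p \<in> even_perms S"
  shows "p = id"
proof (cases "card S = 2")
  case True
  then obtain a b where ab: "S = {a, b}" "a \<noteq> b" by (auto simp: card_2_iff)
  with assms(3) have "p = id \<or> p = transpose a b"
    by (auto simp: even_perms_def permutes_doubleton_iff)
  with assms(3) ab show ?thesis by (auto simp: even_perms_def evenperm_swap)
next
  case False
  then have "card S \<le> 1" using assms(2) by simp
  then have "S = {} \<or> (\<exists>a. S = {a})"
    using assms(1) by (metis One_nat_def card_1_singletonE card_eq_0_iff le_SucE le_zero_eq)
  then show ?thesis using assms(3) by (auto simp: even_perms_def)
qed

lemma even_perms_move:
  assumes "finite S" "3 \<le> card S" "i \<in> S" "j \<in> S"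
  obtains p where "p \<in> even_perms S" "p i = j"
proof (cases "i = j")
  case True
  then show ?thesis using that[of id] by simp
next
  case False
  have "\<not> S \<subseteq> {i, j}" using assms(2) False card_mono[of "{i, j}" S] by auto
  then obtain k where k: "k \<in> S" "k \<noteq> i" "k \<noteq> j" by blast
  have d: "distinct [i, j, k]" using k False by simp
  show ?thesis
    by (rule that[of "three_cycle i j k"])
       (use three_cycle_even_perms[OF d, of S] three_cycle_apply[OF d] k assms in auto)
qed

lemma even_perms_fix_move:
  assumes "finite S" "4 \<le> card S" "i \<in> S" "j \<in> S" "i \<noteq> j"
  obtains p where "p \<in> even_perms S" "p i = i" "p j \<noteq> j"
proof -
  have c: "3 \<le> card (S - {i})" using assms by simp
  then have "\<not> S - {i} \<subseteq> {j}" using card_mono[of "{j}" "S - {i}"] by auto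
  then obtain k where k: "k \<in> S - {i}" "k \<noteq> j" by blast
  obtain p where p: "p \<in> even_perms (S - {i})" "p j = k"
    using even_perms_move[of "S - {i}" j k] assms c k by auto
  then have "p i = i" by (auto simp: even_perms_def permutes_not_in)
  moreover have "p \<in> even_perms S" using p(1) even_perms_mono[of "S - {i}" S] by blast
  ultimately show ?thesis using that p(2) k by metis
qed

text \<open>One three-cycle brings a moved point back to its place; induct on the support.\<close>

lemma even_perms_subset_of_three_cycles:
  assumes "finite S" "id \<in> H" "\<And>p q. p \<in> H \<Longrightarrow> q \<in> H \<Longrightarrow> p \<circ> q \<in> H"
    and "\<And>a b c. distinct [a, b, c] \<Longrightarrow> {a, b, c} \<subseteq> S \<Longrightarrow> three_cycle a b c \<in> H"
  shows "even_perms S \<subseteq> H"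
  using assms(1,4)
proof (induction S rule: finite_psubset_induct)
  case (psubset S)
  show ?case
  proof
    fix p assume p: "p \<in> even_perms S"
    show "p \<in> H"
    proof (cases "card S \<le> 2")
      case True
      then show ?thesis using even_perms_le_2[OF psubset.hyps _ p] assms(2) by simp
    next
      case False
      show ?thesis
      proof (cases "p = id")
        case True
        then show ?thesis using assms(2) by simp
      next
        case False
        then obtain a where a: "p a \<noteq> a" by (auto simp: fun_eq_iff)
        have pS: "p permutes S" using p by (simp add: even_perms_def)
        have aS: "a \<in> S" "p a \<in> S" using a pS permutes_not_in permutes_in_image by metis+
        have "\<not> S \<subseteq> {a, p a}" using \<open>\<not> card S \<le> 2\<close> card_mono[of "{a, p a}" S] a by auto
        then obtain c where c: "c \<in> S" "c \<noteq> a" "c \<noteq> p a" by blast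
        have d: "distinct [p a, a, c]" "distinct [a, p a, c]" using a c by auto
        define q where "q = three_cycle (p a) a c \<circ> p"
        have q: "q \<in> even_perms S"
          unfolding q_def using p aS c d psubset.hyps by (intro even_perms_comp three_cycle_even_perms) auto
        have "q a = a" unfolding q_def by (simp add: three_cycle_apply[OF d(1)])
        then have "q permutes (S - {a})"
          using permutes_superset[of q S "S - {a}"] q by (force simp: even_perms_def)
        then have "q \<in> even_perms (S - {a})" using q by (simp add: even_perms_def)
        then have "q \<in> H" using psubset.IH[of "S - {a}"] psubset.prems aS by blast
        moreover have "p = three_cycle a (p a) c \<circ> q"
          unfolding q_def using d by (auto simp: fun_eq_iff three_cycle_apply split: if_splits)
        ultimately show ?thesis
          using assms(3) psubset.prems[OF d(2)] aS c by (metis empty_subsetI insert_subset)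
      qed
    qed
  qed
qed

text \<open>The supports of \<open>g\<close> and \<open>h\<close> meet only in \<open>d\<close>:
  apart from \<open>d\<close>, a point moved by one is fixed by the other. So the commutator can
  only disturb \<open>d\<close> and its two images.\<close>

lemma commutator_three_cycle:
  assumes "bij g" "bij h" "g d \<noteq> d" "h d \<noteq> d" "\<And>x. x \<noteq> d \<Longrightarrow> g x = x \<or> h x = x"
  shows "g \<circ> h \<circ> inv' g \<circ> inv' h = three_cycle d (g d) (h d)"
proof (rule three_cycle_eqI)
  have gi: "g (inv' g x) = x" "inv' g (g x) = x" "h (inv' h x) = x" "inv' h (h x) = x" for x
    using assms by (auto simp: bij_is_inj bij_is_surj surj_f_inv_f)
  have fixi: "inv' g x = x \<longleftrightarrow> g x = x" "inv' h x = x \<longleftrightarrow> h x = x" for x using gi by metis+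
  have sg: "h x = x" if "g x \<noteq> x" "x \<noteq> d" for x using that assms(5) by blast
  have mg: "g (g d) \<noteq> g d" "g (inv' g d) \<noteq> inv' g d" "inv' g d \<noteq> d" using gi assms(3) by metis+
  have mh: "h (h d) \<noteq> h d" "h (inv' h d) \<noteq> inv' h d" "inv' h d \<noteq> d" using gi assms(4) by metis+
  have 1: "h (g d) = g d" "h (inv' g d) = inv' g d" using sg mg assms(3) by auto
  have 2: "g (h d) = h d" "g (inv' h d) = inv' h d" using assms(5) mh assms(4) by blast+
  show "distinct [d, g d, h d]" using assms(3,4) 1 mh by auto
  show "(g \<circ> h \<circ> inv' g \<circ> inv' h) d = g d" using 2 gi by (metis comp_apply fixi(1))
  show "(g \<circ> h \<circ> inv' g \<circ> inv' h) (g d) = h d" using 1 2 gi by (metis comp_apply fixi(2))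
  show "(g \<circ> h \<circ> inv' g \<circ> inv' h) (h d) = d" using 1 gi by simp
  show "(g \<circ> h \<circ> inv' g \<circ> inv' h) x = x" if x: "x \<notin> {d, g d, h d}" for x
  proof (cases "h x = x")
    case True
    have "inv' g x \<noteq> d" using x gi by force
    then have "h (inv' g x) = inv' g x" 
      using assms(5)[of "inv' g x"] True gi by metis
    moreover have "inv' h x = x" using True fixi by simp
    ultimately show ?thesis using gi by simp
  next
    case False
    then have "g x = x" using assms(5) x by blast
    have "inv' h x \<noteq> d" using x gi by force
    moreover have "h (inv' h x) \<noteq> inv' h x" using gi False by metis
    ultimately have "g (inv' h x) = inv' h x" using assms(5) by blast
    then have "inv' g (inv' h x) = inv' h x" using fixi by simp
    then show ?thesis using gi \<open>g x = x\<close> by simp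
  qed
qed

lemma card_le_card_image_times:
  assumes "finite A" "\<And>x. x \<in> A \<Longrightarrow> card {z \<in> A. f z = f x} \<le> k"
  shows "card A \<le> card (f ` A) * k"
proof -
  have "card A = card (\<Union>y\<in>f ` A. {z \<in> A. f z = y})" by (rule arg_cong[of _ _ card]) auto
  also have "\<dots> \<le> (\<Sum>y\<in>f ` A. card {z \<in> A. f z = y})" using assms(1) by (intro card_UN_le) auto
  also have "\<dots> \<le> of_nat (card (f ` A)) * k" using assms(2) by (intro sum_bounded_above) auto
  finally show ?thesis by simp
qed

section \<open>Classes of points linked by three-cycles\<close>

locale even_perm_subgroup =
  fixes \<Omega> :: "'a set" and H :: "('a \<Rightarrow> 'a) set"
  assumes finite_\<Omega>: "finite \<Omega>"
    and H_sub: "H \<subseteq> even_perms \<Omega>"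
    and H_id: "id \<in> H"
    and H_comp: "\<And>p q. p \<in> H \<Longrightarrow> q \<in> H \<Longrightarrow> p \<circ> q \<in> H"
    and H_inv: "\<And>p. p \<in> H \<Longrightarrow> inv' p \<in> H"
begin

lemma H_bij: "h \<in> H \<Longrightarrow> bij h"
  using H_sub even_perms_bij by blast

lemma H_permutes: "h \<in> H \<Longrightarrow> h permutes \<Omega>"
  using H_sub by (auto simp: even_perms_def)

lemma H_conj:
  assumes "distinct [a, b, c]" "three_cycle a b c \<in> H" "h \<in> H"
  shows "three_cycle (h a) (h b) (h c) \<in> H"
  using conj_three_cycle[OF H_bij[OF assms(3)] assms(1)] H_comp H_inv assms by metis

text \<open>Asking for just one third point makes the relation easy to establish;
  \<open>three_cycle_linked\<close> later upgrades this to every third point of the class.\<close>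

definition linked :: "'a \<Rightarrow> 'a \<Rightarrow> bool" where
  "linked a b \<longleftrightarrow> a = b \<or> (\<exists>c. distinct [a, b, c] \<and> three_cycle a b c \<in> H)"

lemma linkedE:
  assumes "linked a b" "a \<noteq> b"
  obtains c where "distinct [a, b, c]" "three_cycle a b c \<in> H"
  using assms by (auto simp: linked_def)

lemma linkedI: "distinct [a, b, c] \<Longrightarrow> three_cycle a b c \<in> H \<Longrightarrow> linked a b"
  unfolding linked_def by blast

lemma three_cycle_reverse_H:
  assumes "distinct [a, b, c]" "three_cycle a b c \<in> H"
  shows "three_cycle b a c \<in> H"
  using inv_three_cycle[OF assms(1)] H_inv[OF assms(2)] by simp

lemma three_cycle_rotate_H:
  assumes "distinct [a, b, c]" "three_cycle a b c \<in> H"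
  shows "three_cycle b c a \<in> H"
  using three_cycle_rotate[OF assms(1)] assms by simp

lemma linked_sym:
  assumes "linked a b"
  shows "linked b a"
proof (cases "a = b")
  case False
  then obtain c where c: "distinct [a, b, c]" "three_cycle a b c \<in> H" using linkedE assms by blast
  show ?thesis by (rule linkedI[of b a c]) (use c three_cycle_reverse_H[OF c] in auto)
qed (simp add: linked_def)

text \<open>Unless the three-cycle on \<open>a\<close> and \<open>b\<close> already passes through
  \<open>c\<close>, its inverse carries \<open>b\<close> to \<open>a\<close> and fixes
  \<open>c\<close>; conjugating the three-cycle on \<open>b\<close> and \<open>c\<close> by it links
  \<open>a\<close> to \<open>c\<close>.\<close>

lemma linked_trans:
  assumes "linked a b" "linked b c"
  shows "linked a c"
proof (cases "a = b \<or> b = c \<or> a = c")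
  case True
  then show ?thesis using assms by (auto simp: linked_def)
next
  case False
  obtain x where x: "distinct [a, b, x]" "three_cycle a b x \<in> H" using linkedE assms False by blast
  obtain y where y: "distinct [b, c, y]" "three_cycle b c y \<in> H" using linkedE assms False by blast
  show ?thesis
  proof (cases "x = c")
    case True
    have "three_cycle c a b \<in> H" using x True three_cycle_rotate_H by force
    then have "three_cycle a c b \<in> H" using three_cycle_reverse_H[of c a b] x(1) True by auto
    then show ?thesis by (intro linkedI[of a c b]) (use x True in auto)
  next
    case neq: False
    have d: "distinct [b, a, x]" using x(1) by auto
    have g: "three_cycle b a x \<in> H" using x three_cycle_reverse_H by blast
    have "three_cycle (three_cycle b a x b) (three_cycle b a x c) (three_cycle b a x y) \<in> H"
      using H_conj[OF y g] .
    moreover have "three_cycle b a x b = a" "three_cycle b a x c = c"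
      using False neq by (auto simp: three_cycle_apply[OF d])
    ultimately have H: "three_cycle a c (three_cycle b a x y) \<in> H" by simp
    show ?thesis
    proof (rule linkedI[OF _ H])
      show "distinct [a, c, three_cycle b a x y]"
        using False neq y(1) d by (auto simp: three_cycle_apply[OF d])
    qed
  qed
qed

lemma linked_H: "h \<in> H \<Longrightarrow> linked a b \<Longrightarrow> linked (h a) (h b)"
proof (cases "a = b")
  case False
  assume h: "h \<in> H" "linked a b"
  then obtain c where c: "distinct [a, b, c]" "three_cycle a b c \<in> H" using linkedE False by blast
  have "distinct [h a, h b, h c]" using c(1) H_bij[OF h(1)] by (auto dest: bij_is_inj injD)
  then show "linked (h a) (h b)" using H_conj[OF c h(1)] linkedI by blast
qed (simp add: linked_def)

text \<open>Conjugating (a b x) by a three-cycle (x c z) replaces \<open>x\<close> by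
  \<open>c\<close>, which is all that is wanted if \<open>z\<close> is neither \<open>a\<close> nor
  \<open>b\<close>. If \<open>z\<close> is one of them, conjugating a second time produces the
  inverse of (a b c).\<close>

lemma three_cycle_linked:
  assumes "distinct [a, b, c]" "linked a b" "linked a c"
  shows "three_cycle a b c \<in> H"
proof -
  obtain x where x: "distinct [a, b, x]" "three_cycle a b x \<in> H" using linkedE assms by force
  show ?thesis
  proof (cases "x = c")
    case True
    then show ?thesis using x by simp
  next
    case xc: False
    have "three_cycle x a b \<in> H"
      using three_cycle_rotate_H[of a b x] three_cycle_rotate_H[of b x a] x by auto
    then have "linked x a" using x(1) by (intro linkedI[of x a b]) auto
    with assms(3) have "linked x c" using linked_trans by blast
    then obtain z where z: "distinct [x, c, z]" "three_cycle x c z \<in> H" using linkedE xc by blast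
    note k = H_conj[OF _ _ z(2)] and ap = three_cycle_apply[OF z(1)]
    consider "z = a" | "z = b" | "z \<noteq> a" "z \<noteq> b" by blast
    then show ?thesis
    proof cases
      case 1
      have "three_cycle x b c \<in> H" using k[OF x] assms(1) x(1) xc by (auto simp: ap[unfolded 1] 1 split: if_splits)
      moreover have "distinct [x, b, c]" using x(1) assms(1) xc by auto
      ultimately have "three_cycle c b a \<in> H" using k[of x b c] assms(1) x(1) xc by (auto simp: ap[unfolded 1] 1 split: if_splits)
      then have "three_cycle b c a \<in> H" using three_cycle_reverse_H[of c b a] assms(1) by auto
      then show ?thesis using three_cycle_rotate_H[of b c a] three_cycle_rotate_H[of c a b] assms(1) by auto
    next
      case 2
      have "three_cycle a x c \<in> H" using k[OF x] assms(1) x(1) xc by (auto simp: ap[unfolded 2] 2 split: if_splits)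
      moreover have "distinct [a, x, c]" using x(1) assms(1) xc by auto
      ultimately have "three_cycle a c b \<in> H" using k[of a x c] assms(1) x(1) xc by (auto simp: ap[unfolded 2] 2 split: if_splits)
      then have "three_cycle c a b \<in> H" using three_cycle_reverse_H[of a c b] assms(1) by auto
      then show ?thesis using three_cycle_rotate_H[of c a b] assms(1) by auto
    next
      case 3
      show ?thesis using k[OF x] assms(1) x(1) xc 3 by (auto simp: ap split: if_splits)
    qed
  qed
qed

definition linkage_class :: "'a \<Rightarrow> 'a set" where
  "linkage_class a = {b \<in> \<Omega>. linked a b}"

lemma linkage_class_self: "a \<in> \<Omega> \<Longrightarrow> a \<in> linkage_class a"
  by (simp add: linkage_class_def linked_def)

lemma linkage_class_eq: "b \<in> linkage_class a \<Longrightarrow> linkage_class b = linkage_class a"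
  unfolding linkage_class_def using linked_sym linked_trans by blast

lemma linkage_class_disjoint: "linkage_class a = linkage_class b \<or> linkage_class a \<inter> linkage_class b = {}"
  using linkage_class_eq by blast

lemma finite_linkage_class: "finite (linkage_class a)"
  using finite_\<Omega> by (simp add: linkage_class_def)

lemma even_perms_linkage_class: "even_perms (linkage_class a) \<subseteq> H"
proof (rule even_perms_subset_of_three_cycles)
  fix x y z assume d: "distinct [x, y, z]" and "{x, y, z} \<subseteq> linkage_class a"
  then have l: "linked a x" "linked a y" "linked a z" by (auto simp: linkage_class_def)
  have "linked x a" using linked_sym[OF l(1)] .
  then show "three_cycle x y z \<in> H" using three_cycle_linked[OF d] linked_trans l by metis
qed (fact finite_linkage_class H_id | erule (1) H_comp)+

lemma image_linkage_class:
  assumes "h \<in> H"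
  shows "h ` linkage_class a = linkage_class (h a)"
proof -
  have sub: "g ` linkage_class b \<subseteq> linkage_class (g b)" if "g \<in> H" for g b
    using that linked_H permutes_in_image[OF H_permutes] by (auto simp: linkage_class_def)
  have gi: "h (inv' h x) = x" "inv' h (h x) = x" for x
    using H_bij[OF assms] by (auto simp: bij_is_inj bij_is_surj surj_f_inv_f)
  have "inv' h ` linkage_class (h a) \<subseteq> linkage_class a"
    using sub[OF H_inv[OF assms], of "h a"] gi by simp
  then have "h ` inv' h ` linkage_class (h a) \<subseteq> h ` linkage_class a" by (rule image_mono)
  then show ?thesis using sub[OF assms] gi by (force simp: image_image)
qed

end

section \<open>Counting cosets\<close>

locale even_perm_subgroup_index = even_perm_subgroup +
  fixes f :: "('a \<Rightarrow> 'a) \<Rightarrow> 'x"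
  assumes f_eq: "\<And>p q. p \<in> even_perms \<Omega> \<Longrightarrow> q \<in> even_perms \<Omega> \<Longrightarrow> f p = f q \<longleftrightarrow> inv' p \<circ> q \<in> H"
begin

text \<open>\<open>f\<close> stands for the orbit map of a point with stabilizer \<open>H\<close>.
  By \<open>f_eq\<close> its fibres are the left cosets of \<open>H\<close>, so an orbit length
  serves as the index and no coset space has to be formed.\<close>

abbreviation index :: nat where "index \<equiv> card (f ` even_perms \<Omega>)"

text \<open>Left translation by \<open>inv' p\<close> carries the fibre through \<open>p\<close>
  injectively into \<open>H \<inter> even_perms T\<close>, so no fibre is larger than that
  set.\<close>

lemma card_even_perms_le_index:
  assumes "T \<subseteq> \<Omega>"
  shows "card (even_perms T) \<le> index * card (H \<inter> even_perms T)"
proof -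
  have finT: "finite T" using assms finite_\<Omega> finite_subset by blast
  have sub: "even_perms T \<subseteq> even_perms \<Omega>" using even_perms_mono assms by blast
  have "card (even_perms T) \<le> card (f ` even_perms T) * card (H \<inter> even_perms T)"
  proof (rule card_le_card_image_times[OF finite_even_perms[OF finT]])
    fix p assume p: "p \<in> even_perms T"
    have "inj_on ((\<circ>) (inv' p)) {q \<in> even_perms T. f q = f p}"
    proof (rule inj_onI)
      fix q r assume "inv' p \<circ> q = inv' p \<circ> r"
      then have "p \<circ> inv' p \<circ> q = p \<circ> inv' p \<circ> r" by (simp add: comp_assoc)
      moreover have "p \<circ> inv' p = id" using even_perms_bij[OF p] bij_is_surj surj_iff by blast
      ultimately show "q = r" by simp
    qed
    moreover have "((\<circ>) (inv' p)) ` {q \<in> even_perms T. f q = f p} \<subseteq> H \<inter> even_perms T"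
      using p sub f_eq even_perms_comp[OF finT even_perms_inv[OF finT p]] by fastforce
    ultimately show "card {q \<in> even_perms T. f q = f p} \<le> card (H \<inter> even_perms T)"
      using finite_even_perms[OF finT] by (intro card_inj_on_le) auto
  qed
  also have "\<dots> \<le> index * card (H \<inter> even_perms T)"
    using sub finite_even_perms[OF finite_\<Omega>] by (intro mult_right_mono card_mono) auto
  finally show ?thesis .
qed

text \<open>Each \<open>c\<close>-subset of \<open>\<Omega>\<close> is a translate of a class of size \<open>c\<close>, and translates by elements of the
  same coset of \<open>H\<close> involve the same partition into classes.\<close>

lemma choose_le_index:
  assumes "a \<in> \<Omega>" "card (linkage_class a) = c" "2 \<le> c"
  shows "card \<Omega> choose c \<le> index * card {K. K \<in> linkage_class ` \<Omega> \<and> card K = c}"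
proof -
  let ?C = "linkage_class a" and ?S = "{K. K \<subseteq> \<Omega> \<and> card K = c}"
  let ?R = "{K. K \<in> linkage_class ` \<Omega> \<and> card K = c}"
  have C: "?C \<subseteq> \<Omega>" by (auto simp: linkage_class_def)
  have finR: "finite ?R" using finite_\<Omega> by simp
  have finS: "finite ?S" using finite_\<Omega> by simp
  have ex: "\<exists>p\<in>even_perms \<Omega>. p ` ?C = K" if K: "K \<in> ?S" for K
  proof -
    have finK: "finite K" using K finite_\<Omega> finite_subset by blast
    obtain g where g: "bij_betw g ?C K"
      using finite_same_card_bij[OF finite_linkage_class finK] assms K by auto
    obtain g' where g': "bij_betw g' (\<Omega> - ?C) (\<Omega> - K)"
    proof -
      have "card (\<Omega> - ?C) = card (\<Omega> - K)"
        using K C assms(2) finK finite_linkage_class by (simp add: card_Diff_subset)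
      then show ?thesis using that finite_same_card_bij finite_\<Omega> by (metis finite_Diff)
    qed
    define p where "p x = (if x \<in> ?C then g x else if x \<in> \<Omega> then g' x else x)" for x
    have "bij_betw p (?C \<union> (\<Omega> - ?C)) (K \<union> (\<Omega> - K))"
    proof (rule bij_betw_combine)
      show "bij_betw p ?C K" using g by (rule bij_betw_cong[THEN iffD1, rotated]) (simp add: p_def)
      show "bij_betw p (\<Omega> - ?C) (\<Omega> - K)"
        using g' by (rule bij_betw_cong[THEN iffD1, rotated]) (simp add: p_def)
    qed auto
    moreover have "?C \<union> (\<Omega> - ?C) = \<Omega>" "K \<union> (\<Omega> - K) = \<Omega>" using C K by auto
    ultimately have p: "p permutes \<Omega>" using C by (intro bij_imp_permutes) (auto simp: p_def)
    have pC: "p ` ?C = K" using g by (auto simp: p_def bij_betw_def)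
    show ?thesis
    proof (cases "evenperm p")
      case True
      then show ?thesis using p pC by (auto simp: even_perms_def)
    next
      case False
      \<comment> \<open>A transposition inside the class does not change the image of the class and
        repairs the parity; this is where \<open>2 \<le> c\<close> enters.\<close>
      obtain T where "T \<subseteq> ?C" "card T = 2" using obtain_subset_with_card_n[of 2 ?C] assms by metis
      then obtain x y where xy: "x \<in> ?C" "y \<in> ?C" "x \<noteq> y" by (auto simp: card_2_iff)
      let ?t = "transpose x y"
      have "?t ` ?C = ?C" using xy by (auto simp: transpose_def image_iff)
      then have "(p \<circ> ?t) ` ?C = K" using pC by (metis image_comp)
      moreover have "p \<circ> ?t \<in> even_perms \<Omega>"
        using p xy C False finite_\<Omega> permutes_imp_permutation[OF finite_\<Omega> p]
        by (auto simp: even_perms_def evenperm_comp permutation_swap_id evenperm_swap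
            intro!: permutes_compose permutes_swap_id)
      ultimately show ?thesis by blast
    qed
  qed
  define P where "P K = (SOME p. p \<in> even_perms \<Omega> \<and> p ` ?C = K)" for K
  have P: "P K \<in> even_perms \<Omega>" "P K ` ?C = K" if "K \<in> ?S" for K
    using someI_ex[of "\<lambda>p. p \<in> even_perms \<Omega> \<and> p ` ?C = K"] ex[OF that] by (auto simp: P_def)
  have "card ?S \<le> card ((\<lambda>K. f (P K)) ` ?S) * card ?R"
  proof (rule card_le_card_image_times[OF finS])
    fix K assume K: "K \<in> ?S"
    have "{K' \<in> ?S. f (P K') = f (P K)} \<subseteq> (\<lambda>L. P K ` L) ` ?R"
    proof
      fix K' assume "K' \<in> {K' \<in> ?S. f (P K') = f (P K)}"
      then have K': "K' \<in> ?S" "f (P K) = f (P K')" by auto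
      define h where "h = inv' (P K) \<circ> P K'"
      have h: "h \<in> H" unfolding h_def using f_eq[OF P(1)[OF K] P(1)[OF K'(1)]] K'(2) by simp
      have "P K \<circ> h = P K'"
        unfolding h_def using even_perms_bij[OF P(1)[OF K]]
        by (simp add: fun_eq_iff bij_is_surj surj_f_inv_f)
      then have "P K ` (h ` ?C) = K'" using P(2)[OF K'(1)] by (metis image_comp)
      moreover have "h ` ?C \<in> ?R"
      proof -
        have "h ` ?C = linkage_class (h a)" "h a \<in> \<Omega>"
          using image_linkage_class[OF h] permutes_in_image[OF H_permutes[OF h]] assms(1) by auto
        moreover have "card (h ` ?C) = c"
          using assms(2) H_bij[OF h] card_image[of h ?C] by (simp add: bij_is_inj inj_on_subset[OF _ subset_UNIV])
        ultimately show ?thesis by auto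
      qed
      ultimately show "K' \<in> (\<lambda>L. P K ` L) ` ?R" by blast
    qed
    then show "card {z \<in> ?S. f (P z) = f (P K)} \<le> card ?R"
      using finR by (rule surj_card_le[rotated])
  qed
  also have "\<dots> \<le> index * card ?R"
    using P(1) finite_even_perms[OF finite_\<Omega>] by (intro mult_right_mono card_mono) auto
  finally show ?thesis using n_subsets[OF finite_\<Omega>] by simp
qed

lemma card_classes_times_le:
  "card {K. K \<in> linkage_class ` \<Omega> \<and> card K = c} * c \<le> card \<Omega>"
proof -
  let ?R = "{K. K \<in> linkage_class ` \<Omega> \<and> card K = c}"
  have "\<Union>?R \<subseteq> \<Omega>" by (auto simp: linkage_class_def)
  moreover have "c * card ?R = card (\<Union>?R)"
  proof (rule card_partition)
    show "finite ?R" "finite (\<Union>?R)" using finite_\<Omega> finite_linkage_class by auto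
    show "K \<inter> L = {}" if "K \<in> ?R" "L \<in> ?R" "K \<noteq> L" for K L
      using that linkage_class_disjoint by force
  qed simp
  ultimately show ?thesis using card_mono[OF finite_\<Omega>] by (metis mult.commute)
qed

end

section \<open>Numerical estimates\<close>

lemma fact_ge_16_times: "5 \<le> k \<Longrightarrow> 16 * k \<le> (fact k :: nat)"
proof (induction k rule: dec_induct)
  case base
  then show ?case by (simp add: fact_numeral)
next
  case (step k)
  have "16 * Suc k \<le> Suc k * (16 * k)" using step.hyps by simp
  also have "\<dots> \<le> Suc k * fact k" using step.IH by (intro mult_le_mono2)
  finally show ?case by simp
qed

text \<open>To be used with \<open>N\<close> points, index \<open>m\<close>, and \<open>r\<close>
  classes of size \<open>c\<close>. If 2c > N there is at most one such class. Otherwise the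
  absorption identity for \<open>c * (N choose c)\<close> allows the product \<open>r * c\<close> to
  be replaced by \<open>N\<close>. Either way a binomial coefficient of degree at least 2 would have
  to stay below the linear bound on \<open>m\<close>.\<close>

lemma choose_gt_linear:
  fixes N c r m :: nat
  assumes "9 \<le> N" "m + 3 \<le> 4 * N" "3 \<le> c" "c + 2 \<le> N" "r * c \<le> N" "N choose c \<le> m * r"
  shows "N = 9 \<and> c = 3 \<and> r = 3"
proof -
  have c2: "2 * (k choose 2) = k * (k - 1)" for k :: nat
  proof -
    have "even (k * (k - 1))" by (cases k) auto
    then show ?thesis by (simp add: choose_two)
  qed
  consider "N < 2 * c" | "2 * c \<le> N" "4 \<le> c" | "c = 3" using assms(3) by linarith
  then show ?thesis
  proof cases
    case 1
    have "r \<le> 1"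
    proof (rule ccontr)
      assume "\<not> r \<le> 1"
      then have "2 * c \<le> r * c" by (intro mult_le_mono1) simp
      then show False using 1 assms(5) by linarith
    qed
    then have "m * r \<le> m" using mult_le_mono2[of r 1 m] by simp
    moreover have "N choose 2 \<le> N choose (N - c)" using 1 assms(4) by (intro binomial_mono) auto
    ultimately have "N choose 2 \<le> m" using assms(4,6) binomial_symmetric[of c N] by linarith
    then have "N * (N - 1) \<le> 2 * m" using c2[of N] by linarith
    moreover have "N * 8 \<le> N * (N - 1)" using assms(1) by (intro mult_le_mono2) simp
    ultimately show ?thesis using assms by linarith
  next
    case 2
    have "N * ((N - 1) choose (c - 1)) = c * (N choose c)"
      using times_binomial_minus1_eq[of c N] 2 by simp
    also have "\<dots> \<le> c * (m * r)" using assms(6) by (rule mult_le_mono2)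
    also have "\<dots> = m * (r * c)" by simp
    also have "\<dots> \<le> m * N" using assms(5) by (rule mult_le_mono2)
    finally have "(N - 1) choose (c - 1) \<le> m" using assms(1) by simp
    moreover have "(N - 1) choose 3 \<le> (N - 1) choose (c - 1)"
      using 2 by (intro binomial_mono) auto
    moreover have "6 * ((N - 1) choose 3) = (N - 1) * ((N - 2) * (N - 3))"
    proof -
      have six: "6 = 2 * (3::nat)" by simp
      have "3 * ((N - 1) choose 3) = (N - 1) * ((N - 1 - 1) choose (3 - 1))"
        by (rule times_binomial_minus1_eq) simp
      moreover have "N - 1 - 1 = N - 2" "N - 2 - 1 = N - 3" "3 - 1 = (2::nat)" by simp_all
      ultimately have "3 * ((N - 1) choose 3) = (N - 1) * ((N - 2) choose 2)"
        "2 * ((N - 2) choose 2) = (N - 2) * (N - 3)" using c2[of "N - 2"] by metis+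
      then show ?thesis by (metis six mult.assoc mult.left_commute)
    qed
    moreover have "(N - 1) * (7 * 6) \<le> (N - 1) * ((N - 2) * (N - 3))"
      using assms(1) by (intro mult_le_mono2 mult_le_mono) auto
    ultimately have "42 * (N - 1) \<le> 6 * m" by linarith
    then show ?thesis using assms(1,2) by linarith
  next
    case 3
    have *: "3 * (N choose 3) = N * ((N - 1) choose 2)"
      using times_binomial_minus1_eq[of 3 N] by simp
    have c2': "2 * ((N - 1) choose 2) = (N - 1) * (N - 2)"
      using c2[of "N - 1"] by (metis diff_diff_left one_add_one)
    have t: "6 * (N choose 3) = N * ((N - 1) * (N - 2))"
      unfolding c2'[symmetric] using * by simp
    \<comment> \<open>For triples the quadratic estimate only works from N = 11 on. At N = 10, 120
      exceeds 37 * 3; at N = 9, 84 lies between 33 * 2 and 33 * 3, which is the surviving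
      case.\<close>
    consider "N = 9" | "N = 10" | "11 \<le> N" using assms(1) by linarith
    then show ?thesis
    proof cases
      case 1
      then have r: "r \<le> 3" "m \<le> 33" using assms 3 by auto
      have "m * r \<le> 33 * r" using r(2) by (rule mult_le_mono1)
      moreover have "N choose 3 = 84" using t 1 by simp
      ultimately have "r = 3" using assms(6) r(1) unfolding 3 by linarith
      then show ?thesis using 1 3 by simp
    next
      case 2
      then have r: "r \<le> 3" "m \<le> 37" using assms 3 by auto
      then have "m * r \<le> 37 * 3" by (intro mult_le_mono)
      moreover have "N choose 3 = 120" using t 2 by simp
      ultimately show ?thesis using assms(6) 3 by simp
    next
      case 11: 3
      have "N * ((N - 1) choose 2) \<le> m * (r * 3)" using * assms(6) 3 by simp
      also have "\<dots> \<le> m * N" using assms(5) 3 by (intro mult_le_mono2) simp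
      finally have "(N - 1) choose 2 \<le> m" using assms(1) by simp
      then have "(N - 1) * (N - 2) \<le> 2 * m" using c2' by linarith
      moreover have "(N - 1) * 9 \<le> (N - 1) * (N - 2)" using 11 by (intro mult_le_mono2) simp
      ultimately show ?thesis using assms by linarith
    qed
  qed
qed

section \<open>Subgroups of index at most 4N - 3\<close>

context even_perm_subgroup_index
begin

context
  assumes \<Omega>_ge: "9 \<le> card \<Omega>" and index_le: "index + 3 \<le> 4 * card \<Omega>"
begin

text \<open>If only the identity were left, the index would be at least |T|! / 2. As |T| \<ge> 5,
  this is at least 8 |T| \<ge> 4N, too large. The factor in \<open>fact_ge_16_times\<close> is
  chosen for this comparison.\<close>

lemma nontrivial_element_on_large_set:
  assumes "T \<subseteq> \<Omega>" "card \<Omega> \<le> 2 * card T"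
  shows "\<exists>g \<in> H \<inter> even_perms T. g \<noteq> id"
proof (rule ccontr)
  assume "\<not> ?thesis"
  then have "H \<inter> even_perms T \<subseteq> {id}" by blast
  then have "card (H \<inter> even_perms T) \<le> 1" using card_mono[of "{id}" "H \<inter> even_perms T"] by simp
  then have "index * card (H \<inter> even_perms T) \<le> index * 1" by (rule mult_le_mono2)
  then have "card (even_perms T) \<le> index" using card_even_perms_le_index[OF assms(1)] by linarith
  moreover have "2 * card (even_perms T) = fact (card T)"
    using assms \<Omega>_ge finite_subset[OF assms(1) finite_\<Omega>] by (intro card_even_perms) auto
  moreover have "16 * card T \<le> fact (card T)" using assms \<Omega>_ge by (intro fact_ge_16_times) linarith
  ultimately show False using index_le assms(2) \<Omega>_ge by linarith
qed

text \<open>Following Bochert: let \<open>S\<close> be a maximal set supporting no non-trivial element of \<open>H\<close>. Then some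
  \<open>g \<in> H\<close> is supported off \<open>S\<close>, and for a point \<open>d\<close> moved by \<open>g\<close> some \<open>h \<in> H\<close> supported on
  \<open>S \<union> {d}\<close> moves \<open>d\<close>; now take the commutator.\<close>

lemma obtain_large_linkage_class:
  obtains d where "d \<in> \<Omega>" "3 \<le> card (linkage_class d)"
proof -
  let ?free = "\<lambda>S. S \<subseteq> \<Omega> \<and> H \<inter> even_perms S \<subseteq> {id}"
  have "?free {}" by (auto simp: even_perms_def)
  moreover have "\<forall>S. ?free S \<longrightarrow> card S < Suc (card \<Omega>)"
    using card_mono[OF finite_\<Omega>] by (auto simp: less_Suc_eq_le)
  ultimately obtain S where S: "?free S" and max: "\<And>S'. ?free S' \<Longrightarrow> card S' \<le> card S"
    using ex_has_greatest_nat[of ?free "{}" card "Suc (card \<Omega>)"] by blast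
  have finS: "finite S" using S finite_\<Omega> finite_subset by blast
  have "2 * card S < card \<Omega>" using nontrivial_element_on_large_set[of S] S by force
  then have "card \<Omega> \<le> 2 * card (\<Omega> - S)" using S finS by (simp add: card_Diff_subset)
  then obtain g where g: "g \<in> H" "g \<in> even_perms (\<Omega> - S)" "g \<noteq> id"
    using nontrivial_element_on_large_set[of "\<Omega> - S"] by blast
  then obtain d where d: "g d \<noteq> d" by (auto simp: fun_eq_iff)
  have gp: "g permutes (\<Omega> - S)" using g by (simp add: even_perms_def)
  have dS: "d \<in> \<Omega>" "d \<notin> S" using d permutes_not_in[OF gp] by blast+
  have "\<not> ?free (insert d S)" using max[of "insert d S"] dS finS by auto
  then obtain h where h: "h \<in> H" "h \<in> even_perms (insert d S)" "h \<noteq> id" using S dS by blast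
  have hp: "h permutes insert d S" using h by (simp add: even_perms_def)
  have hd: "h d \<noteq> d"
  proof
    assume "h d = d"
    then have "h permutes S" using permutes_superset[OF hp, of S] by blast
    then have "h \<in> H \<inter> even_perms S" using h by (simp add: even_perms_def)
    then show False using S h(3) by blast
  qed
  have "g x = x \<or> h x = x" if "x \<noteq> d" for x
    using permutes_not_in[OF gp] permutes_not_in[OF hp] that by blast
  then have eq: "g \<circ> h \<circ> inv' g \<circ> inv' h = three_cycle d (g d) (h d)"
    using H_bij g(1) h(1) d hd by (intro commutator_three_cycle) auto
  have t: "three_cycle d (g d) (h d) \<in> H" unfolding eq[symmetric] by (intro H_comp H_inv g h)
  have gd: "g d \<in> \<Omega> - S" "h d \<in> S"
    using permutes_in_image[OF gp] permutes_in_image[OF hp] dS hd by auto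
  then have dist: "distinct [d, g d, h d]" using d hd by auto
  have "linked d (g d)" using linkedI[OF dist t] .
  moreover have "linked (h d) d"
    using three_cycle_rotate_H[of "g d" "h d" d] three_cycle_rotate_H[OF dist t] dist
    by (intro linkedI[of "h d" d "g d"]) auto
  ultimately have "{d, g d, h d} \<subseteq> linkage_class d"
    using linked_sym dS gd S by (auto simp: linkage_class_def linked_def)
  then have "card {d, g d, h d} \<le> card (linkage_class d)" by (rule card_mono[OF finite_linkage_class])
  then show ?thesis using that dS dist by simp
qed

text \<open>The numerical estimate leaves one case: three classes of size three. There the pointwise
  stabilizer of a transversal has at most \<open>2\<^sup>3\<close> elements, too few for the complementary six points.\<close>

lemma not_three_classes:
  assumes "card \<Omega> = 9" "card {K. K \<in> linkage_class ` \<Omega> \<and> card K = 3} = 3"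
  shows False
proof -
  define R where "R = {K. K \<in> linkage_class ` \<Omega> \<and> card K = 3}"
  have R3: "card R = 3" "finite R" using assms finite_\<Omega> by (auto simp: R_def)
  have disj: "K \<inter> L = {}" if "K \<in> R" "L \<in> R" "K \<noteq> L" for K L
    using that linkage_class_disjoint by (force simp: R_def)
  have R_sub: "K \<subseteq> \<Omega>" if "K \<in> R" for K using that by (auto simp: R_def linkage_class_def)
  then have Un: "\<Union>R \<subseteq> \<Omega>" by blast
  have "3 * card R = card (\<Union>R)"
    by (rule card_partition) (use R3 disj Un finite_\<Omega> finite_subset in \<open>auto simp: R_def\<close>)
  then have UR: "\<Union>R = \<Omega>" using Un card_subset_eq[OF finite_\<Omega>] R3 assms by simp
  have "\<forall>K\<in>R. \<exists>t. \<exists>b c. K = {t, b, c} \<and> distinct [t, b, c]"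
    unfolding R_def by (auto simp: card_3_iff)
  then obtain t where "\<forall>K\<in>R. \<exists>b. \<exists>c. K = {t K, b, c} \<and> distinct [t K, b, c]" by (metis (no_types))
  then obtain b where "\<forall>K\<in>R. \<exists>c. K = {t K, b K, c} \<and> distinct [t K, b K, c]" by (metis (no_types))
  then obtain c where K: "\<And>K. K \<in> R \<Longrightarrow> K = {t K, b K, c K} \<and> distinct [t K, b K, c K]" by (metis (no_types))
  define T where "T = \<Omega> - t ` R"
  have tK: "t K \<in> K" "b K \<in> K" "c K \<in> K" if "K \<in> R" for K using K[OF that] by blast+
  have "inj_on t R"
  proof (rule inj_onI)
    fix K L assume "K \<in> R" "L \<in> R" "t K = t L"
    then show "K = L" using disj tK(1) by (metis disjoint_iff)
  qed
  then have "card (t ` R) = 3" using R3 by (simp add: card_image)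
  moreover have "t ` R \<subseteq> \<Omega>" using tK R_sub by blast
  ultimately have cT: "card T = 6" unfolding T_def using assms finite_\<Omega>
    by (simp add: card_Diff_subset finite_subset)
  have hK: "h (t K) = t K \<and> (h (b K) = b K \<and> h (c K) = c K \<or> h (b K) = c K \<and> h (c K) = b K)"
    if hT: "h \<in> H \<inter> even_perms T" and KR: "K \<in> R" for h K
  proof -
    have "h permutes T" using hT by (simp add: even_perms_def)
    then have ht: "h (t K) = t K" using permutes_not_in KR by (fastforce simp: T_def)
    obtain a where "K = linkage_class a" using KR by (auto simp: R_def)
    then have "K = linkage_class (t K)" using linkage_class_eq tK(1)[OF KR] by simp
    then have "h ` K = K" using image_linkage_class[of h "t K"] ht hT by auto
    then have "h (b K) \<in> {t K, b K, c K}" "h (c K) \<in> {t K, b K, c K}" using K tK KR by blast+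
    moreover have "inj h" using H_bij hT by (auto dest: bij_is_inj)
    then have "h (b K) \<noteq> h (t K)" "h (c K) \<noteq> h (t K)" "h (b K) \<noteq> h (c K)"
      using K[OF KR] by (auto simp: inj_eq)
    ultimately show ?thesis unfolding ht by auto
  qed
  \<comment> \<open>In each class the point \<open>t K\<close> is fixed, so an element of
    \<open>H\<close> supported on \<open>T\<close> is known once it is known which of the three
    pairs \<open>b K\<close>, \<open>c K\<close> it leaves in place.\<close>
  have "inj_on (\<lambda>h. {K \<in> R. h (b K) = b K}) (H \<inter> even_perms T)"
  proof (rule inj_onI, rule ext)
    fix h h' x assume h: "h \<in> H \<inter> even_perms T" "h' \<in> H \<inter> even_perms T"
      and e: "{K \<in> R. h (b K) = b K} = {K \<in> R. h' (b K) = b K}"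
    show "h x = h' x"
    proof (cases "x \<in> \<Omega>")
      case True
      then obtain L where L: "L \<in> R" "x \<in> L" using UR by blast
      then have "x = t L \<or> x = b L \<or> x = c L" using K by blast
      moreover have "h (b L) = b L \<longleftrightarrow> h' (b L) = b L" using e L(1) by blast
      ultimately show ?thesis using hK[OF h(1) L(1)] hK[OF h(2) L(1)] K[OF L(1)] by auto
    next
      case False
      then show ?thesis using h H_permutes permutes_not_in by (metis IntD1)
    qed
  qed
  then have "card (H \<inter> even_perms T) \<le> card (Pow R)" using R3 by (intro card_inj_on_le) auto
  then have "card (H \<inter> even_perms T) \<le> 8" using R3 by (simp add: card_Pow)
  \<comment> \<open>The contradiction will be 360 > 33 * 8, where 360 is the order of the
    alternating group on the six points of \<open>T\<close>.\<close>
  then have "index * card (H \<inter> even_perms T) \<le> 33 * 8" using index_le assms by (intro mult_le_mono) auto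
  moreover have "T \<subseteq> \<Omega>" by (auto simp: T_def)
  moreover have "2 * card (even_perms T) = fact 6"
    using card_even_perms[of T] cT card.infinite[of T] by fastforce
  ultimately show False using card_even_perms_le_index[of T] by (simp add: fact_numeral)
qed

text \<open>The large class has N or N - 1 points. In the second case the point left out is a class
  of its own, and \<open>H\<close> fixes it, because an element moving it would carry a singleton
  class onto the large one.\<close>

theorem subgroup_of_small_index:
  "H = even_perms \<Omega> \<or> (\<exists>i\<in>\<Omega>. H = {p \<in> even_perms \<Omega>. p i = i})"
proof -
  obtain d where d: "d \<in> \<Omega>" "3 \<le> card (linkage_class d)" by (rule obtain_large_linkage_class)
  let ?C = "linkage_class d" and ?c = "card (linkage_class d)"
  have C: "?C \<subseteq> \<Omega>" by (auto simp: linkage_class_def)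
  have "card \<Omega> \<le> ?c + 1"
  proof (rule ccontr)
    assume "\<not> ?thesis"
    then have "card \<Omega> = 9 \<and> ?c = 3 \<and> card {K. K \<in> linkage_class ` \<Omega> \<and> card K = ?c} = 3"
      using d \<Omega>_ge index_le choose_le_index[OF d(1) refl] card_classes_times_le[of ?c]
      by (intro choose_gt_linear[of _ index]) auto
    then show False using not_three_classes by metis
  qed
  then consider "?c = card \<Omega>" | "card (\<Omega> - ?C) = 1"
    using C card_mono[OF finite_\<Omega> C] finite_linkage_class
    by (simp add: card_Diff_subset) linarith
  then show ?thesis
  proof cases
    case 1
    then have "?C = \<Omega>" using C card_subset_eq[OF finite_\<Omega>] by blast
    then show ?thesis using even_perms_linkage_class[of d] H_sub by auto
  next
    case 2
    then obtain i where i: "\<Omega> - ?C = {i}" by (auto simp: card_1_singleton_iff)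
    have ci: "linkage_class i = {i}"
    proof
      have "linkage_class i \<inter> ?C = {}"
        using linkage_class_disjoint[of i d] linkage_class_self[of i] i by blast
      moreover have "linkage_class i \<subseteq> \<Omega>" by (auto simp: linkage_class_def)
      ultimately show "linkage_class i \<subseteq> {i}" using i by blast
    qed (use linkage_class_self i in blast)
    have "h i = i" if "h \<in> H" for h
    proof (rule ccontr)
      assume "h i \<noteq> i"
      moreover have "h i \<in> \<Omega>" using permutes_in_image[OF H_permutes[OF that]] i by blast
      ultimately have "h i \<in> ?C" using i by blast
      then have "?C = {h i}" using linkage_class_eq image_linkage_class[OF that, of i] ci by simp
      then show False using d(2) by simp
    qed
    moreover have "p \<in> H" if "p \<in> even_perms \<Omega>" "p i = i" for p
    proof -
      have pO: "p permutes \<Omega>" using that(1) by (simp add: even_perms_def)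
      have "p permutes ?C" by (rule permutes_superset[OF pO]) (unfold i, use that(2) in simp)
      then show ?thesis using that even_perms_linkage_class[of d] by (auto simp: even_perms_def)
    qed
    ultimately show ?thesis using i H_sub by blast
  qed
qed

end

end

text \<open>The stabilizer of \<open>x\<close> serves as \<open>H\<close> and the orbit map as
  \<open>f\<close>. The action laws are demanded at \<open>x\<close> alone, so \<open>act\<close>
  may be arbitrary elsewhere; graph automorphisms are meaningful only on the vertices and darts of
  the graph.\<close>

lemma action_small_orbit:
  assumes "finite \<Omega>" "9 \<le> card \<Omega>"
    and "act id x = x"
    and act_comp: "\<And>p q. p \<in> even_perms \<Omega> \<Longrightarrow> q \<in> even_perms \<Omega> \<Longrightarrow> act (p \<circ> q) x = act p (act q x)"
    and "card ((\<lambda>p. act p x) ` even_perms \<Omega>) + 3 \<le> 4 * card \<Omega>"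
  shows "(\<forall>p\<in>even_perms \<Omega>. act p x = x) \<or> (\<exists>i\<in>\<Omega>. \<forall>p\<in>even_perms \<Omega>. act p x = x \<longleftrightarrow> p i = i)"
proof -
  let ?H = "{p \<in> even_perms \<Omega>. act p x = x}"
  have invs: "p \<circ> inv' p = id" "inv' p \<circ> p = id" if "p \<in> even_perms \<Omega>" for p
    using even_perms_bij[OF that] by (simp_all add: bij_is_surj surj_iff[symmetric] bij_is_inj)
  have act_inv: "act (inv' p) (act p x) = x" if "p \<in> even_perms \<Omega>" for p
    using act_comp[OF even_perms_inv[OF assms(1) that] that] invs[OF that] assms(3) by simp
  interpret even_perm_subgroup_index \<Omega> ?H "\<lambda>p. act p x"
  proof
    show "finite \<Omega>" by fact
    show "p \<circ> q \<in> ?H" if "p \<in> ?H" "q \<in> ?H" for p q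
      using that assms(1) act_comp even_perms_comp by auto
    show "inv' p \<in> ?H" if "p \<in> ?H" for p
      using that act_inv[of p] even_perms_inv[OF assms(1)] by auto
    show "act p x = act q x \<longleftrightarrow> inv' p \<circ> q \<in> ?H"
      if pq: "p \<in> even_perms \<Omega>" "q \<in> even_perms \<Omega>" for p q
    proof -
      have m: "inv' p \<circ> q \<in> even_perms \<Omega>" using pq assms(1) by (intro even_perms_comp even_perms_inv)
      have "act (inv' p \<circ> q) x = act (inv' p) (act q x)"
        by (rule act_comp[OF even_perms_inv[OF assms(1) pq(1)] pq(2)])
      moreover have "act q x = act p (act (inv' p \<circ> q) x)"
        using act_comp[OF pq(1) m] invs[OF pq(1)] by (simp add: comp_assoc[symmetric])
      ultimately show ?thesis using m act_inv[OF pq(1)] by (metis (mono_tags, lifting) mem_Collect_eq)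
    qed
  qed (use assms in auto)
  show ?thesis using subgroup_of_small_index[OF assms(2,5)] by blast
qed

section \<open>Homology and separating edges\<close>

context vector_space
begin

text \<open>The finite set \<open>W\<close> matters: the ambient space may have infinite dimension,
  and \<open>dim\<close> is the cardinality of a basis, which is 0 for an infinite one.\<close>

lemma dim_mono_finite_span:
  assumes "S \<subseteq> T" "T \<subseteq> span W" "finite W"
  shows "dim S \<le> dim T"
proof -
  obtain B where B: "B \<subseteq> T" "independent B" "T \<subseteq> span B" "card B = dim T" by (rule basis_exists)
  have "finite B" using independent_span_bound[OF assms(3) B(2)] B(1) assms(2) by blast
  then show ?thesis using dim_le_card[of S B] B assms(1) by auto
qed

lemma dim_less_finite_span:
  assumes "subspace S" "S \<subseteq> T" "x \<in> T" "x \<notin> S" "T \<subseteq> span W" "finite W"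
  shows "dim S < dim T"
proof -
  obtain B where B: "B \<subseteq> T" "independent B" "T \<subseteq> span B" "card B = dim T" by (rule basis_exists)
  obtain C where C: "C \<subseteq> S" "independent C" "S \<subseteq> span C" "card C = dim S" by (rule basis_exists)
  have finB: "finite B" using independent_span_bound[OF assms(6) B(2)] B(1) assms(5) by blast
  have x: "x \<notin> span C" using span_minimal[OF C(1) assms(1)] assms(4) by blast
  have "insert x C \<subseteq> span B" using C(1) B(3) assms(2,3) by blast
  note independent_span_bound[OF finB independent_insertI[OF x C(2)] this]
  moreover have "x \<notin> C" using x span_base by blast
  ultimately show ?thesis using B(4) C(4) by auto
qed

text \<open>Any \<open>s\<close> with \<open>\<phi> s \<noteq> 0\<close> spans a complement of the
  kernel: subtracting \<open>\<phi> x / \<phi> s\<close> times \<open>s\<close> from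
  \<open>x\<close> lands in it.\<close>

lemma dim_le_Suc_dim_kernel:
  assumes "subspace S" "S \<subseteq> span W" "finite W"
    and add: "\<And>x y. \<phi> (x + y) = \<phi> x + \<phi> y" and scl: "\<And>a x. \<phi> (scale a x) = a * \<phi> x"
  shows "dim S \<le> Suc (dim {x \<in> S. \<phi> x = 0})"
proof -
  let ?T = "{x \<in> S. \<phi> x = 0}"
  obtain B where B: "B \<subseteq> ?T" "independent B" "?T \<subseteq> span B" "card B = dim ?T" by (rule basis_exists)
  have finB: "finite B" using independent_span_bound[OF assms(3) B(2)] B(1) assms(2) by blast
  show ?thesis
  proof (cases "S \<subseteq> ?T")
    case True
    then have "dim S \<le> card B" using dim_le_card[OF _ finB] B(3) by blast
    then show ?thesis using B(4) by simp
  next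
    case False
    then obtain s where s: "s \<in> S" "\<phi> s \<noteq> 0" by blast
    have "S \<subseteq> span (insert s B)"
    proof
      fix x assume x: "x \<in> S"
      let ?k = "\<phi> x / \<phi> s"
      have "x + scale (- ?k) s \<in> S" by (intro subspace_add subspace_scale assms(1) s(1) x)
      moreover have "\<phi> (x + scale (- ?k) s) = 0" unfolding add scl using s(2) by simp
      ultimately have "x + scale (- ?k) s \<in> span (insert s B)"
        using B(3) span_mono[of B "insert s B"] by blast
      moreover have "scale ?k s \<in> span (insert s B)" by (intro span_scale span_base) simp
      ultimately have "x + scale (- ?k) s + scale ?k s \<in> span (insert s B)" by (rule span_add)
      then show "x \<in> span (insert s B)" by simp
    qed
    then have "dim S \<le> card (insert s B)" using finB by (intro dim_le_card) auto
    then show ?thesis using B(4) card_insert_le_m1[of "Suc (card B)" B s] finB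
      by (metis card_insert_if le_Suc_eq le_trans order_refl)
  qed
qed

end

section \<open>Edge counts from linear conditions on chains\<close>

interpretation chain: vector_space "\<lambda>(q::rat) (c::'e \<Rightarrow> rat) d. q * c d"
  by unfold_locales (auto simp: fun_eq_iff algebra_simps)

definition supported_chains :: "'e set \<Rightarrow> ('e \<Rightarrow> rat) set" where
  "supported_chains D = {c. \<forall>d. d \<notin> D \<longrightarrow> c d = 0}"

lemma subspace_supported_chains: "chain.subspace (supported_chains D)"
  by (auto simp: chain.subspace_def supported_chains_def)

lemma supported_chains_span:
  assumes "finite D"
  shows "supported_chains D \<subseteq> chain.span ((\<lambda>d x. if x = d then 1 else 0) ` D)"
  using assms
proof (induction D rule: finite_induct)
  case empty
  have "supported_chains {} = {0 :: 'a \<Rightarrow> rat}" by (auto simp: supported_chains_def fun_eq_iff)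
  then show ?case by simp
next
  case (insert a D)
  let ?\<delta> = "\<lambda>d x. if x = d then 1 else (0::rat)"
  show ?case
  proof
    fix c :: "'a \<Rightarrow> rat" assume c: "c \<in> supported_chains (insert a D)"
    have "(\<lambda>x. if x = a then 0 else c x) \<in> supported_chains D"
      using c by (auto simp: supported_chains_def)
    then have "(\<lambda>x. if x = a then 0 else c x) \<in> chain.span (?\<delta> ` insert a D)"
      using insert.IH chain.span_mono[of "?\<delta> ` D" "?\<delta> ` insert a D"] by blast
    moreover have "(\<lambda>x. c a * ?\<delta> a x) \<in> chain.span (?\<delta> ` insert a D)"
      by (intro chain.span_scale chain.span_base) auto
    ultimately have "(\<lambda>x. if x = a then 0 else c x) + (\<lambda>x. c a * ?\<delta> a x)
        \<in> chain.span (?\<delta> ` insert a D)" by (rule chain.span_add)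
    also have "(\<lambda>x. if x = a then 0 else c x) + (\<lambda>x. c a * ?\<delta> a x) = c" by (auto simp: fun_eq_iff)
    finally show "c \<in> chain.span (?\<delta> ` insert a D)" .
  qed
qed

lemma card_le_dim_supported_chains:
  assumes "finite D"
  shows "card D \<le> chain.dim (supported_chains D)"
  using assms
proof (induction D rule: finite_induct)
  case (insert a D)
  have "chain.dim (supported_chains D) < chain.dim (supported_chains (insert a D))"
  proof (rule chain.dim_less_finite_span)
    show "supported_chains D \<subseteq> supported_chains (insert a D)" by (auto simp: supported_chains_def)
    show "(\<lambda>x. if x = a then 1 else 0) \<in> supported_chains (insert a D)"
      "(\<lambda>x. if x = a then 1 else 0) \<notin> supported_chains D"
      using insert.hyps by (auto simp: supported_chains_def)
    show "supported_chains (insert a D) \<subseteq> chain.span ((\<lambda>d x. if x = d then 1 else 0) ` insert a D)"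
      using insert.hyps by (intro supported_chains_span) simp
  qed (use insert.hyps subspace_supported_chains in auto)
  then show ?case using insert by simp
qed simp

text \<open>Every condition on chains has this shape: summing to 0 over an edge is antisymmetry,
  summing to 0 over the star of a vertex is vanishing boundary there. Each set in the family thus
  costs at most one dimension.\<close>

definition solutions :: "'e set \<Rightarrow> 'e set set \<Rightarrow> ('e \<Rightarrow> rat) set" where
  "solutions D \<K> = {c \<in> supported_chains D. \<forall>K\<in>\<K>. (\<Sum>d\<in>K. c d) = 0}"

lemma subspace_solutions: "chain.subspace (solutions D \<K>)"
  by (auto simp: chain.subspace_def solutions_def supported_chains_def sum.distrib
      simp flip: sum_distrib_left)

lemma card_le_dim_solutions:
  assumes "finite D" "finite \<K>"
  shows "card D \<le> chain.dim (solutions D \<K>) + card \<K>"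
  using assms(2)
proof (induction \<K> rule: finite_induct)
  case empty
  then show ?case using card_le_dim_supported_chains[OF assms(1)] by (simp add: solutions_def)
next
  case (insert K \<K>)
  have "chain.dim (solutions D \<K>) \<le> Suc (chain.dim {c \<in> solutions D \<K>. (\<Sum>d\<in>K. c d) = 0})"
  proof (rule chain.dim_le_Suc_dim_kernel)
    show "solutions D \<K> \<subseteq> chain.span ((\<lambda>d x. if x = d then 1 else 0) ` D)"
      using supported_chains_span[OF assms(1)] by (auto simp: solutions_def)
  qed (use assms(1) subspace_solutions in \<open>auto simp: sum.distrib sum_distrib_left\<close>)
  also have "{c \<in> solutions D \<K>. (\<Sum>d\<in>K. c d) = 0} = solutions D (insert K \<K>)"
    by (auto simp: solutions_def)
  finally show ?case using insert by simp
qed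

lemma rat_common_denominator:
  fixes c :: "'e \<Rightarrow> rat"
  assumes "finite D"
  shows "\<exists>m::int. m > 0 \<and> (\<forall>d\<in>D. of_int m * c d \<in> \<int>)"
  using assms
proof (induction D rule: finite_induct)
  case empty
  then show ?case by (intro exI[of _ 1]) simp
next
  case (insert a D)
  then obtain m :: int where m: "m > 0" "\<And>d. d \<in> D \<Longrightarrow> of_int m * c d \<in> \<int>" by blast
  obtain p q :: int where pq: "c a = of_int p / of_int q" "q > 0"
    by (cases "c a") (auto simp: Fract_of_int_quotient)
  have "of_int (m * q) * c d \<in> \<int>" if "d \<in> insert a D" for d
  proof (cases "d = a")
    case True
    then have "of_int (m * q) * c d = of_int (m * p)" using pq by simp
    then show ?thesis by (metis Ints_of_int)
  next
    case False
    then have "of_int m * c d \<in> \<int>" using m that by blast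
    then have "of_int q * (of_int m * c d) \<in> \<int>" by (rule Ints_mult[OF Ints_of_int])
    moreover have "of_int (m * q) * c d = of_int q * (of_int m * c d)" by simp
    ultimately show ?thesis by metis
  qed
  then show ?case using m pq by (intro exI[of _ "m * q"]) auto
qed

lemma card_edges:
  assumes "graph Y" "D \<subseteq> darts Y" "\<And>d. d \<in> D \<Longrightarrow> opp Y d \<in> D" "finite D"
  shows "card D = 2 * card (edge Y ` D)"
proof -
  have U: "\<Union>(edge Y ` D) = D" using assms(3) by (auto simp: edge_def)
  have oo: "opp Y (opp Y d) = d" "opp Y d \<noteq> d" if "d \<in> D" for d
    using assms(1,2) that by (auto simp: graph_def)
  have ex: "edge Y x = edge Y d" if "d \<in> D" "x \<in> edge Y d" for d x
    using oo(1)[OF that(1)] that(2) by (auto simp: edge_def)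
  have "2 * card (edge Y ` D) = card (\<Union>(edge Y ` D))"
  proof (rule card_partition)
    show "card e = 2" if "e \<in> edge Y ` D" for e
      using that oo(2) by (fastforce simp: edge_def)
    show "e \<inter> e' = {}" if "e \<in> edge Y ` D" "e' \<in> edge Y ` D" "e \<noteq> e'" for e e'
    proof (rule ccontr)
      assume "e \<inter> e' \<noteq> {}"
      then obtain x where "x \<in> e" "x \<in> e'" by blast
      then have "e = edge Y x" "e' = edge Y x" using ex that(1,2) by auto
      then show False using that(3) by simp
    qed
  qed (use assms(4) U in auto)
  then show ?thesis using U by simp
qed

text \<open>The family \<open>\<K>\<close> must contain enough conditions to turn an antisymmetric
  chain on \<open>D\<close> into a cycle. \<open>D\<close> has two darts per edge and antisymmetry
  costs one condition per edge, so the space of solutions has dimension at least the number of edges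
  minus \<open>card \<K>\<close>, and it lies in the rational span of \<open>H1 Y\<close>. A cycle
  that is non-zero somewhere off \<open>D\<close> lies outside this space, which makes the second
  inequality strict.\<close>

lemma card_edges_le_genus:
  assumes Y: "finite_graph Y" and D: "D \<subseteq> darts Y" "\<And>d. d \<in> D \<Longrightarrow> opp Y d \<in> D"
    and "finite \<K>"
    and cyc: "\<And>c v. \<lbrakk>\<And>d. d \<notin> D \<Longrightarrow> c d = 0; \<And>d. d \<in> D \<Longrightarrow> c (opp Y d) = - c d;
        \<And>K. K \<in> \<K> \<Longrightarrow> (\<Sum>d\<in>K. c d) = 0; v \<in> verts Y\<rbrakk>
      \<Longrightarrow> (\<Sum>d | d \<in> darts Y \<and> org Y d = v. c d) = (0::rat)"
  shows "card (edge Y ` D) \<le> genus Y + card \<K>"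
    and "z \<in> H1 Y \<Longrightarrow> d \<in> darts Y - D \<Longrightarrow> z d \<noteq> 0 \<Longrightarrow> card (edge Y ` D) < genus Y + card \<K>"
proof -
  have g: "graph Y" "finite (darts Y)" using Y by (auto simp: finite_graph_def)
  have finD: "finite D" using D(1) g(2) finite_subset by blast
  let ?S = "solutions D (\<K> \<union> edge Y ` D)"
  have 1: "card (edge Y ` D) \<le> chain.dim ?S + card \<K>"
    using card_le_dim_solutions[OF finD, of "\<K> \<union> edge Y ` D"] finD assms(4)
      card_edges[OF g(1) D finD] card_Un_le[of \<K> "edge Y ` D"] by simp
  have S_sub: "?S \<subseteq> chain.span (H1 Y)"
  proof
    fix c assume c: "c \<in> ?S"
    then have supp: "c d = 0" if "d \<notin> D" for d
      using that by (auto simp: solutions_def supported_chains_def)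
    have anti: "c (opp Y d) = - c d" if "d \<in> D" for d
    proof -
      have "(\<Sum>x\<in>edge Y d. c x) = 0" using c that by (auto simp: solutions_def)
      moreover have "opp Y d \<noteq> d" using g(1) D(1) that by (auto simp: graph_def)
      ultimately show ?thesis by (simp add: edge_def)
    qed
    have K: "(\<Sum>d\<in>K. c d) = 0" if "K \<in> \<K>" for K using c that by (auto simp: solutions_def)
    \<comment> \<open>\<open>H1\<close> only has integer chains, so a rational solution enters its
      span after denominators are cleared.\<close>
    obtain m :: int where m: "m > 0" "\<And>d. d \<in> D \<Longrightarrow> of_int m * c d \<in> \<int>"
      using rat_common_denominator[OF finD] by blast
    have cy: "(\<Sum>d | d \<in> darts Y \<and> org Y d = v. c d) = 0" if "v \<in> verts Y" for v
      using cyc[of c v] supp anti K that by blast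
    have "(\<lambda>d. of_int m * c d) \<in> H1 Y"
      unfolding H1_def
    proof (intro CollectI conjI allI ballI impI)
      fix d show "of_int m * c d \<in> \<int>" by (cases "d \<in> D") (auto simp: m supp)
    next
      fix d assume "d \<notin> darts Y" then show "of_int m * c d = 0" using supp D(1) by auto
    next
      fix d assume d: "d \<in> darts Y"
      show "of_int m * c (opp Y d) = - (of_int m * c d)"
      proof (cases "d \<in> D")
        case False
        then have "opp Y d \<notin> D" using D(2) d g(1) by (metis graph_def)
        then show ?thesis using supp False by simp
      qed (simp add: anti)
    qed (simp add: cy flip: sum_distrib_left)
    then have "(\<lambda>d. inverse (of_int m) * (of_int m * c d)) \<in> chain.span (H1 Y)"
      by (intro chain.span_scale chain.span_base)
    then show "c \<in> chain.span (H1 Y)" using m(1) by (simp add: mult.assoc[symmetric])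
  qed
  have W: "chain.span (H1 Y) \<subseteq> chain.span ((\<lambda>d x. if x = d then 1 else 0) ` darts Y)"
    using supported_chains_span[OF g(2)]
    by (intro chain.span_minimal) (auto simp: H1_def supported_chains_def)
  have dim: "chain.dim (chain.span (H1 Y)) = genus Y" by (simp add: genus_def chain.dim_span)
  have "chain.dim ?S \<le> genus Y"
    using chain.dim_mono_finite_span[OF S_sub W] g(2) dim by simp
  then show "card (edge Y ` D) \<le> genus Y + card \<K>" using 1 by linarith
  assume "z \<in> H1 Y" "d \<in> darts Y - D" "z d \<noteq> 0"
  then have "z \<in> chain.span (H1 Y)" "z \<notin> ?S"
    by (auto simp: solutions_def supported_chains_def intro: chain.span_base)
  then have "chain.dim ?S < genus Y"
    using chain.dim_less_finite_span[OF subspace_solutions S_sub _ _ W] g(2) dim by simp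
  then show "card (edge Y ` D) < genus Y + card \<K>" using 1 by linarith
qed

text \<open>The boundary conditions at all but one of the vertices suffice, since all boundaries sum to 0.\<close>

lemma card_edges_le_genus_plus_verts:
  assumes Y: "finite_graph Y" and D: "D \<subseteq> darts Y" "\<And>d. d \<in> D \<Longrightarrow> opp Y d \<in> D" "D \<noteq> {}"
  shows "card (edge Y ` D) + 1 \<le> genus Y + card (org Y ` D)"
proof -
  have g: "graph Y" "finite (darts Y)" using Y by (auto simp: finite_graph_def)
  have finD: "finite D" using D(1) g(2) finite_subset by blast
  obtain d0 where d0: "d0 \<in> D" using D by blast
  define I where "I = org Y ` D - {org Y d0}"
  have cI: "card (org Y ` D) = Suc (card I)"
    unfolding I_def using d0 finD by (intro card_Suc_Diff1[symmetric]) auto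
  let ?st = "\<lambda>v. {d \<in> D. org Y d = v}"
  have "card (edge Y ` D) \<le> genus Y + card (?st ` I)"
  proof (rule card_edges_le_genus(1)[OF Y D(1,2)])
    fix c :: "'b \<Rightarrow> rat" and v
    assume supp: "\<And>d. d \<notin> D \<Longrightarrow> c d = 0" and anti: "\<And>d. d \<in> D \<Longrightarrow> c (opp Y d) = - c d"
      and K: "\<And>K. K \<in> ?st ` I \<Longrightarrow> (\<Sum>d\<in>K. c d) = 0"
    have all0: "(\<Sum>d\<in>D. c d) = 0"
    proof -
      have "bij_betw (opp Y) D D"
        by (rule bij_betw_byWitness[where f' = "opp Y"]) (use g(1) D in \<open>auto simp: graph_def\<close>)
      then have "(\<Sum>d\<in>D. c d) = (\<Sum>d\<in>D. c (opp Y d))" by (rule sum.reindex_bij_betw[symmetric])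
      also have "\<dots> = - (\<Sum>d\<in>D. c d)" by (simp add: anti sum_negf)
      finally show ?thesis by simp
    qed
    have st0: "(\<Sum>d\<in>?st v. c d) = 0" for v
    proof -
      consider "v \<in> I" | "v \<notin> org Y ` D" | "v = org Y d0" by (auto simp: I_def)
      then show ?thesis
      proof cases
        case 1 then show ?thesis using K by blast
      next
        case 2
        then have "?st v = {}" by blast
        then show ?thesis by (simp only: sum.empty)
      next
        case 3
        have "(\<Sum>d\<in>D. c d) = (\<Sum>v\<in>org Y ` D. \<Sum>d\<in>?st v. c d)"
          using finD by (rule sum.image_gen)
        also have "\<dots> = (\<Sum>d\<in>?st (org Y d0). c d) + (\<Sum>v\<in>I. \<Sum>d\<in>?st v. c d)"
          unfolding I_def using finD d0 by (intro sum.remove) auto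
        also have "(\<Sum>v\<in>I. \<Sum>d\<in>?st v. c d) = 0" using K by (intro sum.neutral) blast
        finally show ?thesis using all0 3 by simp
      qed
    qed
    have "(\<Sum>d | d \<in> darts Y \<and> org Y d = v. c d) = (\<Sum>d\<in>?st v. c d)"
      by (rule sum.mono_neutral_right) (use D(1) g(2) supp in auto)
    then show "(\<Sum>d | d \<in> darts Y \<and> org Y d = v. c d) = 0" using st0 by simp
  qed (use finD in \<open>auto simp: I_def\<close>)
  moreover have "card (?st ` I) \<le> card I" using finD by (intro card_image_le) (simp add: I_def)
  ultimately show ?thesis using cI by linarith
qed

section \<open>Cycles, pullbacks and separating edges\<close>

lemma is_cycle_H1:
  assumes "graph Y" "finite (darts Y)" "is_cycle Y ds"
  obtains c where "c \<in> H1 Y" "\<And>d. d \<in> set ds \<Longrightarrow> c d \<noteq> 0"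
proof -
  have sub: "set ds \<subseteq> darts Y"
    and step: "\<And>i. i < length ds \<Longrightarrow> org Y (opp Y (ds ! i)) = org Y (ds ! (Suc i mod length ds))"
    and dist: "distinct (map (org Y) ds)" and nopp: "\<And>d. d \<in> set ds \<Longrightarrow> opp Y d \<notin> set ds"
    using assms(3) by (auto simp: is_cycle_def)
  have op: "opp Y d \<in> darts Y" "opp Y (opp Y d) = d" if "d \<in> darts Y" for d
    using assms(1) that by (auto simp: graph_def)
  have dd: "distinct ds" using dist by (simp add: distinct_map)
  have cnt: "card {d \<in> set ds. P d} = length (filter P ds)" for P
    using distinct_card[OF distinct_filter[OF dd, of P]] by simp
  define c :: "'b \<Rightarrow> rat" where
    "c d = (if d \<in> set ds then 1 else if d \<in> darts Y \<and> opp Y d \<in> set ds then - 1 else 0)" for d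
  \<comment> \<open>The end points of the listed darts are their origins rotated by one place. Hence
    each vertex is entered as often as it is left, and the signed indicator \<open>c\<close> has
    boundary 0.\<close>
  have rot: "map (\<lambda>d. org Y (opp Y d)) ds = rotate1 (map (org Y) ds)"
  proof (rule nth_equalityI)
    fix i assume "i < length (map (\<lambda>d. org Y (opp Y d)) ds)"
    moreover from this have "Suc i mod length ds < length ds" by (intro mod_less_divisor) auto
    ultimately show "map (\<lambda>d. org Y (opp Y d)) ds ! i = rotate1 (map (org Y) ds) ! i"
      by (simp add: nth_rotate1 step)
  qed simp
  have len: "length (filter P (rotate1 xs)) = length (filter P xs)" for P and xs :: "'a list"
    by (cases xs) auto
  have "c \<in> H1 Y"
    unfolding H1_def
  proof (intro CollectI conjI allI ballI impI)
    fix v assume "v \<in> verts Y"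
    let ?A = "{d \<in> set ds. org Y d = v}" and ?B = "{d \<in> darts Y. org Y d = v \<and> opp Y d \<in> set ds}"
    have "bij_betw (opp Y) ?B {d \<in> set ds. org Y (opp Y d) = v}"
      by (rule bij_betw_byWitness[where f' = "opp Y"]) (use op sub in auto)
    then have "card ?B = card {d \<in> set ds. org Y (opp Y d) = v}" by (rule bij_betw_same_card)
    also have "\<dots> = length (filter (\<lambda>d. org Y (opp Y d) = v) ds)"
      by (rule cnt)
    also have "\<dots> = length (filter (\<lambda>x. x = v) (map (\<lambda>d. org Y (opp Y d)) ds))"
      by (simp add: filter_map comp_def)
    also have "\<dots> = length (filter (\<lambda>x. x = v) (map (org Y) ds))" unfolding rot len ..
    also have "\<dots> = length (filter (\<lambda>d. org Y d = v) ds)" by (simp add: filter_map comp_def)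
    also have "\<dots> = card ?A" by (rule cnt[symmetric])
    finally have AB: "card ?B = card ?A" .
    have "(\<Sum>d | d \<in> darts Y \<and> org Y d = v. c d) = (\<Sum>d\<in>?A \<union> ?B. c d)"
      by (rule sum.mono_neutral_right) (use assms(2) sub in \<open>auto simp: c_def\<close>)
    also have "\<dots> = (\<Sum>d\<in>?A. c d) + (\<Sum>d\<in>?B. c d)"
      by (rule sum.union_disjoint) (use assms(2) nopp in auto)
    also have "(\<Sum>d\<in>?A. c d) = (\<Sum>d\<in>?A. 1)" by (rule sum.cong) (auto simp: c_def)
    also have "(\<Sum>d\<in>?B. c d) = (\<Sum>d\<in>?B. - 1)" by (rule sum.cong) (use nopp in \<open>auto simp: c_def\<close>)
    finally show "(\<Sum>d | d \<in> darts Y \<and> org Y d = v. c d) = 0" using AB by simp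
  next
    fix d assume "d \<in> darts Y"
    then show "c (opp Y d) = - c d" using nopp op sub by (auto simp: c_def)
  qed (use sub in \<open>auto simp: c_def\<close>)
  then show ?thesis using that by (simp add: c_def)
qed

text \<open>The pullback is cut off outside \<open>darts Y\<close>, where \<open>graph_iso\<close>
  says nothing about \<open>snd \<phi>\<close> but \<open>H1\<close> requires the value 0.\<close>

lemma H1_pullback:
  assumes "finite_graph Y" "graph_iso Y Y \<phi>" "c \<in> H1 Y"
  shows "(\<lambda>d. if d \<in> darts Y then c (snd \<phi> d) else 0) \<in> H1 Y"
proof -
  have g: "graph Y" "finite (darts Y)" using assms(1) by (auto simp: finite_graph_def)
  have bv: "bij_betw (fst \<phi>) (verts Y) (verts Y)" and bd: "bij_betw (snd \<phi>) (darts Y) (darts Y)"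
    and eo: "\<And>d. d \<in> darts Y \<Longrightarrow> fst \<phi> (org Y d) = org Y (snd \<phi> d)"
    and ep: "\<And>d. d \<in> darts Y \<Longrightarrow> snd \<phi> (opp Y d) = opp Y (snd \<phi> d)"
    using assms(2) by (auto simp: graph_iso_def)
  have dd: "snd \<phi> d \<in> darts Y" if "d \<in> darts Y" for d using bd that bij_betwE by blast
  have op: "opp Y d \<in> darts Y" if "d \<in> darts Y" for d using g(1) that by (auto simp: graph_def)
  show ?thesis
    unfolding H1_def
  proof (intro CollectI conjI allI ballI impI)
    fix v assume v: "v \<in> verts Y"
    let ?A = "\<lambda>v. {d \<in> darts Y. org Y d = v}"
    have "bij_betw (snd \<phi>) (?A v) (?A (fst \<phi> v))"
    proof (rule bij_betwI')
      fix e assume e: "e \<in> ?A (fst \<phi> v)"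
      then obtain d where d: "d \<in> darts Y" "e = snd \<phi> d" using bd by (auto simp: bij_betw_def)
      then have "fst \<phi> (org Y d) = fst \<phi> v" using e eo by simp
      moreover have "org Y d \<in> verts Y" using g(1) d(1) by (auto simp: graph_def)
      ultimately have "org Y d = v" using bv v by (auto simp: bij_betw_def dest: inj_onD)
      then show "\<exists>d\<in>?A v. e = snd \<phi> d" using d by blast
    next
      fix x y assume "x \<in> ?A v" "y \<in> ?A v"
      then show "(snd \<phi> x = snd \<phi> y) = (x = y)" using bd by (auto simp: bij_betw_def dest: inj_onD)
    next
      fix x assume "x \<in> ?A v"
      then show "snd \<phi> x \<in> ?A (fst \<phi> v)" using dd eo[of x] by auto
    qed
    then have "(\<Sum>d\<in>?A v. c (snd \<phi> d)) = (\<Sum>d\<in>?A (fst \<phi> v). c d)" by (rule sum.reindex_bij_betw)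
    also have "\<dots> = 0" using assms(3) bij_betwE[OF bv] v by (auto simp: H1_def)
    finally show "(\<Sum>d\<in>?A v. if d \<in> darts Y then c (snd \<phi> d) else 0) = 0"
      by (simp cong: sum.cong_simp)
  qed (use assms(3) dd op ep in \<open>auto simp: H1_def\<close>)
qed

lemma carrier_aut_group: "\<alpha> \<in> carrier (aut_group Y) \<Longrightarrow> graph_iso Y Y \<alpha>"
  by (simp add: aut_group_def)

text \<open>The separating edges are those on which all of \<open>H1\<close> vanishes; they form an invariant forest.\<close>

lemma minimal_action_no_separating_edge:
  assumes "finite_graph Y" "minimal_action G Y \<rho>" "d \<in> darts Y"
  obtains c where "c \<in> H1 Y" "c d \<noteq> 0"
proof (rule ccontr)
  assume neg: "\<not> thesis"
  have g: "graph Y" "finite (darts Y)" using assms(1) by (auto simp: finite_graph_def)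
  define Z where "Z = {d \<in> darts Y. \<forall>c\<in>H1 Y. c d = 0}"
  define F where "F = Y\<lparr>darts := Z\<rparr>"
  have dZ: "d \<in> Z" using neg that assms(3) by (auto simp: Z_def)
  have H: "c (opp Y e) = - c e" if "c \<in> H1 Y" "e \<in> darts Y" for c e using that by (auto simp: H1_def)
  have "c (opp Y e) = 0" if "c \<in> H1 Y" "e \<in> Z" for c e using H[of c e] that by (simp add: Z_def)
  then have gF: "graph F" using g(1) by (simp add: F_def Z_def graph_def)
  have "\<not> is_cycle F ds" for ds
  proof
    assume "is_cycle F ds"
    then have ds: "is_cycle Y ds" "set ds \<subseteq> Z" "ds \<noteq> []"
      by (auto simp: is_cycle_def F_def Z_def)
    obtain c where "c \<in> H1 Y" "\<And>d. d \<in> set ds \<Longrightarrow> c d \<noteq> 0" using is_cycle_H1[OF g ds(1)] by blast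
    moreover obtain e where "e \<in> set ds" using ds(3) by (cases ds) auto
    ultimately show False using ds(2) by (auto simp: Z_def)
  qed
  then have "nontrivial_forest F Y" using gF dZ
    by (auto simp: nontrivial_forest_def subgraph_def F_def Z_def)
  moreover have "invariant_under (\<rho> ` carrier G) F"
    unfolding invariant_under_def
  proof
    fix \<alpha> assume "\<alpha> \<in> \<rho> ` carrier G"
    then have iso: "graph_iso Y Y \<alpha>"
      using assms(2) carrier_aut_group[of \<alpha> Y] by (auto simp: minimal_action_def hom_def Pi_def)
    have bd: "bij_betw (snd \<alpha>) (darts Y) (darts Y)" using iso by (simp add: graph_iso_def)
    have "snd \<alpha> ` Z \<subseteq> Z"
    proof
      fix e assume "e \<in> snd \<alpha> ` Z"
      then obtain x where x: "x \<in> Z" "e = snd \<alpha> x" by blast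
      have "c e = 0" if "c \<in> H1 Y" for c
        using H1_pullback[OF assms(1) iso that] x by (fastforce simp: Z_def)
      moreover have "e \<in> darts Y" using x bij_betwE[OF bd] by (auto simp: Z_def)
      ultimately show "e \<in> Z" by (simp add: Z_def)
    qed
    moreover have "inj_on (snd \<alpha>) Z" using bd by (auto simp: bij_betw_def Z_def intro: inj_on_subset)
    ultimately have "snd \<alpha> ` Z = Z" using g(2) by (intro card_subset_eq) (auto simp: Z_def card_image)
    moreover have "fst \<alpha> ` verts Y = verts Y" using iso by (simp add: graph_iso_def bij_betw_def)
    ultimately show "fst \<alpha> ` verts F = verts F \<and> snd \<alpha> ` darts F = darts F" by (simp add: F_def)
  qed
  ultimately show False using assms(2) by (auto simp: minimal_action_def)
qed

section \<open>Actions with small orbits\<close>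

lemma Gn_carrier: "(p, k) \<in> carrier (Gn n) \<longleftrightarrow> p permutes {1..n + 1} \<and> (k = 0 \<or> k = 1)"
  by (auto simp: Gn_def DirProd_def sym_group_carrier carrier_integer_mod_group)

lemma Gn_mult: "(p, k) \<otimes>\<^bsub>Gn n\<^esub> (q, l) = (p \<circ> q, (k + l) mod 2)"
  by (simp add: Gn_def DirProd_def sym_group_mult)

lemma even_perms_alt_group: "even_perms {1..n} = carrier (alt_group n)"
  by (auto simp: even_perms_def alt_group_carrier)

lemma even_perms_fixing:
  assumes "p \<in> even_perms S" "p i = i"
  shows "p \<in> even_perms (S - {i})"
proof -
  have pS: "p permutes S" using assms(1) by (simp add: even_perms_def)
  have "p permutes (S - {i})" by (rule permutes_superset[OF pS]) (use assms(2) in auto)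
  then show ?thesis using assms(1) by (simp add: even_perms_def)
qed

text \<open>Abstract, because it will be instantiated three times: with vertices, with darts and
  with unoriented edges.\<close>

locale Gn_action =
  fixes n :: nat and X :: "'x set" and act :: "(nat \<Rightarrow> nat) \<times> int \<Rightarrow> 'x \<Rightarrow> 'x"
  assumes n_ge: "8 \<le> n"
    and act_in: "\<And>g x. g \<in> carrier (Gn n) \<Longrightarrow> x \<in> X \<Longrightarrow> act g x \<in> X"
    and act_mult: "\<And>g h x. g \<in> carrier (Gn n) \<Longrightarrow> h \<in> carrier (Gn n) \<Longrightarrow> x \<in> X
        \<Longrightarrow> act (g \<otimes>\<^bsub>Gn n\<^esub> h) x = act g (act h x)"
    and act_one: "\<And>x. x \<in> X \<Longrightarrow> act (id, 0) x = x"
begin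

abbreviation \<Omega> :: "nat set" where "\<Omega> \<equiv> {1..n + 1}"
abbreviation A :: "(nat \<Rightarrow> nat) set" where "A \<equiv> even_perms \<Omega>"

definition invar :: "'x \<Rightarrow> bool" where
  "invar x \<longleftrightarrow> (\<forall>p\<in>A. act (p, 0) x = x)"

definition labelled :: "'x \<Rightarrow> nat \<Rightarrow> bool" where
  "labelled x i \<longleftrightarrow> i \<in> \<Omega> \<and> (\<forall>p\<in>A. act (p, 0) x = x \<longleftrightarrow> p i = i)"

lemma A_G: "p \<in> A \<Longrightarrow> (p, 0) \<in> carrier (Gn n)"
  by (auto simp: Gn_carrier even_perms_def)

lemma A_comp: "p \<in> A \<Longrightarrow> q \<in> A \<Longrightarrow> p \<circ> q \<in> A"
  by (rule even_perms_comp) auto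

lemma A_inv: "p \<in> A \<Longrightarrow> inv' p \<in> A"
  by (rule even_perms_inv) auto

lemma A_inv_cancel [simp]:
  assumes "p \<in> A"
  shows "inv' p (p i) = i" "p (inv' p i) = i" "inv' p \<circ> p = id" "p \<circ> inv' p = id"
  using even_perms_bij[OF assms]
  by (simp_all add: bij_is_inj bij_is_surj surj_f_inv_f surj_iff[symmetric])

lemma A_in: "p \<in> A \<Longrightarrow> p i \<in> \<Omega> \<longleftrightarrow> i \<in> \<Omega>"
  using permutes_in_image[of p \<Omega> i] by (simp only: even_perms_def mem_Collect_eq)

lemma act_comp: "p \<in> A \<Longrightarrow> q \<in> A \<Longrightarrow> x \<in> X \<Longrightarrow> act (p \<circ> q, 0) x = act (p, 0) (act (q, 0) x)"
  using act_mult[OF A_G A_G, of p q x] by (simp add: Gn_mult)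

lemma act_inv_cancel:
  assumes "p \<in> A" "x \<in> X"
  shows "act (inv' p, 0) (act (p, 0) x) = x" "act (p, 0) (act (inv' p, 0) x) = x"
  using act_comp[OF A_inv[OF assms(1)] assms] act_comp[OF assms(1) A_inv[OF assms(1)] assms(2)]
    A_inv_cancel[OF assms(1)] act_one[OF assms(2)] by metis+

lemma act_inj:
  assumes g: "g \<in> carrier (Gn n)" and xy: "x \<in> X" "y \<in> X" "act g x = act g y"
  shows "x = y"
proof -
  obtain p k where pk: "g = (p, k)" by (cases g)
  let ?h = "(inv' p, k)"
  have p: "p permutes \<Omega>" "k = 0 \<or> k = 1" using g unfolding pk by (simp_all add: Gn_carrier)
  have h: "?h \<in> carrier (Gn n)" using permutes_inv[OF p(1)] p(2) by (simp add: Gn_carrier)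
  have hg: "?h \<otimes>\<^bsub>Gn n\<^esub> g = (id, 0)" using p permutes_inv_o[OF p(1)] unfolding pk by (auto simp: Gn_mult)
  have "act ?h (act g z) = z" if "z \<in> X" for z using act_mult[OF h g that] act_one[OF that] hg by simp
  then show ?thesis using xy by metis
qed

lemma exists_move:
  assumes "i \<in> \<Omega>" "j \<in> \<Omega>"
  obtains p where "p \<in> A" "p i = j"
  using even_perms_move[of \<Omega> i j] assms n_ge by auto

definition move :: "nat \<Rightarrow> nat \<Rightarrow> nat \<Rightarrow> nat" where
  "move i j = (SOME p. p \<in> A \<and> p i = j)"

lemma move:
  assumes "i \<in> \<Omega>" "j \<in> \<Omega>"
  shows "move i j \<in> A" "move i j i = j"
  using someI_ex[of "\<lambda>p. p \<in> A \<and> p i = j"] exists_move[OF assms] by (auto simp: move_def)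

lemma stabilizer_le_imp_eq:
  assumes "i \<in> \<Omega>" "j \<in> \<Omega>" "\<And>p. p \<in> A \<Longrightarrow> p i = i \<Longrightarrow> p j = j"
  shows "i = j"
proof (rule ccontr)
  assume "i \<noteq> j"
  then obtain p where "p \<in> A" "p i = i" "p j \<noteq> j"
    using even_perms_fix_move[of \<Omega> i j] assms(1,2) n_ge by auto
  then show False using assms(3) by blast
qed

lemma labelled_unique: "labelled x i \<Longrightarrow> labelled x j \<Longrightarrow> i = j"
  by (rule stabilizer_le_imp_eq) (auto simp: labelled_def)

lemma labelled_not_invar:
  assumes "labelled x i" shows "\<not> invar x"
proof
  assume inv: "invar x"
  have i: "i \<in> \<Omega>" using assms by (simp add: labelled_def)
  define j where "j = (if i = 1 then 2 else 1 :: nat)"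
  have "j \<in> \<Omega>" "j \<noteq> i" using n_ge by (auto simp: j_def)
  then obtain p where "p \<in> A" "p i = j" using exists_move i by blast
  then show False using inv assms \<open>j \<noteq> i\<close> by (auto simp: invar_def labelled_def)
qed

text \<open>This is normality of the alternating group: moving \<open>q\<close> past
  \<open>(p, k)\<close> conjugates it by \<open>p\<close>, and \<open>k\<close> is central.\<close>

lemma act_swap:
  assumes "(p, k) \<in> carrier (Gn n)" "q \<in> A" "x \<in> X"
  shows "inv' p \<circ> q \<circ> p \<in> A"
    and "act (q, 0) (act (p, k) x) = act (p, k) (act (inv' p \<circ> q \<circ> p, 0) x)"
proof -
  have p: "p permutes \<Omega>" "k = 0 \<or> k = 1" using assms(1) by (simp_all add: Gn_carrier)
  have pq: "permutation p" "permutation q" "permutation (inv' p)" "q permutes \<Omega>" "evenperm q"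
    using p(1) assms(2) permutes_imp_permutation[of \<Omega>] permutes_inv[OF p(1)] by (auto simp: even_perms_def)
  show e: "inv' p \<circ> q \<circ> p \<in> A"
    using p pq permutes_compose[OF permutes_compose[OF p(1) pq(4)] permutes_inv[OF p(1)]]
    by (auto simp: even_perms_def evenperm_comp permutation_compose evenperm_inv comp_assoc)
  have "p \<circ> (inv' p \<circ> q \<circ> p) = q \<circ> p"
    using permutes_inv_o(1)[OF p(1)] by (metis comp_assoc id_comp)
  then show "act (q, 0) (act (p, k) x) = act (p, k) (act (inv' p \<circ> q \<circ> p, 0) x)"
    using act_mult[OF A_G[OF assms(2)] assms(1,3)] act_mult[OF assms(1) A_G[OF e] assms(3)] by (simp add: Gn_mult)
qed

lemma labelled_act:
  assumes "(p, k) \<in> carrier (Gn n)" "x \<in> X" "labelled x i"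
  shows "labelled (act (p, k) x) (p i)"
  unfolding labelled_def
proof (intro conjI ballI)
  have p: "p permutes \<Omega>" using assms(1) by (simp add: Gn_carrier)
  show "p i \<in> \<Omega>" using assms(3) permutes_in_image[OF p] unfolding labelled_def by blast
  fix q assume q: "q \<in> A"
  let ?r = "inv' p \<circ> q \<circ> p"
  have r: "?r \<in> A" "act (q, 0) (act (p, k) x) = act (p, k) (act (?r, 0) x)"
    using act_swap[OF assms(1) q assms(2)] by blast+
  have "act (q, 0) (act (p, k) x) = act (p, k) x \<longleftrightarrow> act (?r, 0) x = x"
    using r act_inj[OF assms(1) act_in[OF A_G[OF r(1)] assms(2)] assms(2)] by metis
  also have "\<dots> \<longleftrightarrow> ?r i = i" using assms(3) r(1) by (simp add: labelled_def)
  also have "\<dots> \<longleftrightarrow> q (p i) = p i" using permutes_inv_eq[OF p, of "q (p i)" i] by auto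
  finally show "act (q, 0) (act (p, k) x) = act (p, k) x \<longleftrightarrow> q (p i) = p i" .
qed

lemma labelled_actA: "p \<in> A \<Longrightarrow> x \<in> X \<Longrightarrow> labelled x i \<Longrightarrow> labelled (act (p, 0) x) (p i)"
  using labelled_act[OF A_G] .

lemma invar_act:
  assumes "g \<in> carrier (Gn n)" "x \<in> X" "invar x"
  shows "invar (act g x)"
proof -
  obtain p k where pk: "g = (p, k)" by (cases g)
  show ?thesis
    using act_swap[of p k _ x] assms unfolding invar_def pk by metis
qed

lemma act_eq_iff:
  assumes "labelled x i" "x \<in> X" "p \<in> A" "q \<in> A"
  shows "act (p, 0) x = act (q, 0) x \<longleftrightarrow> p i = q i"
proof -
  have r: "inv' p \<circ> q \<in> A" using assms A_comp A_inv by blast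
  have e: "act (inv' p \<circ> q, 0) x = act (inv' p, 0) (act (q, 0) x)"
    using act_comp[OF A_inv[OF assms(3)] assms(4,2)] .
  have "act (p, 0) x = act (q, 0) x \<longleftrightarrow> act (inv' p \<circ> q, 0) x = x"
    using e act_inv_cancel[OF assms(3)] assms(2) act_in[OF A_G[OF assms(4)] assms(2)] by metis
  also have "\<dots> \<longleftrightarrow> inv' p (q i) = i" using assms(1) r by (simp add: labelled_def)
  also have "\<dots> \<longleftrightarrow> p i = q i" using A_inv_cancel[OF assms(3)] by metis
  finally show ?thesis .
qed

lemma card_orbit_le:
  assumes "x \<in> X" "invar x \<or> labelled x i"
  shows "card ((\<lambda>p. act (p, 0) x) ` A) \<le> n + 1"
proof (cases "invar x")
  case True
  then have "(\<lambda>p. act (p, 0) x) ` A \<subseteq> {x}" by (auto simp: invar_def)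
  then have "card ((\<lambda>p. act (p, 0) x) ` A) \<le> card {x}" by (intro card_mono) auto
  then show ?thesis by simp
next
  case False
  then have l: "labelled x i" using assms(2) by blast
  then have i: "i \<in> \<Omega>" by (simp add: labelled_def)
  have "(\<lambda>p. act (p, 0) x) ` A \<subseteq> (\<lambda>j. act (move i j, 0) x) ` \<Omega>"
  proof
    fix y assume "y \<in> (\<lambda>p. act (p, 0) x) ` A"
    then obtain p where p: "p \<in> A" "y = act (p, 0) x" by blast
    have "p i \<in> \<Omega>" using A_in[OF p(1)] i by blast
    moreover from this have "y = act (move i (p i), 0) x"
      using act_eq_iff[OF l assms(1) p(1)] move[OF i] p(2) by simp
    ultimately show "y \<in> (\<lambda>j. act (move i j, 0) x) ` \<Omega>" by blast
  qed
  then show ?thesis using surj_card_le[of \<Omega>] by fastforce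
qed

text \<open>\<open>4 * n + 1\<close> is 4N - 3 for N = n + 1.\<close>

lemma invar_or_labelled:
  assumes "x \<in> X" "card ((\<lambda>p. act (p, 0) x) ` A) \<le> 4 * n + 1"
  shows "invar x \<or> (\<exists>i. labelled x i)"
proof -
  have "(\<forall>p\<in>A. act (p, 0) x = x) \<or> (\<exists>i\<in>\<Omega>. \<forall>p\<in>A. act (p, 0) x = x \<longleftrightarrow> p i = i)"
    by (rule action_small_orbit[where act = "\<lambda>p. act (p, 0)"])
       (use assms n_ge act_one act_comp in auto)
  then show ?thesis unfolding invar_def labelled_def by blast
qed

section \<open>Transport from label 1 to label i\<close>

definition label_set :: "nat \<Rightarrow> 'x set" where
  "label_set i = {x \<in> X. labelled x i}"

text \<open>The arbitrary choice made in \<open>move\<close> has no effect on elements labelled 1: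
  by \<open>act_eq_iff\<close> their image depends only on where the point 1 goes.\<close>

definition tr :: "nat \<Rightarrow> 'x \<Rightarrow> 'x" where
  "tr i x = act (move 1 i, 0) x"

lemma one_\<Omega>: "1 \<in> \<Omega>" by simp

lemma labelled_tr:
  assumes "x \<in> label_set 1" "i \<in> \<Omega>"
  shows "tr i x \<in> X" "labelled (tr i x) i" "tr i x \<in> label_set i"
proof -
  have x: "x \<in> X" "labelled x 1" using assms(1) by (auto simp: label_set_def)
  note m = move[OF one_\<Omega> assms(2)]
  show "tr i x \<in> X" unfolding tr_def using act_in[OF A_G[OF m(1)] x(1)] .
  moreover show "labelled (tr i x) i" unfolding tr_def using labelled_actA[OF m(1) x] m(2) by simp
  ultimately show "tr i x \<in> label_set i" by (simp add: label_set_def)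
qed

lemma act_tr:
  assumes "x \<in> label_set 1" "i \<in> \<Omega>" "p \<in> A"
  shows "act (p, 0) (tr i x) = tr (p i) x"
proof -
  have x: "x \<in> X" "labelled x 1" using assms(1) by (auto simp: label_set_def)
  note m = move[OF one_\<Omega> assms(2)]
  have pi: "p i \<in> \<Omega>" using A_in[OF assms(3)] assms(2) by blast
  note m' = move[OF one_\<Omega> pi]
  have "act (p, 0) (tr i x) = act (p \<circ> move 1 i, 0) x"
    unfolding tr_def using act_comp[OF assms(3) m(1) x(1)] by simp
  also have "\<dots> = tr (p i) x"
    unfolding tr_def using act_eq_iff[OF x(2,1) A_comp[OF assms(3) m(1)] m'(1)] m(2) m'(2) by simp
  finally show ?thesis .
qed

lemma tr_inj:
  assumes "x \<in> label_set 1" "y \<in> label_set 1" "i \<in> \<Omega>" "tr i x = tr i y"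
  shows "x = y"
  using act_inj[OF A_G[OF move(1)[OF one_\<Omega> assms(3)]]] assms
  by (auto simp: tr_def label_set_def)

lemma tr_surj:
  assumes "y \<in> X" "labelled y i"
  obtains x where "x \<in> label_set 1" "y = tr i x"
proof -
  have i: "i \<in> \<Omega>" using assms(2) by (simp add: labelled_def)
  note m = move[OF one_\<Omega> i]
  let ?x = "act (inv' (move 1 i), 0) y"
  have mi: "inv' (move 1 i) i = 1" using A_inv_cancel(1)[OF m(1), of 1] m(2) by simp
  have "?x \<in> label_set 1"
    using act_in[OF A_G[OF A_inv[OF m(1)]] assms(1)] labelled_actA[OF A_inv[OF m(1)] assms] mi
    by (simp add: label_set_def)
  moreover have "y = tr i ?x" unfolding tr_def using act_inv_cancel[OF m(1) assms(1)] by simp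
  ultimately show ?thesis using that by blast
qed

lemma card_labelled:
  assumes "finite X"
  shows "card {x \<in> X. \<exists>i. labelled x i} = (n + 1) * card (label_set 1)"
proof -
  have "bij_betw (\<lambda>(i, x). tr i x) (\<Omega> \<times> label_set 1) {x \<in> X. \<exists>i. labelled x i}"
  proof (rule bij_betwI')
    fix u w assume "u \<in> \<Omega> \<times> label_set 1" "w \<in> \<Omega> \<times> label_set 1"
    then obtain i x j y where u: "u = (i, x)" "i \<in> \<Omega>" "x \<in> label_set 1"
      and w: "w = (j, y)" "j \<in> \<Omega>" "y \<in> label_set 1" by blast
    show "((case u of (i, x) \<Rightarrow> tr i x) = (case w of (i, x) \<Rightarrow> tr i x)) = (u = w)"
      using labelled_tr(2)[OF u(3,2)] labelled_tr(2)[OF w(3,2)] labelled_unique[of "tr i x" i j]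
        tr_inj[OF u(3) w(3) u(2)]
      unfolding u(1) w(1) by auto
  next
    fix u assume "u \<in> \<Omega> \<times> label_set 1"
    then show "(case u of (i, x) \<Rightarrow> tr i x) \<in> {x \<in> X. \<exists>i. labelled x i}" using labelled_tr by fastforce
  next
    fix y assume "y \<in> {x \<in> X. \<exists>i. labelled x i}"
    then obtain i where y: "y \<in> X" "labelled y i" by blast
    then obtain x where "x \<in> label_set 1" "y = tr i x" using tr_surj by blast
    then show "\<exists>u\<in>\<Omega> \<times> label_set 1. y = (case u of (i, x) \<Rightarrow> tr i x)"
      using y(2) by (intro bexI[of _ "(i, x)"]) (auto simp: labelled_def)
  qed
  then have "card (\<Omega> \<times> label_set 1) = card {x \<in> X. \<exists>i. labelled x i}" by (rule bij_betw_same_card)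
  then show ?thesis by (simp add: card_cartesian_product)
qed

end

section \<open>Minimal graphs\<close>

lemma aut_group_mult:
  assumes "\<alpha> \<in> carrier (aut_group Y)" "\<beta> \<in> carrier (aut_group Y)"
  shows "\<alpha> \<otimes>\<^bsub>aut_group Y\<^esub> \<beta> = (compose (verts Y) (fst \<alpha>) (fst \<beta>), compose (darts Y) (snd \<alpha>) (snd \<beta>))"
  using assms by (cases \<alpha>; cases \<beta>) (auto simp: aut_group_def DirProd_def BijGroup_def)

lemma aut_group_eqI:
  assumes "\<alpha> \<in> carrier (aut_group Y)" "\<beta> \<in> carrier (aut_group Y)"
    and "\<And>v. v \<in> verts Y \<Longrightarrow> fst \<alpha> v = fst \<beta> v" "\<And>d. d \<in> darts Y \<Longrightarrow> snd \<alpha> d = snd \<beta> d"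
  shows "\<alpha> = \<beta>"
proof (rule prod_eqI)
  have "fst \<alpha> \<in> extensional (verts Y)" "fst \<beta> \<in> extensional (verts Y)"
    "snd \<alpha> \<in> extensional (darts Y)" "snd \<beta> \<in> extensional (darts Y)"
    using assms(1,2) by (auto simp: aut_group_def Bij_def)
  then show "fst \<alpha> = fst \<beta>" "snd \<alpha> = snd \<beta>" using assms(3,4) by (auto intro: extensionalityI)
qed

section \<open>The actions on vertices, edges and darts\<close>

locale Gn_minimal_graph =
  fixes n :: nat and Y :: "('v, 'e) pregraph"
    and \<rho> :: "(nat \<Rightarrow> nat) \<times> int \<Rightarrow> ('v, 'e, 'v, 'e) gmap"
  assumes n_gt: "7 < n" and adm: "admissible Y" and minimal: "minimal_action (Gn n) Y \<rho>"
    and genus_le: "genus Y \<le> 2 * n"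
begin

lemma fin: "finite_graph Y" "graph Y" "finite (verts Y)" "finite (darts Y)" "connected_graph Y"
  using adm by (auto simp: admissible_def finite_graph_def)

lemma opp: "d \<in> darts Y \<Longrightarrow> opp Y d \<in> darts Y" "d \<in> darts Y \<Longrightarrow> opp Y (opp Y d) = d"
    "d \<in> darts Y \<Longrightarrow> opp Y d \<noteq> d" "d \<in> darts Y \<Longrightarrow> org Y d \<in> verts Y"
  using fin(2) by (auto simp: graph_def)

lemma rho_aut: "g \<in> carrier (Gn n) \<Longrightarrow> \<rho> g \<in> carrier (aut_group Y)"
  using minimal by (auto simp: minimal_action_def hom_def)

lemma rho_iso: "g \<in> carrier (Gn n) \<Longrightarrow> graph_iso Y Y (\<rho> g)"
  using rho_aut carrier_aut_group by blast

lemma rho_org: "g \<in> carrier (Gn n) \<Longrightarrow> d \<in> darts Y \<Longrightarrow> fst (\<rho> g) (org Y d) = org Y (snd (\<rho> g) d)"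
  using rho_iso by (auto simp: graph_iso_def)

lemma rho_opp: "g \<in> carrier (Gn n) \<Longrightarrow> d \<in> darts Y \<Longrightarrow> snd (\<rho> g) (opp Y d) = opp Y (snd (\<rho> g) d)"
  using rho_iso by (auto simp: graph_iso_def)

lemma rho_bij:
  assumes "g \<in> carrier (Gn n)"
  shows "bij_betw (fst (\<rho> g)) (verts Y) (verts Y)" "bij_betw (snd (\<rho> g)) (darts Y) (darts Y)"
  using rho_iso[OF assms] by (auto simp: graph_iso_def)

lemma rho_in:
  assumes "g \<in> carrier (Gn n)"
  shows "v \<in> verts Y \<Longrightarrow> fst (\<rho> g) v \<in> verts Y" "d \<in> darts Y \<Longrightarrow> snd (\<rho> g) d \<in> darts Y"
  using rho_bij[OF assms] bij_betwE by blast+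

lemma rho_mult:
  assumes "g \<in> carrier (Gn n)" "h \<in> carrier (Gn n)"
  shows "v \<in> verts Y \<Longrightarrow> fst (\<rho> (g \<otimes>\<^bsub>Gn n\<^esub> h)) v = fst (\<rho> g) (fst (\<rho> h) v)"
    and "d \<in> darts Y \<Longrightarrow> snd (\<rho> (g \<otimes>\<^bsub>Gn n\<^esub> h)) d = snd (\<rho> g) (snd (\<rho> h) d)"
proof -
  have "\<rho> (g \<otimes>\<^bsub>Gn n\<^esub> h) = \<rho> g \<otimes>\<^bsub>aut_group Y\<^esub> \<rho> h"
    using minimal assms by (auto simp: minimal_action_def hom_def)
  then have "\<rho> (g \<otimes>\<^bsub>Gn n\<^esub> h) = (compose (verts Y) (fst (\<rho> g)) (fst (\<rho> h)), compose (darts Y) (snd (\<rho> g)) (snd (\<rho> h)))"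
    using aut_group_mult[OF rho_aut[OF assms(1)] rho_aut[OF assms(2)]] by simp
  then show "v \<in> verts Y \<Longrightarrow> fst (\<rho> (g \<otimes>\<^bsub>Gn n\<^esub> h)) v = fst (\<rho> g) (fst (\<rho> h) v)"
    "d \<in> darts Y \<Longrightarrow> snd (\<rho> (g \<otimes>\<^bsub>Gn n\<^esub> h)) d = snd (\<rho> g) (snd (\<rho> h) d)"
    by (simp_all add: compose_def)
qed

lemma one_carrier: "(id, 0) \<in> carrier (Gn n)"
  by (simp add: Gn_carrier)

lemma rho_one:
  "v \<in> verts Y \<Longrightarrow> fst (\<rho> (id, 0)) v = v" "d \<in> darts Y \<Longrightarrow> snd (\<rho> (id, 0)) d = d"
proof -
  have e: "(id, 0) \<otimes>\<^bsub>Gn n\<^esub> (id, 0) = (id, 0)" by (simp add: Gn_mult)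
  show "fst (\<rho> (id, 0)) v = v" if "v \<in> verts Y"
    using rho_mult(1)[OF one_carrier one_carrier that] rho_in(1)[OF one_carrier that]
      bij_betw_imp_inj_on[OF rho_bij(1)[OF one_carrier]] that unfolding e by (metis inj_onD)
  show "snd (\<rho> (id, 0)) d = d" if "d \<in> darts Y"
    using rho_mult(2)[OF one_carrier one_carrier that] rho_in(2)[OF one_carrier that]
      bij_betw_imp_inj_on[OF rho_bij(2)[OF one_carrier]] that unfolding e by (metis inj_onD)
qed

lemma faithful:
  assumes "g \<in> carrier (Gn n)" "h \<in> carrier (Gn n)"
    and "\<And>v. v \<in> verts Y \<Longrightarrow> fst (\<rho> g) v = fst (\<rho> h) v" "\<And>d. d \<in> darts Y \<Longrightarrow> snd (\<rho> g) d = snd (\<rho> h) d"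
  shows "g = h"
  using aut_group_eqI[OF rho_aut[OF assms(1)] rho_aut[OF assms(2)] assms(3,4)] minimal assms(1,2)
  by (auto simp: minimal_action_def dest: inj_onD)

sublocale V: Gn_action n "verts Y" "\<lambda>g. fst (\<rho> g)"
  by unfold_locales (use n_gt rho_in rho_mult rho_one in auto)

sublocale D: Gn_action n "darts Y" "\<lambda>g. snd (\<rho> g)"
  by unfold_locales (use n_gt rho_in rho_mult rho_one in auto)

lemma edge_sub: "d \<in> darts Y \<Longrightarrow> edge Y d \<subseteq> darts Y"
  by (auto simp: edge_def opp)

lemma edge_act: "g \<in> carrier (Gn n) \<Longrightarrow> d \<in> darts Y \<Longrightarrow> snd (\<rho> g) ` edge Y d = edge Y (snd (\<rho> g) d)"
  by (simp add: edge_def rho_opp)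

text \<open>Unoriented edges need an action of their own: the genus bounds the number of edges in an
  orbit, and the resulting bound for darts would be twice as large, beyond the reach of
  \<open>invar_or_labelled\<close>.\<close>

sublocale E: Gn_action n "edge Y ` darts Y" "\<lambda>g e. snd (\<rho> g) ` e"
proof
  show "8 \<le> n" using n_gt by simp
  show "snd (\<rho> g) ` e \<in> edge Y ` darts Y" if "g \<in> carrier (Gn n)" "e \<in> edge Y ` darts Y" for g e
    using that(2) edge_act[OF that(1)] rho_in(2)[OF that(1)] by auto
  show "snd (\<rho> (g \<otimes>\<^bsub>Gn n\<^esub> h)) ` e = snd (\<rho> g) ` (snd (\<rho> h) ` e)"
    if "g \<in> carrier (Gn n)" "h \<in> carrier (Gn n)" "e \<in> edge Y ` darts Y" for g h e
    using that edge_sub rho_mult(2)[OF that(1,2)] unfolding image_image by (force intro!: image_cong)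
  show "snd (\<rho> (id, 0)) ` e = e" if "e \<in> edge Y ` darts Y" for e
    using that edge_sub rho_one(2) by force
qed

lemma reachable_closed:
  assumes "u \<in> S" "u \<in> verts Y" "v \<in> verts Y"
    and "\<And>d. d \<in> darts Y \<Longrightarrow> org Y d \<in> S \<Longrightarrow> org Y (opp Y d) \<in> S"
  shows "v \<in> S"
proof -
  have "(u, v) \<in> {(org Y d, org Y (opp Y d)) | d. d \<in> darts Y}\<^sup>*"
    using fin(5) assms(2,3) by (auto simp: connected_graph_def)
  then show ?thesis by (induction rule: rtrancl_induct) (use assms(1,4) in auto)
qed

text \<open>Admissibility speaks of valences 1 and 2. At valence 0 connectedness would reduce the
  graph to one vertex, on which the central involution acts as the identity, against
  faithfulness.\<close>

lemma valence_ge: "v \<in> verts Y \<Longrightarrow> 3 \<le> valence Y v"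
proof -
  assume v: "v \<in> verts Y"
  have "valence Y v \<noteq> 1 \<and> valence Y v \<noteq> 2" using adm v by (auto simp: admissible_def)
  moreover have "valence Y v \<noteq> 0"
  proof
    assume "valence Y v = 0"
    then have none: "org Y d \<noteq> v" if "d \<in> darts Y" for d
      using that fin(4) by (auto simp: valence_def)
    have "verts Y = {v}"
      using reachable_closed[of v "{v}"] v none by blast
    then have dY: "darts Y = {}" and vv: "verts Y = {v}" using opp(4) none by blast+
    have "(id, 1) \<in> carrier (Gn n)" by (simp add: Gn_carrier)
    then have "(id :: nat \<Rightarrow> nat, 1 :: int) = (id, 0)"
      by (rule faithful[OF _ one_carrier])
         (use vv dY rho_in(1)[OF one_carrier, of v] rho_in(1)[of "(id, 1)" v] in \<open>auto simp: Gn_carrier\<close>)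
    then show False by simp
  qed
  ultimately show ?thesis by linarith
qed

lemma obtain_dart:
  assumes "v \<in> verts Y"
  obtains d where "d \<in> darts Y" "org Y d = v"
proof -
  have "{d \<in> darts Y. org Y d = v} \<noteq> {}"
    using valence_ge[OF assms] unfolding valence_def by (metis card.empty not_numeral_le_zero)
  then show ?thesis using that by blast
qed

lemma card_darts_org:
  assumes "D \<subseteq> darts Y" "S \<subseteq> verts Y" "\<And>d. d \<in> darts Y \<Longrightarrow> org Y d \<in> S \<Longrightarrow> d \<in> D"
  shows "3 * card S + card {d \<in> D. org Y d \<notin> S} \<le> card D"
proof -
  have finD: "finite D" using assms(1) fin(4) finite_subset by blast
  have finS: "finite S" using assms(2) fin(3) finite_subset by blast
  have "card S * 3 \<le> (\<Sum>v\<in>S. card {d \<in> darts Y. org Y d = v})"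
    using sum_bounded_below[of S 3 "\<lambda>v. card {d \<in> darts Y. org Y d = v}"] valence_ge assms(2)
    by (auto simp: valence_def)
  also have "\<dots> = card (\<Union>v\<in>S. {d \<in> darts Y. org Y d = v})"
    by (rule card_UN_disjoint[symmetric]) (use finS fin(4) in auto)
  also have "(\<Union>v\<in>S. {d \<in> darts Y. org Y d = v}) = {d \<in> D. org Y d \<in> S}"
    using assms(1,3) by auto
  finally have "3 * card S + card {d \<in> D. org Y d \<notin> S}
      \<le> card {d \<in> D. org Y d \<in> S} + card {d \<in> D. org Y d \<notin> S}" by simp
  also have "\<dots> = card ({d \<in> D. org Y d \<in> S} \<union> {d \<in> D. org Y d \<notin> S})"
    using finD by (intro card_Un_disjoint[symmetric]) auto
  also have "{d \<in> D. org Y d \<in> S} \<union> {d \<in> D. org Y d \<notin> S} = D" by auto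
  finally show ?thesis .
qed

lemma verts_nonempty: "verts Y \<noteq> {}"
  using fin(5) by (simp add: connected_graph_def)

text \<open>E + 1 \<le> genus + V and 3V \<le> 2E together give V \<le> 2 genus - 2.\<close>

lemma card_verts_le: "card (verts Y) \<le> 4 * n - 2"
proof -
  obtain d where d: "d \<in> darts Y" using verts_nonempty obtain_dart by blast
  have "card (edge Y ` darts Y) + 1 \<le> genus Y + card (org Y ` darts Y)"
    using d opp(1) by (intro card_edges_le_genus_plus_verts[OF fin(1)]) auto
  moreover have "card (org Y ` darts Y) \<le> card (verts Y)"
    using opp(4) fin(3) by (intro card_mono) auto
  moreover have "card (darts Y) = 2 * card (edge Y ` darts Y)"
    using opp(1) fin by (intro card_edges) auto
  moreover have "3 * card (verts Y) + card {d \<in> darts Y. org Y d \<notin> verts Y} \<le> card (darts Y)"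
    by (rule card_darts_org) auto
  ultimately show ?thesis using genus_le by linarith
qed

lemma vert_cases:
  assumes "v \<in> verts Y" obtains "V.invar v" | i where "V.labelled v i"
proof -
  have "card ((\<lambda>p. fst (\<rho> (p, 0)) v) ` V.A) \<le> card (verts Y)"
    using fin(3) assms rho_in(1) V.A_G by (intro card_mono) auto
  then show ?thesis using V.invar_or_labelled[OF assms] card_verts_le n_gt that by fastforce
qed

lemma card_vert_orbit: "v \<in> verts Y \<Longrightarrow> card ((\<lambda>p. fst (\<rho> (p, 0)) v) ` V.A) \<le> n + 1"
  using V.card_orbit_le vert_cases by metis

text \<open>Each end of the edge sweeps out at most n + 1 vertices, so its orbit has at most 2n +
  (2n + 2) - 1 = 4n + 1 edges, exactly what \<open>invar_or_labelled\<close> tolerates.\<close>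

lemma edge_cases:
  assumes "d \<in> darts Y" obtains "E.invar (edge Y d)" | i where "E.labelled (edge Y d) i"
proof -
  define O1 where "O1 x = (\<lambda>p. snd (\<rho> (p, 0)) x) ` D.A" for x
  \<comment> \<open>Both orientations are included so that the set is closed under
    \<open>opp\<close> even if no even permutation reverses the edge.\<close>
  define O' where "O' = O1 d \<union> O1 (opp Y d)"
  have sub: "O' \<subseteq> darts Y" unfolding O'_def O1_def using assms opp(1) rho_in(2) D.A_G by auto
  have closed: "opp Y x \<in> O'" if xO: "x \<in> O'" for x
  proof -
    obtain p where p: "p \<in> D.A" "x = snd (\<rho> (p, 0)) d \<or> x = snd (\<rho> (p, 0)) (opp Y d)"
      using xO unfolding O'_def O1_def by blast
    then have "opp Y x = snd (\<rho> (p, 0)) (opp Y d) \<or> opp Y x = snd (\<rho> (p, 0)) d"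
      using rho_opp[OF D.A_G[OF p(1)] assms] rho_in(2)[OF D.A_G[OF p(1)] assms] opp(2) by auto
    then show ?thesis using p(1) by (auto simp: O'_def O1_def)
  qed
  have eO: "edge Y ` O' = (\<lambda>p. snd (\<rho> (p, 0)) ` edge Y d) ` D.A" (is "_ = ?EO")
  proof
    show "edge Y ` O' \<subseteq> ?EO"
    proof
      fix e assume "e \<in> edge Y ` O'"
      then obtain p x where p: "p \<in> D.A" "e = edge Y (snd (\<rho> (p, 0)) x)" "x = d \<or> x = opp Y d"
        by (auto simp: O'_def O1_def)
      moreover have "edge Y (opp Y d) = edge Y d" using opp(2)[OF assms] by (auto simp: edge_def)
      ultimately have "e = snd (\<rho> (p, 0)) ` edge Y d"
        using edge_act[OF D.A_G[OF p(1)]] assms opp(1) by metis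
      then show "e \<in> ?EO" using p(1) by blast
    qed
    show "?EO \<subseteq> edge Y ` O'"
      using edge_act[OF D.A_G] assms by (auto simp: O'_def O1_def)
  qed
  have org: "org Y ` O1 x = (\<lambda>p. fst (\<rho> (p, 0)) (org Y x)) ` V.A" if "x \<in> darts Y" for x
    unfolding O1_def image_image using rho_org[OF D.A_G _ ] that by (intro image_cong) auto
  have "card (org Y ` O1 x) \<le> n + 1" if "x \<in> darts Y" for x
    unfolding org[OF that] using card_vert_orbit opp(4) that by blast
  then have "card (org Y ` O1 d) \<le> n + 1" "card (org Y ` O1 (opp Y d)) \<le> n + 1"
    using assms opp(1) by blast+
  then have "card (org Y ` O') \<le> 2 * n + 2"
    unfolding O'_def image_Un using card_Un_le[of "org Y ` O1 d" "org Y ` O1 (opp Y d)"] by linarith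
  moreover have "snd (\<rho> (id, 0)) d \<in> O'"
    unfolding O'_def O1_def by (intro UnI1 imageI[where f = "\<lambda>p. snd (\<rho> (p, 0)) d"] even_perms_id)
  then have "card (edge Y ` O') + 1 \<le> genus Y + card (org Y ` O')"
    using sub closed by (intro card_edges_le_genus_plus_verts[OF fin(1)]) auto
  ultimately have "card ?EO \<le> 4 * n + 1" using genus_le unfolding eO by linarith
  then show ?thesis using E.invar_or_labelled[of "edge Y d"] assms that by blast
qed

text \<open>A three-cycle preserving an edge cannot reverse it, having odd order.\<close>

lemma edge_stabilizer:
  assumes "d \<in> darts Y" "S \<subseteq> D.\<Omega>" "\<And>p. p \<in> even_perms S \<Longrightarrow> snd (\<rho> (p, 0)) ` edge Y d = edge Y d"
    and "p \<in> even_perms S"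
  shows "snd (\<rho> (p, 0)) d = d"
proof -
  have SA: "even_perms S \<subseteq> D.A" using even_perms_mono assms(2) by blast
  let ?H = "{p \<in> D.A. snd (\<rho> (p, 0)) d = d}"
  have "even_perms S \<subseteq> ?H"
  proof (rule even_perms_subset_of_three_cycles)
    show "finite S" using assms(2) finite_subset by blast
    show "id \<in> ?H" using rho_one(2)[OF assms(1)] by simp
    show "p \<circ> q \<in> ?H" if "p \<in> ?H" "q \<in> ?H" for p q
      using that D.A_comp D.act_comp assms(1) by auto
    fix a b c assume abc: "distinct [a, b, c]" "{a, b, c} \<subseteq> S"
    let ?t = "three_cycle a b c"
    have tS: "?t \<in> even_perms S" using three_cycle_even_perms[OF abc] .
    then have tA: "?t \<in> D.A" using SA by blast
    have "snd (\<rho> (?t, 0)) d \<in> edge Y d" using assms(3)[OF tS] by (auto simp: edge_def)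
    moreover have "snd (\<rho> (?t, 0)) d \<noteq> opp Y d"
    proof
      assume 1: "snd (\<rho> (?t, 0)) d = opp Y d"
      then have 2: "snd (\<rho> (?t, 0)) (opp Y d) = d"
        using rho_opp[OF D.A_G[OF tA] assms(1)] opp(2)[OF assms(1)] by simp
      have "?t \<circ> (?t \<circ> ?t) = id" using abc(1) by (auto simp: fun_eq_iff three_cycle_apply)
      then have "d = snd (\<rho> (?t, 0)) (snd (\<rho> (?t, 0)) (snd (\<rho> (?t, 0)) d))"
        using D.act_comp[OF tA D.A_comp[OF tA tA] assms(1)] D.act_comp[OF tA tA assms(1)]
          rho_one(2)[OF assms(1)] by simp
      then show False using 1 2 opp(3)[OF assms(1)] by simp
    qed
    ultimately show "?t \<in> ?H" using tA by (auto simp: edge_def)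
  qed
  then show ?thesis using assms(4) by blast
qed

lemma edge_invar_iff: "d \<in> darts Y \<Longrightarrow> E.invar (edge Y d) \<longleftrightarrow> D.invar d"
proof
  assume d: "d \<in> darts Y"
  show "D.invar d" if "E.invar (edge Y d)"
    using edge_stabilizer[OF d order.refl] that unfolding D.invar_def E.invar_def by blast
  show "E.invar (edge Y d)" if "D.invar d"
    using that edge_act[OF D.A_G d] unfolding D.invar_def E.invar_def by simp
qed

text \<open>A dart inherits the label of its edge: the stabilizer of the edge is the alternating
  group on the remaining points, and by \<open>edge_stabilizer\<close> none of its elements reverses
  the edge.\<close>

lemma dart_cases:
  assumes "d \<in> darts Y" obtains "D.invar d" | i where "D.labelled d i"
  using assms
proof (cases rule: edge_cases)
  case 1
  then show ?thesis using that edge_invar_iff assms by blast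
next
  case (2 i)
  have "snd (\<rho> (p, 0)) d = d \<longleftrightarrow> p i = i" if p: "p \<in> D.A" for p
  proof
    assume "snd (\<rho> (p, 0)) d = d"
    then have "snd (\<rho> (p, 0)) ` edge Y d = edge Y d" using edge_act[OF D.A_G[OF p] assms] by simp
    then show "p i = i" using 2 p by (simp add: E.labelled_def)
  next
    assume "p i = i"
    then have "p \<in> even_perms (D.\<Omega> - {i})" by (rule even_perms_fixing[OF p])
    moreover have "snd (\<rho> (q, 0)) ` edge Y d = edge Y d" if "q \<in> even_perms (D.\<Omega> - {i})" for q
    proof -
      have "q \<in> D.A" using that even_perms_mono[of "D.\<Omega> - {i}" "D.\<Omega>"] by auto
      moreover have "q i = i" using that permutes_not_in[of q "D.\<Omega> - {i}" i] by (simp add: even_perms_def)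
      ultimately show ?thesis using 2 by (simp add: E.labelled_def)
    qed
    ultimately show "snd (\<rho> (p, 0)) d = d"
      using edge_stabilizer[OF assms Diff_subset, of "{i}" p] by metis
  qed
  then have "D.labelled d i" using 2 unfolding D.labelled_def E.labelled_def by blast
  then show ?thesis using that by blast
qed

lemma labelled_opp: "d \<in> darts Y \<Longrightarrow> D.labelled d i \<Longrightarrow> D.labelled (opp Y d) i"
  using rho_opp[OF D.A_G] rho_in(2)[OF D.A_G] opp(2) unfolding D.labelled_def by metis

lemma invar_org: "d \<in> darts Y \<Longrightarrow> D.invar d \<Longrightarrow> V.invar (org Y d)"
  using rho_org[OF D.A_G] unfolding D.invar_def V.invar_def by simp

text \<open>Whatever fixes a dart fixes its origin, and one point stabilizer is contained in another
  only if the points coincide.\<close>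

lemma labelled_org:
  assumes "d \<in> darts Y" "D.labelled d i"
  shows "V.invar (org Y d) \<or> V.labelled (org Y d) i"
  using opp(4)[OF assms(1)]
proof (cases rule: vert_cases)
  case (2 j)
  have "i = j"
  proof (rule D.stabilizer_le_imp_eq)
    fix p assume "p \<in> D.A" "p i = i"
    then show "p j = j" using assms 2 rho_org[OF D.A_G, of p d] unfolding D.labelled_def V.labelled_def by metis
  qed (use assms 2 in \<open>auto simp: D.labelled_def V.labelled_def\<close>)
  then show ?thesis using 2 by simp
qed simp

lemma labelled_dart_at:
  assumes "d \<in> darts Y" "V.labelled (org Y d) i"
  shows "D.labelled d i"
  using assms(1)
proof (cases rule: dart_cases)
  case 1
  then show ?thesis using invar_org assms V.labelled_not_invar by blast
next
  case (2 j)
  then have "V.labelled (org Y d) j" using labelled_org[OF assms(1)] V.labelled_not_invar[OF assms(2)] by blast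
  then show ?thesis using 2 V.labelled_unique assms(2) by blast
qed

end

text \<open>A non-trivial involution of three points has exactly one fixed point, which a commuting
  involution has to preserve.\<close>

lemma commuting_involutions_fixpoint:
  assumes "card U = 3"
    and \<phi>: "\<And>x. x \<in> U \<Longrightarrow> \<phi> x \<in> U" "\<And>x. x \<in> U \<Longrightarrow> \<phi> (\<phi> x) = x"
    and \<psi>: "\<And>x. x \<in> U \<Longrightarrow> \<psi> x \<in> U" "\<And>x. x \<in> U \<Longrightarrow> \<psi> (\<psi> x) = x"
    and comm: "\<And>x. x \<in> U \<Longrightarrow> \<phi> (\<psi> x) = \<psi> (\<phi> x)"
  obtains u where "u \<in> U" "\<phi> u = u" "\<psi> u = u"
proof -
  have uniq: "\<exists>c\<in>U. f c = c \<and> (\<forall>x\<in>U. f x = x \<longrightarrow> x = c)"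
    if f: "\<And>x. x \<in> U \<Longrightarrow> f x \<in> U" "\<And>x. x \<in> U \<Longrightarrow> f (f x) = x" and a: "a \<in> U" "f a \<noteq> a" for f a
  proof -
    have "finite U" using assms(1) by (metis card.infinite zero_neq_numeral)
    then have "card (U - {a, f a}) = 1" using assms(1) f a by (simp add: card_Diff_subset)
    then obtain c where c: "U - {a, f a} = {c}" by (auto simp: card_1_singleton_iff)
    then have U: "U = {a, f a, c}" "c \<noteq> a" "c \<noteq> f a" "c \<in> U" using a f by blast+
    have "f c \<noteq> a" using f(2)[OF U(4)] U(3) by metis
    moreover have "f c \<noteq> f a" using f(2)[OF U(4)] f(2)[OF a(1)] U(2) by metis
    ultimately have "f c = c" using f(1)[OF U(4)] U(1) by blast
    moreover have "f (f a) \<noteq> f a" using f(2)[OF a(1)] a(2) by simp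
    ultimately show ?thesis using U a(2) by blast
  qed
  show ?thesis
  proof (cases "\<forall>x\<in>U. \<phi> x = x")
    case True
    show ?thesis
    proof (cases "\<forall>x\<in>U. \<psi> x = x")
      case True
      moreover obtain u where "u \<in> U" using assms(1) by (metis card.empty equals0I zero_neq_numeral)
      ultimately show ?thesis using that \<open>\<forall>x\<in>U. \<phi> x = x\<close> by blast
    next
      case False
      then obtain a where "a \<in> U" "\<psi> a \<noteq> a" by blast
      then show ?thesis using uniq[of \<psi> a] \<psi> True that by blast
    qed
  next
    case False
    then obtain a where "a \<in> U" "\<phi> a \<noteq> a" by blast
    then obtain c where c: "c \<in> U" "\<phi> c = c" "\<And>x. x \<in> U \<Longrightarrow> \<phi> x = x \<Longrightarrow> x = c"
      using uniq[of \<phi> a] \<phi> by blast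
    have "\<psi> c = c" using c(3)[OF \<psi>(1)[OF c(1)]] comm[OF c(1)] c(2) by simp
    then show ?thesis using that c by blast
  qed
qed

text \<open>\<open>k\<close> and \<open>W\<close> are the numbers of orbits of moved edges and moved
  vertices, \<open>t\<close> counts the darts labelled 1 that start at fixed vertices, and
  \<open>f\<close> counts those vertices. The third hypothesis is twice the bound E + 1 \<le> 2n + V
  for the moved edges. With x = k - W it forces \<open>f\<close> to grow like (n + 1) x - 2n,
  whereas valences give f \<le> 2x - W; so x \<le> 2.\<close>

lemma orbit_count_cases:
  fixes n k W t f :: nat
  assumes "8 \<le> n" "1 \<le> k" "(n + 1) * (2 * k) + 2 \<le> 4 * n + 2 * f + 2 * ((n + 1) * W)"
    and "3 * W + t \<le> 2 * k" "f \<le> t" "1 \<le> W \<Longrightarrow> 1 \<le> t"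
  shows "W = 0 \<and> k = 1 \<or> W = 0 \<and> k = 2 \<and> 3 \<le> f \<or> W = 1 \<and> k = 2 \<and> t = 1 \<or> W = 1 \<and> k = 3 \<and> t = 3 \<and> f = 3"
proof -
  have "W \<le> k" using assms(4) by linarith
  then obtain x where x: "k = W + x" using le_Suc_ex by blast
  obtain m where m: "n = m + 1" using assms(1) by (metis add.commute le_Suc_ex le_trans one_le_numeral)
  \<comment> \<open>Substituting n = m + 1 and k = W + x removes truncated subtraction and isolates
    the terms with \<open>W\<close>, which then cancel.\<close>
  have e: "(n + 1) * (2 * k) = 2 * (m * x) + 4 * x + 2 * ((n + 1) * W)"
    unfolding x m by (simp add: algebra_simps)
  have *: "2 * (m * x) + 4 * x + 2 \<le> 4 * n + 2 * f" using assms(3) unfolding e by linarith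
  have "x \<le> 2"
  proof (rule ccontr)
    assume "\<not> x \<le> 2"
    then have "m * 3 \<le> m * x" by (intro mult_le_mono2) simp
    then show False using * assms x m by linarith
  qed
  then consider "x = 0" | "x = 1" | "x = 2" by linarith
  then show ?thesis
  proof cases
    case 1
    then show ?thesis using * assms x m by auto
  next
    case 2
    then have "W \<le> 1" using assms x m by (cases "W = 0") auto
    then show ?thesis using 2 * assms x m by (cases "W = 0") auto
  next
    case 3
    then have "W \<le> 1" using * assms x m by auto
    then show ?thesis using 3 * assms x m by (cases "W = 0") auto
  qed
qed

text \<open>The boundary of an antisymmetric chain sums to 0 over all vertices. For an edge orbit
  with at most two ends, one boundary condition therefore implies the other.\<close>

lemma sum_two_vertices:
  fixes c :: "'e \<Rightarrow> rat"
  assumes "finite B" "\<And>d. d \<in> B \<Longrightarrow> op d \<in> B" "\<And>d. d \<in> B \<Longrightarrow> op (op d) = d"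
    and anti: "\<And>d. d \<in> B \<Longrightarrow> c (op d) = - c d" and sub: "og ` B \<subseteq> {a, b}"
    and a0: "(\<Sum>d | d \<in> B \<and> og d = a. c d) = 0"
  shows "(\<Sum>d | d \<in> B \<and> og d = v. c d) = 0"
proof -
  have "bij_betw op B B" by (rule bij_betw_byWitness[where f' = op]) (use assms(2,3) in auto)
  then have "(\<Sum>d\<in>B. c d) = (\<Sum>d\<in>B. c (op d))" by (rule sum.reindex_bij_betw[symmetric])
  also have "\<dots> = - (\<Sum>d\<in>B. c d)" by (simp add: anti sum_negf)
  finally have all0: "(\<Sum>d\<in>B. c d) = 0" by simp
  consider "v = a" | "v = b" "a \<noteq> b" | "v \<notin> {a, b}" by blast
  then show ?thesis
  proof cases
    case 1
    then show ?thesis using a0 by simp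
  next
    case 2
    have "B = {d \<in> B. og d = a} \<union> {d \<in> B. og d = b}" using sub by auto
    then have "(\<Sum>d\<in>B. c d) = (\<Sum>d | d \<in> B \<and> og d = a. c d) + (\<Sum>d | d \<in> B \<and> og d = b. c d)"
      using sum.union_disjoint[of "{d \<in> B. og d = a}" "{d \<in> B. og d = b}" c] assms(1) 2(2) by fastforce
    then show ?thesis using all0 a0 2 by simp
  next
    case 3
    then have "{d \<in> B. og d = v} = {}" using sub by auto
    then show ?thesis by (simp only: sum.empty)
  qed
qed

section \<open>Counting moved darts and vertices\<close>

context Gn_minimal_graph
begin

definition moved_darts :: "'e set" where
  "moved_darts = {d \<in> darts Y. \<exists>i. D.labelled d i}"

abbreviation D\<^sub>1 :: "'e set" where "D\<^sub>1 \<equiv> D.label_set 1"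
abbreviation V\<^sub>1 :: "'v set" where "V\<^sub>1 \<equiv> V.label_set 1"

text \<open>Label 1 selects one of the N isomorphic pieces of the moved part; these darts are where
  that piece is attached to fixed vertices.\<close>

definition F\<^sub>1 :: "'e set" where
  "F\<^sub>1 = {d \<in> D\<^sub>1. V.invar (org Y d)}"

lemma D1: "d \<in> D\<^sub>1 \<Longrightarrow> d \<in> darts Y" "d \<in> D\<^sub>1 \<Longrightarrow> D.labelled d 1" "d \<in> D\<^sub>1 \<Longrightarrow> opp Y d \<in> D\<^sub>1"
  using labelled_opp opp(1) by (auto simp: D.label_set_def)

lemma fin_D1: "finite D\<^sub>1" "finite V\<^sub>1" "finite F\<^sub>1" "finite moved_darts"
  using fin by (auto simp: D.label_set_def V.label_set_def F\<^sub>1_def moved_darts_def)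

lemma moved_darts_opp: "d \<in> moved_darts \<Longrightarrow> opp Y d \<in> moved_darts"
  using labelled_opp opp(1) by (auto simp: moved_darts_def)

lemma tr_dart:
  assumes "d \<in> D\<^sub>1" "i \<in> D.\<Omega>"
  shows "org Y (D.tr i d) = V.tr i (org Y d)" "opp Y (D.tr i d) = D.tr i (opp Y d)"
proof -
  note m = D.A_G[OF D.move(1)[OF D.one_\<Omega> assms(2)]]
  show "org Y (D.tr i d) = V.tr i (org Y d)"
    using rho_org[OF m D1(1)[OF assms(1)]] by (simp add: D.tr_def V.tr_def)
  show "opp Y (D.tr i d) = D.tr i (opp Y d)"
    using rho_opp[OF m D1(1)[OF assms(1)]] by (simp add: D.tr_def)
qed

lemma V_tr_invar: "V.invar v \<Longrightarrow> i \<in> D.\<Omega> \<Longrightarrow> V.tr i v = v"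
  using D.move(1)[OF D.one_\<Omega>] by (auto simp: V.tr_def V.invar_def)

lemma org_D1: "d \<in> D\<^sub>1 \<Longrightarrow> V.invar (org Y d) \<or> org Y d \<in> V\<^sub>1"
  using labelled_org[OF D1(1) D1(2)] opp(4) D1(1) by (auto simp: V.label_set_def)

lemma V1_not_invar: "v \<in> V\<^sub>1 \<Longrightarrow> \<not> V.invar v"
  using V.labelled_not_invar by (auto simp: V.label_set_def)

lemma moved_dart_cases:
  assumes "d \<in> moved_darts"
  obtains i x where "i \<in> D.\<Omega>" "x \<in> D\<^sub>1" "d = D.tr i x" "D.labelled d i"
proof -
  obtain i where i: "d \<in> darts Y" "D.labelled d i" using assms by (auto simp: moved_darts_def)
  then obtain x where "x \<in> D\<^sub>1" "d = D.tr i x" using D.tr_surj by blast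
  then show ?thesis using that i by (auto simp: D.labelled_def)
qed

lemma tr_moved: "x \<in> D\<^sub>1 \<Longrightarrow> i \<in> D.\<Omega> \<Longrightarrow> D.tr i x \<in> moved_darts"
  using D.labelled_tr by (fastforce simp: moved_darts_def)

lemma invar_org_tr:
  assumes "x \<in> D\<^sub>1" "i \<in> D.\<Omega>" "V.invar (org Y (D.tr i x))"
  shows "x \<in> F\<^sub>1" "org Y (D.tr i x) = org Y x"
proof -
  have "org Y x \<notin> V\<^sub>1"
  proof
    assume "org Y x \<in> V\<^sub>1"
    then have "V.labelled (V.tr i (org Y x)) i" using V.labelled_tr(2) assms(2) by blast
    then show False using assms V.labelled_not_invar tr_dart(1) by metis
  qed
  then show "x \<in> F\<^sub>1" using org_D1 assms(1) by (auto simp: F\<^sub>1_def)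
  then show "org Y (D.tr i x) = org Y x"
    using tr_dart(1)[OF assms(1,2)] V_tr_invar assms(2) by (simp add: F\<^sub>1_def)
qed

lemma invar_org_moved:
  assumes "d \<in> moved_darts" "V.invar (org Y d)"
  shows "org Y d \<in> org Y ` F\<^sub>1"
  using moved_dart_cases[OF assms(1)] invar_org_tr assms(2) by (metis imageI)

lemma D1_nonempty: "D\<^sub>1 \<noteq> {}"
proof
  assume e: "D\<^sub>1 = {}"
  have di: "D.invar d" if "d \<in> darts Y" for d
    using that
  proof (cases rule: dart_cases)
    case (2 i)
    then show ?thesis using D.tr_surj[OF that 2] e by blast
  qed
  have vi: "V.invar v" if "v \<in> verts Y" for v
    using obtain_dart[OF that] di invar_org by metis
  let ?t = "three_cycle 1 2 (3 :: nat)"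
  have d: "distinct [1, 2, 3 :: nat]" by simp
  have t: "?t \<in> D.A" using n_gt by (intro three_cycle_even_perms) auto
  have "(?t, 0 :: int) = (id, 0)"
    by (rule faithful[OF D.A_G[OF t] one_carrier])
       (use t di vi rho_one in \<open>auto simp: D.invar_def V.invar_def\<close>)
  then have "?t 1 = 1" by simp
  then show False using three_cycle_apply[OF d, of 1] by simp
qed

lemma card_moved: "card moved_darts = (n + 1) * card D\<^sub>1" "card moved_darts = 2 * card (edge Y ` moved_darts)"
    "card D\<^sub>1 = 2 * card (edge Y ` D\<^sub>1)"
proof -
  show "card moved_darts = (n + 1) * card D\<^sub>1"
    using D.card_labelled fin(4) by (simp add: moved_darts_def)
  show "card moved_darts = 2 * card (edge Y ` moved_darts)"
    using moved_darts_opp fin_D1 fin(2) by (intro card_edges) (auto simp: moved_darts_def)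
  show "card D\<^sub>1 = 2 * card (edge Y ` D\<^sub>1)"
    using D1 fin_D1 fin(2) by (intro card_edges) auto
qed

text \<open>The first claim is the genus count for all moved edges, the second the valence count in
  one piece. The third is connectedness: without attaching darts no edge would leave
  \<open>V\<^sub>1\<close>, and the translates labelled 2 could not be reached.\<close>

lemma orbit_counts:
  "(n + 1) * card D\<^sub>1 + 2 \<le> 4 * n + 2 * card (org Y ` F\<^sub>1) + 2 * ((n + 1) * card V\<^sub>1)"
  "3 * card V\<^sub>1 + card F\<^sub>1 \<le> card D\<^sub>1"
  "1 \<le> card V\<^sub>1 \<Longrightarrow> 1 \<le> card F\<^sub>1"
proof -
  let ?MV = "{v \<in> verts Y. \<exists>i. V.labelled v i}"
  have "org Y ` moved_darts \<subseteq> org Y ` F\<^sub>1 \<union> ?MV"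
  proof
    fix v assume "v \<in> org Y ` moved_darts"
    then obtain d where d: "d \<in> moved_darts" "v = org Y d" by blast
    then have v: "v \<in> verts Y" using opp(4) by (auto simp: moved_darts_def)
    then show "v \<in> org Y ` F\<^sub>1 \<union> ?MV"
      by (cases rule: vert_cases) (use d invar_org_moved v in auto)
  qed
  then have "card (org Y ` moved_darts) \<le> card (org Y ` F\<^sub>1 \<union> ?MV)"
    using fin_D1 fin(3) by (intro card_mono) auto
  also have "\<dots> \<le> card (org Y ` F\<^sub>1) + (n + 1) * card V\<^sub>1"
    using card_Un_le[of "org Y ` F\<^sub>1" ?MV] V.card_labelled[OF fin(3)] by simp
  finally have 1: "card (org Y ` moved_darts) \<le> card (org Y ` F\<^sub>1) + (n + 1) * card V\<^sub>1" .
  have "moved_darts \<noteq> {}" using D1_nonempty D1 by (auto simp: moved_darts_def)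
  then have "card (edge Y ` moved_darts) + 1 \<le> genus Y + card (org Y ` moved_darts)"
    using moved_darts_opp by (intro card_edges_le_genus_plus_verts[OF fin(1)]) (auto simp: moved_darts_def)
  then show "(n + 1) * card D\<^sub>1 + 2 \<le> 4 * n + 2 * card (org Y ` F\<^sub>1) + 2 * ((n + 1) * card V\<^sub>1)"
    using 1 card_moved genus_le by linarith
  have "{d \<in> D\<^sub>1. org Y d \<notin> V\<^sub>1} = F\<^sub>1" using org_D1 V1_not_invar by (auto simp: F\<^sub>1_def)
  moreover have "3 * card V\<^sub>1 + card {d \<in> D\<^sub>1. org Y d \<notin> V\<^sub>1} \<le> card D\<^sub>1"
    using D1(1) labelled_dart_at
    by (intro card_darts_org) (auto simp: V.label_set_def D.label_set_def)
  ultimately show "3 * card V\<^sub>1 + card F\<^sub>1 \<le> card D\<^sub>1" by simp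
  show "1 \<le> card F\<^sub>1" if "1 \<le> card V\<^sub>1"
  proof (rule ccontr)
    assume "\<not> 1 \<le> card F\<^sub>1"
    then have F: "F\<^sub>1 = {}" using fin_D1 by (simp add: not_le)
    obtain v where v: "v \<in> V\<^sub>1" using \<open>1 \<le> card V\<^sub>1\<close> by fastforce
    then have v': "v \<in> verts Y" "V.labelled v 1" by (auto simp: V.label_set_def)
    have two: "2 \<in> D.\<Omega>" using n_gt by simp
    have w: "V.tr 2 v \<in> verts Y" "V.labelled (V.tr 2 v) 2" using V.labelled_tr[OF v two] by blast+
    have "V.tr 2 v \<in> V\<^sub>1"
    proof (rule reachable_closed[OF v v'(1) w(1)])
      fix d assume d: "d \<in> darts Y" "org Y d \<in> V\<^sub>1"
      then have "d \<in> D\<^sub>1" using labelled_dart_at[of d 1] by (simp add: V.label_set_def D.label_set_def)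
      then show "org Y (opp Y d) \<in> V\<^sub>1" using D1(3) org_D1 F by (auto simp: F\<^sub>1_def)
    qed
    then show False using w(2) V.labelled_unique[of "V.tr 2 v" 1 2] by (simp add: V.label_set_def)
  qed
qed

text \<open>The first alternative leads to the rose and the cage, the second to the double cage. The
  last two contain a moved vertex and are excluded by \<open>no_moved_vertices\<close>.\<close>

lemma orbit_cases:
  "V\<^sub>1 = {} \<and> card D\<^sub>1 = 2 \<or> V\<^sub>1 = {} \<and> card D\<^sub>1 = 4 \<and> 3 \<le> card (org Y ` D\<^sub>1) \<or>
   card V\<^sub>1 = 1 \<and> card D\<^sub>1 = 4 \<and> card F\<^sub>1 = 1 \<or>
   card V\<^sub>1 = 1 \<and> card D\<^sub>1 = 6 \<and> card F\<^sub>1 = 3 \<and> card (org Y ` F\<^sub>1) = 3"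
proof -
  have "card D\<^sub>1 \<noteq> 0" using D1_nonempty fin_D1 by simp
  then have "1 \<le> card (edge Y ` D\<^sub>1)" using card_moved(3) by linarith
  moreover have "card (org Y ` F\<^sub>1) \<le> card (org Y ` D\<^sub>1)" using fin_D1
    by (intro card_mono image_mono) (auto simp: F\<^sub>1_def)
  moreover note orbit_count_cases[of n "card (edge Y ` D\<^sub>1)" "card (org Y ` F\<^sub>1)" "card V\<^sub>1" "card F\<^sub>1"]
    orbit_counts[unfolded card_moved(3)] card_image_le[OF fin_D1(3), of "org Y"]
  ultimately show ?thesis using n_gt card_moved(3) fin_D1(2) by auto
qed

end

lemma image_eq_singleton_iff: "a \<in> A \<Longrightarrow> f ` A = {b} \<longleftrightarrow> (\<forall>x\<in>A. f x = b)"
  by auto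

section \<open>Excluding moved vertices\<close>

context Gn_minimal_graph
begin

text \<open>If one vertex orbit is moved, its vertices have valence 3. A loop there would leave a separating
  edge; otherwise the moved edges form the complete bipartite graph on \<open>3 + (n + 1)\<close> vertices, on
  whose three fixed vertices \<open>G\<^sub>n\<close> acts through a group of order 4. So it fixes one of them, and
  the star around that vertex is an invariant forest.\<close>

lemma no_moved_vertices: "V\<^sub>1 = {}"
proof (rule ccontr)
  assume ne: "V\<^sub>1 \<noteq> {}"
  then have W: "card V\<^sub>1 = 1" using orbit_cases by blast
  then obtain v where v: "V\<^sub>1 = {v}" by (auto simp: card_1_singleton_iff)
  have vY: "v \<in> verts Y" "V.labelled v 1" using v by (auto simp: V.label_set_def)
  define S where "S = {d \<in> darts Y. org Y d = v}"
  have S_D1: "S \<subseteq> D\<^sub>1" using labelled_dart_at vY by (auto simp: S_def D.label_set_def)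
  have split: "D\<^sub>1 = S \<union> F\<^sub>1" "S \<inter> F\<^sub>1 = {}"
  proof -
    have "x \<in> S \<union> F\<^sub>1" if "x \<in> D\<^sub>1" for x
      using org_D1[OF that] D1(1)[OF that] v that by (auto simp: S_def F\<^sub>1_def)
    then show "D\<^sub>1 = S \<union> F\<^sub>1" using S_D1 by (auto simp: F\<^sub>1_def)
    show "S \<inter> F\<^sub>1 = {}" using V1_not_invar v by (auto simp: S_def F\<^sub>1_def)
  qed
  have finS: "finite S" using S_D1 fin_D1 finite_subset by blast
  have cS: "card D\<^sub>1 = card S + card F\<^sub>1" using split finS fin_D1 card_Un_disjoint by metis
  have S3: "card S = 3" using orbit_cases ne W cS by auto
  \<comment> \<open>A loop uses two of the three darts at \<open>v\<close> and cancels in the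
    boundary there, so every cycle vanishes on the third dart.\<close>
  have noloop: "opp Y d \<notin> S" if d: "d \<in> S" for d
  proof
    assume od: "opp Y d \<in> S"
    have dY: "d \<in> darts Y" using d by (simp add: S_def)
    have "card (S - {d, opp Y d}) = 1" using S3 d od opp(3)[OF dY] finS by (simp add: card_Diff_subset)
    then obtain e where e: "S - {d, opp Y d} = {e}" by (auto simp: card_1_singleton_iff)
    then have Se: "S = {d, opp Y d, e}" "e \<noteq> d" "e \<noteq> opp Y d" "e \<in> darts Y" using d od by (auto simp: S_def)
    obtain c where c: "c \<in> H1 Y" "c e \<noteq> 0"
      using minimal_action_no_separating_edge[OF fin(1) minimal Se(4)] by blast
    have "(\<Sum>x | x \<in> darts Y \<and> org Y x = v. c x) = 0" using c(1) vY(1) by (simp add: H1_def)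
    then have "(\<Sum>x\<in>{d, opp Y d, e}. c x) = 0" using Se(1) by (simp add: S_def)
    moreover have "c (opp Y d) = - c d" using c(1) dY by (simp add: H1_def)
    ultimately show False using c(2) Se(2,3) opp(3)[OF dY] by simp
  qed
  have oppSF: "opp Y ` S \<subseteq> F\<^sub>1" using noloop split S_D1 D1(3) by blast
  have inj: "inj_on (opp Y) S" using opp(2) by (intro inj_onI) (metis S_def mem_Collect_eq)
  \<comment> \<open>Three attaching darts are compatible only with the last alternative of
    \<open>orbit_cases\<close>, which also makes their origins distinct.\<close>
  then have "3 \<le> card F\<^sub>1" using card_mono[OF fin_D1(3) oppSF] S3 by (simp add: card_image)
  then have F3: "card F\<^sub>1 = 3" "card (org Y ` F\<^sub>1) = 3" using orbit_cases ne W by auto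
  have FS: "opp Y x \<in> S" if xF: "x \<in> F\<^sub>1" for x
  proof -
    have "opp Y ` S = F\<^sub>1" using oppSF card_subset_eq[OF fin_D1(3)] inj S3 F3(1) by (simp add: card_image)
    then obtain d where "d \<in> S" "x = opp Y d" using xF by blast
    then show ?thesis using opp(2) by (simp add: S_def)
  qed
  have org_inj: "inj_on (org Y) F\<^sub>1" using F3 fin_D1(3) by (intro eq_card_imp_inj_on) auto
  define U where "U = org Y ` F\<^sub>1"
  have gU: "fst (\<rho> g) u \<in> U" if g: "g \<in> carrier (Gn n)" and u: "u \<in> U" for g u
  proof -
    obtain x where x: "x \<in> F\<^sub>1" "u = org Y x" using u by (auto simp: U_def)
    then have x': "x \<in> darts Y" "D.labelled x 1" "V.invar (org Y x)" by (auto simp: F\<^sub>1_def D.label_set_def)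
    obtain p k where pk: "g = (p, k)" by (cases g)
    have "snd (\<rho> g) x \<in> moved_darts"
      using D.labelled_act[of p k x 1] g x' rho_in(2)[OF g] unfolding pk by (auto simp: moved_darts_def)
    moreover have eq: "org Y (snd (\<rho> g) x) = fst (\<rho> g) u" using rho_org[OF g x'(1)] x(2) by simp
    moreover have "V.invar (fst (\<rho> g) u)" using V.invar_act[OF g _ x'(3)] opp(4)[OF x'(1)] x(2) by simp
    ultimately show ?thesis using invar_org_moved[of "snd (\<rho> g) x"] by (simp add: U_def)
  qed
  have UV: "u \<in> verts Y" "V.invar u" if "u \<in> U" for u
    using that opp(4) by (auto simp: U_def F\<^sub>1_def D.label_set_def)
  \<comment> \<open>The alternating group fixes \<open>U\<close> pointwise. Modulo it,
    \<open>Gn n\<close> is generated by one transposition and the central element, two commuting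
    involutions.\<close>
  let ?t = "transpose 1 (2::nat)"
  have t: "?t permutes D.\<Omega>" using n_gt by (intro permutes_swap_id) auto
  have tt: "?t \<circ> ?t = id" by simp
  have todd: "\<not> evenperm ?t" by (simp add: evenperm_swap)
  let ?s = "(?t, 0::int)" and ?\<delta> = "(id :: nat \<Rightarrow> nat, 1::int)"
  have sG: "?s \<in> carrier (Gn n)" and \<delta>G: "?\<delta> \<in> carrier (Gn n)" using t by (auto simp: Gn_carrier)
  have ss: "?s \<otimes>\<^bsub>Gn n\<^esub> ?s = (id, 0)" and \<delta>\<delta>: "?\<delta> \<otimes>\<^bsub>Gn n\<^esub> ?\<delta> = (id, 0)"
    and s\<delta>: "?s \<otimes>\<^bsub>Gn n\<^esub> ?\<delta> = ?\<delta> \<otimes>\<^bsub>Gn n\<^esub> ?s" by (simp_all add: Gn_mult tt)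
  obtain u where u: "u \<in> U" "fst (\<rho> ?s) u = u" "fst (\<rho> ?\<delta>) u = u"
  proof (rule commuting_involutions_fixpoint[of U "fst (\<rho> ?s)" "fst (\<rho> ?\<delta>)"])
    show "card U = 3" using F3 by (simp add: U_def)
    fix x assume x: "x \<in> U"
    note xV = UV(1)[OF x]
    show "fst (\<rho> ?s) x \<in> U" "fst (\<rho> ?\<delta>) x \<in> U" using gU[OF sG x] gU[OF \<delta>G x] .
    show "fst (\<rho> ?s) (fst (\<rho> ?s) x) = x" using rho_mult(1)[OF sG sG xV] rho_one(1)[OF xV] unfolding ss by simp
    show "fst (\<rho> ?\<delta>) (fst (\<rho> ?\<delta>) x) = x" using rho_mult(1)[OF \<delta>G \<delta>G xV] rho_one(1)[OF xV] unfolding \<delta>\<delta> by simp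
    show "fst (\<rho> ?s) (fst (\<rho> ?\<delta>) x) = fst (\<rho> ?\<delta>) (fst (\<rho> ?s) x)"
      using rho_mult(1)[OF sG \<delta>G xV] rho_mult(1)[OF \<delta>G sG xV] unfolding s\<delta> by simp
  qed (use that in blast)
  note uV = UV(1)[OF u(1)] and ui = UV(2)[OF u(1)]
  have fixA: "fst (\<rho> (p, 0)) u = u" if "p \<in> V.A" for p using ui that by (simp add: V.invar_def)
  have fix0: "fst (\<rho> (p, 0)) u = u" if p: "p permutes D.\<Omega>" for p
  proof (cases "evenperm p")
    case True
    then show ?thesis using fixA p by (simp add: even_perms_def)
  next
    case False
    have "permutation p" using permutes_imp_permutation[OF _ p] by simp
    moreover have "permutation ?t" by (rule permutation_swap_id)
    ultimately have "p \<circ> ?t \<in> V.A" using False todd permutes_compose[OF t p] by (simp add: even_perms_def evenperm_comp)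
    moreover have "(p \<circ> ?t, 0) \<otimes>\<^bsub>Gn n\<^esub> ?s = (p, 0)" by (simp add: Gn_mult comp_assoc tt)
    ultimately show ?thesis using rho_mult(1)[OF D.A_G sG uV] fixA u(2) by metis
  qed
  have fixG: "fst (\<rho> g) u = u" if g: "g \<in> carrier (Gn n)" for g
  proof -
    obtain p k where pk: "g = (p, k)" by (cases g)
    have p: "p permutes D.\<Omega>" "k = 0 \<or> k = 1" using g unfolding pk by (simp_all add: Gn_carrier)
    show ?thesis
    proof (cases "k = 0")
      case True
      then show ?thesis using fix0[OF p(1)] pk by simp
    next
      case False
      then have "g = (p, 0) \<otimes>\<^bsub>Gn n\<^esub> ?\<delta>" using p(2) pk by (simp add: Gn_mult)
      moreover have "(p, 0) \<in> carrier (Gn n)" using p(1) by (simp add: Gn_carrier)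
      ultimately show ?thesis using rho_mult(1)[OF _ \<delta>G uV] fix0[OF p(1)] u(3) by metis
    qed
  qed
  define Z where "Z = {d \<in> moved_darts. org Y d = u \<or> org Y (opp Y d) = u}"
  \<comment> \<open>Keeping all vertices makes the invariance of the vertex set immediate; isolated
    vertices create no cycle.\<close>
  define F where "F = Y\<lparr>darts := Z\<rparr>"
  have ZY: "Z \<subseteq> darts Y" by (auto simp: Z_def moved_darts_def)
  have Zopp: "opp Y d \<in> Z" if "d \<in> Z" for d
    using that moved_darts_opp opp(2) ZY by (auto simp: Z_def)
  have far: "\<exists>i x. D.labelled d i \<and> i \<in> D.\<Omega> \<and> x \<in> F\<^sub>1 \<and> org Y x = u \<and> d = D.tr i x \<and>
      V.labelled (org Y (opp Y d)) i" if d: "d \<in> Z" "org Y d = u" for d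
  proof -
    have dm: "d \<in> moved_darts" using d by (simp add: Z_def)
    obtain i x where ix: "i \<in> D.\<Omega>" "x \<in> D\<^sub>1" "d = D.tr i x" "D.labelled d i"
      by (rule moved_dart_cases[OF dm])
    have "V.invar (org Y (D.tr i x))" using ui d(2) ix(3) by simp
    then have x: "x \<in> F\<^sub>1" "org Y x = u" using invar_org_tr[OF ix(2,1)] ix(3) d(2) by auto
    have "org Y (opp Y x) \<in> V\<^sub>1" using FS[OF x(1)] v by (simp add: S_def)
    then have "V.labelled (V.tr i (org Y (opp Y x))) i" using V.labelled_tr(2) ix(1) by blast
    moreover have "org Y (opp Y d) = V.tr i (org Y (opp Y x))"
      using tr_dart[OF ix(2,1)] tr_dart(1)[OF D1(3)[OF ix(2)] ix(1)] ix(3) by simp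
    ultimately show ?thesis using ix x by metis
  qed
  have far_u: "org Y (opp Y d) \<noteq> u" if "d \<in> Z" "org Y d = u" for d
    using far[OF that] V.labelled_not_invar ui by metis
  \<comment> \<open>The label of the far end determines the label of the spoke, and its origin
    \<open>u\<close> determines the underlying dart in \<open>F\<^sub>1\<close>. So no two spokes
    form a closed path.\<close>
  have far_inj: "d = d'"
    if hyp: "d \<in> Z" "org Y d = u" "d' \<in> Z" "org Y d' = u" "org Y (opp Y d) = org Y (opp Y d')" for d d'
  proof -
    obtain i x where 1: "x \<in> F\<^sub>1" "org Y x = u" "d = D.tr i x" "V.labelled (org Y (opp Y d)) i"
      using far[OF hyp(1,2)] by blast
    obtain j y where 2: "y \<in> F\<^sub>1" "org Y y = u" "d' = D.tr j y" "V.labelled (org Y (opp Y d')) j"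
      using far[OF hyp(3,4)] by blast
    have "i = j" using 1(4) 2(4) hyp(5) V.labelled_unique by metis
    moreover have "x = y" using org_inj 1 2 by (auto dest: inj_onD)
    ultimately show ?thesis using 1 2 by simp
  qed
  have gF: "graph F" using fin(2) Zopp ZY by (auto simp: F_def graph_def)
  have "\<not> is_cycle F ds" for ds
  proof
    assume "is_cycle F ds"
    then have ds: "ds \<noteq> []" "set ds \<subseteq> Z" "\<And>d. d \<in> set ds \<Longrightarrow> opp Y d \<notin> set ds"
      and step: "\<And>i. i < length ds \<Longrightarrow> org Y (opp Y (ds ! i)) = org Y (ds ! (Suc i mod length ds))"
      by (auto simp: is_cycle_def F_def)
    have nxt: "\<exists>e\<in>set ds. org Y (opp Y d) = org Y e" if "d \<in> set ds" for d
    proof -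
      obtain i where i: "i < length ds" "d = ds ! i" using \<open>d \<in> set ds\<close> by (metis in_set_conv_nth)
      have "ds ! (Suc i mod length ds) \<in> set ds" using i(1) by (intro nth_mem mod_less_divisor) auto
      then show ?thesis using step[OF i(1)] i(2) by blast
    qed
    \<comment> \<open>A cycle leaving \<open>u\<close> along \<open>d\<close> would have to return
      by its next dart, since all edges of the star meet \<open>u\<close>. By \<open>far_inj\<close>
      that dart is the reverse of \<open>d\<close>, which a cycle cannot contain.\<close>
    have no_u: "org Y d \<noteq> u" if d: "d \<in> set ds" for d
    proof
      assume du: "org Y d = u"
      have dZ: "d \<in> Z" using d ds(2) by blast
      obtain e where e: "e \<in> set ds" "org Y (opp Y d) = org Y e" using nxt[OF d] by blast
      have eZ: "e \<in> Z" using e ds(2) by blast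
      then have eY: "e \<in> darts Y" using ZY by blast
      have "org Y (opp Y e) = u" using eZ e(2) far_u[OF dZ du] by (auto simp: Z_def)
      then have "d = opp Y e"
        using far_inj[OF dZ du Zopp[OF eZ]] e(2) opp(2)[OF eY] by simp
      then show False using ds(3)[OF e(1)] d by blast
    qed
    obtain d where d: "d \<in> set ds" using ds(1) by (cases ds) auto
    then have "org Y (opp Y d) = u" using no_u[OF d] ds(2) by (auto simp: Z_def)
    then show False using nxt[OF d] no_u by metis
  qed
  moreover have "darts F \<noteq> {}"
  proof -
    obtain x where x: "x \<in> F\<^sub>1" "org Y x = u" using u(1) by (auto simp: U_def)
    then have "x \<in> Z" using D1 by (auto simp: Z_def moved_darts_def F\<^sub>1_def)
    then show ?thesis by (auto simp: F_def)
  qed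
  ultimately have "nontrivial_forest F Y"
    using gF ZY by (auto simp: nontrivial_forest_def subgraph_def F_def)
  moreover have "invariant_under (\<rho> ` carrier (Gn n)) F"
    unfolding invariant_under_def
  proof
    fix \<alpha> assume "\<alpha> \<in> \<rho> ` carrier (Gn n)"
    then obtain g where g: "g \<in> carrier (Gn n)" "\<alpha> = \<rho> g" by blast
    obtain p k where pk: "g = (p, k)" by (cases g)
    have "snd (\<rho> g) ` Z \<subseteq> Z"
    proof
      fix e assume "e \<in> snd (\<rho> g) ` Z"
      then obtain x where x: "x \<in> Z" "e = snd (\<rho> g) x" by blast
      then have xY: "x \<in> darts Y" using ZY by blast
      obtain i where "D.labelled x i" using x(1) by (auto simp: Z_def moved_darts_def)
      then have "D.labelled e (p i)" using D.labelled_act[of p k x i] g(1) xY x(2) pk by simp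
      then have "e \<in> moved_darts" using rho_in(2)[OF g(1) xY] x(2) by (auto simp: moved_darts_def)
      moreover have "org Y e = fst (\<rho> g) (org Y x)" "org Y (opp Y e) = fst (\<rho> g) (org Y (opp Y x))"
        using rho_org[OF g(1)] rho_opp[OF g(1) xY] opp(1)[OF xY] xY x(2) by metis+
      ultimately show "e \<in> Z" using x(1) fixG[OF g(1)] by (auto simp: Z_def)
    qed
    moreover have "inj_on (snd (\<rho> g)) Z" using rho_bij(2)[OF g(1)] ZY by (auto simp: bij_betw_def intro: inj_on_subset)
    moreover have "finite Z" using ZY fin(4) finite_subset by blast
    ultimately have "snd (\<rho> g) ` Z = Z" by (intro card_subset_eq) (auto simp: card_image)
    moreover have "fst (\<rho> g) ` verts Y = verts Y" using rho_bij(1)[OF g(1)] by (simp add: bij_betw_def)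
    ultimately show "fst \<alpha> ` verts F = verts F \<and> snd \<alpha> ` darts F = darts F" using g(2) by (simp add: F_def)
  qed
  ultimately show False using minimal by (auto simp: minimal_action_def)
qed

section \<open>The moved subgraph and its markings\<close>

lemma F1_eq: "F\<^sub>1 = D\<^sub>1"
  using org_D1 no_moved_vertices by (auto simp: F\<^sub>1_def)

lemma invar_org_D1: "x \<in> D\<^sub>1 \<Longrightarrow> V.invar (org Y x)"
  using F1_eq by (auto simp: F\<^sub>1_def)

lemma org_tr: "x \<in> D\<^sub>1 \<Longrightarrow> i \<in> D.\<Omega> \<Longrightarrow> org Y (D.tr i x) = org Y x"
  using tr_dart(1) V_tr_invar[OF invar_org_D1] by metis

lemma org_moved: "org Y ` moved_darts = org Y ` D\<^sub>1"
proof
  show "org Y ` moved_darts \<subseteq> org Y ` D\<^sub>1"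
  proof
    fix v assume "v \<in> org Y ` moved_darts"
    then obtain d where d: "d \<in> moved_darts" "v = org Y d" by blast
    obtain i x where "i \<in> D.\<Omega>" "x \<in> D\<^sub>1" "d = D.tr i x" by (rule moved_dart_cases[OF d(1)])
    then show "v \<in> org Y ` D\<^sub>1" using org_tr d(2) by simp
  qed
  show "org Y ` D\<^sub>1 \<subseteq> org Y ` moved_darts" using D1 by (auto simp: moved_darts_def)
qed

lemma moved_subgraph_eq:
  "moved_subgraph Y \<rho> (Bn n) = Y\<lparr>verts := org Y ` moved_darts, darts := moved_darts\<rparr>"
proof -
  have "{d \<in> darts Y. (\<lambda>b. snd (\<rho> b) ` edge Y d) ` Bn n \<noteq> {edge Y d}} = moved_darts"
  proof -
    have "(\<lambda>b. snd (\<rho> b) ` edge Y d) ` Bn n = {edge Y d} \<longleftrightarrow> \<not> (\<exists>i. D.labelled d i)" if d: "d \<in> darts Y" for d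
    proof -
      have "(\<lambda>b. snd (\<rho> b) ` edge Y d) ` Bn n = {edge Y d} \<longleftrightarrow> E.invar (edge Y d)"
        unfolding Bn_def perm_elt_def even_perms_alt_group[symmetric] E.invar_def image_image
        by (rule image_eq_singleton_iff[OF even_perms_id])
      also have "\<dots> \<longleftrightarrow> D.invar d" using edge_invar_iff[OF d] .
      also have "\<dots> \<longleftrightarrow> \<not> (\<exists>i. D.labelled d i)"
        by (rule dart_cases[OF d]) (use D.labelled_not_invar in auto)
      finally show ?thesis .
    qed
    then show ?thesis unfolding moved_darts_def by (intro Collect_cong conj_cong refl) simp
  qed
  then show ?thesis by (simp add: moved_subgraph_def Let_def)
qed

abbreviation Y\<^sub>B :: "('v, 'e) pregraph" where "Y\<^sub>B \<equiv> moved_subgraph Y \<rho> (Bn n)"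

lemma YB_simps [simp]:
  "verts Y\<^sub>B = org Y ` D\<^sub>1" "darts Y\<^sub>B = moved_darts" "org Y\<^sub>B = org Y" "opp Y\<^sub>B = opp Y"
  by (simp_all add: moved_subgraph_eq org_moved)

text \<open>A marking is determined by an enumeration \<open>e\<close> of the darts labelled 1 and the matching
  bijection \<open>\<nu>\<close> of the vertices, all of which are fixed by the alternating group.\<close>

lemma markingI:
  fixes M :: std_graph
  assumes M: "darts M = C \<times> D.\<Omega> \<times> UNIV" "opp M = (\<lambda>(c, i, s). (c, i, \<not> s))"
    and e: "bij_betw (\<lambda>(c, s). e c s) (C \<times> UNIV) D\<^sub>1" "\<And>c s. c \<in> C \<Longrightarrow> e c (\<not> s) = opp Y (e c s)"
    and \<nu>: "bij_betw \<nu> (verts M) (org Y ` D\<^sub>1)" "\<And>c i s. c \<in> C \<Longrightarrow> \<nu> (org M (c, i, s)) = org Y (e c s)"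
  shows "marking n \<rho> M Y\<^sub>B (\<nu>, \<lambda>(c, i, s). D.tr i (e c s))"
proof -
  have eD: "e c s \<in> D\<^sub>1" if "c \<in> C" for c s
    using bij_betwE[OF e(1)] that by fastforce
  have "bij_betw (\<lambda>(c, i, s). D.tr i (e c s)) (C \<times> D.\<Omega> \<times> UNIV) moved_darts"
  proof (rule bij_betwI')
    fix x y :: "nat \<times> nat \<times> bool"
    assume xy: "x \<in> C \<times> D.\<Omega> \<times> UNIV" "y \<in> C \<times> D.\<Omega> \<times> UNIV"
    obtain c i s where x: "x = (c, i, s)" "c \<in> C" "i \<in> D.\<Omega>" using xy(1) by (cases x) auto
    obtain c' i' s' where y: "y = (c', i', s')" "c' \<in> C" "i' \<in> D.\<Omega>" using xy(2) by (cases y) auto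
    have "D.tr i (e c s) = D.tr i' (e c' s') \<longleftrightarrow> x = y"
    proof
      assume eq: "D.tr i (e c s) = D.tr i' (e c' s')"
      have "i = i'"
        using D.labelled_tr(2)[OF eD[OF x(2)] x(3)] D.labelled_tr(2)[OF eD[OF y(2)] y(3)] eq D.labelled_unique
        by metis
      moreover from this have "e c s = e c' s'" using D.tr_inj eD x y eq by metis
      then have "(c, s) = (c', s')"
        using inj_onD[OF bij_betw_imp_inj_on[OF e(1)], of "(c, s)" "(c', s')"] x(2) y(2) by auto
      ultimately show "x = y" using x(1) y(1) by simp
    qed (use x(1) y(1) in simp)
    then show "((case x of (c, i, s) \<Rightarrow> D.tr i (e c s)) = (case y of (c, i, s) \<Rightarrow> D.tr i (e c s))) = (x = y)"
      using x(1) y(1) by simp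
  next
    fix x assume "x \<in> C \<times> D.\<Omega> \<times> (UNIV :: bool set)"
    then show "(case x of (c, i, s) \<Rightarrow> D.tr i (e c s)) \<in> moved_darts" using tr_moved eD by auto
  next
    fix d assume "d \<in> moved_darts"
    then obtain i x where ix: "i \<in> D.\<Omega>" "x \<in> D\<^sub>1" "d = D.tr i x" by (rule moved_dart_cases)
    have "x \<in> (\<lambda>(c, s). e c s) ` (C \<times> UNIV)" using e(1) ix(2) by (simp only: bij_betw_def)
    then obtain c s where "c \<in> C" "x = e c s" by auto
    then show "\<exists>x\<in>C \<times> D.\<Omega> \<times> UNIV. d = (case x of (c, i, s) \<Rightarrow> D.tr i (e c s))"
      using ix by (intro bexI[of _ "(c, i, s)"]) auto
  qed
  moreover have "\<nu> (org M (c, i, s)) = org Y (D.tr i (e c s))" if "c \<in> C" "i \<in> D.\<Omega>" for c i s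
    using \<nu>(2)[OF that(1)] org_tr[OF eD[OF that(1)] that(2)] by simp
  moreover have "D.tr i (e c (\<not> s)) = opp Y (D.tr i (e c s))" if "c \<in> C" "i \<in> D.\<Omega>" for c i s
    using e(2)[OF that(1)] tr_dart(2)[OF eD[OF that(1)] that(2)] by simp
  ultimately have iso: "graph_iso M Y\<^sub>B (\<nu>, \<lambda>(c, i, s). D.tr i (e c s))"
    using \<nu>(1) unfolding graph_iso_def M YB_simps by auto
  have "agree_on M (\<rho> (perm_elt b) \<circ>\<^sub>g (\<nu>, \<lambda>(c, i, s). D.tr i (e c s)))
      ((\<nu>, \<lambda>(c, i, s). D.tr i (e c s)) \<circ>\<^sub>g std_perm b)" if b: "b \<in> D.A" for b
    unfolding agree_on_def
  proof (intro conjI ballI)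
    fix v assume "v \<in> verts M"
    then have "\<nu> v \<in> org Y ` D\<^sub>1" using bij_betwE[OF \<nu>(1)] by blast
    then have "fst (\<rho> (b, 0)) (\<nu> v) = \<nu> v" using invar_org_D1 b by (auto simp: V.invar_def)
    then show "fst (\<rho> (perm_elt b) \<circ>\<^sub>g (\<nu>, \<lambda>(c, i, s). D.tr i (e c s))) v =
        fst ((\<nu>, \<lambda>(c, i, s). D.tr i (e c s)) \<circ>\<^sub>g std_perm b) v"
      by (simp add: gcomp_def std_perm_def perm_elt_def)
  next
    fix d assume "d \<in> darts M"
    then obtain c i s where d: "d = (c, i, s)" "c \<in> C" "i \<in> D.\<Omega>" unfolding M by auto
    show "snd (\<rho> (perm_elt b) \<circ>\<^sub>g (\<nu>, \<lambda>(c, i, s). D.tr i (e c s))) d =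
        snd ((\<nu>, \<lambda>(c, i, s). D.tr i (e c s)) \<circ>\<^sub>g std_perm b) d"
      using D.act_tr[OF eD[OF d(2)] d(3) b] by (simp add: gcomp_def std_perm_def perm_elt_def d(1))
  qed
  then show ?thesis using iso by (simp add: marking_def even_perms_alt_group[symmetric])
qed

lemma D1_subset_eq:
  assumes "S \<subseteq> D\<^sub>1" "card S = card D\<^sub>1"
  shows "D\<^sub>1 = S"
  using card_subset_eq[OF fin_D1(1) assms] by simp

lemma one_orbit_marking:
  assumes "card D\<^sub>1 = 2"
  shows "(\<exists>\<iota>. marking n \<rho> (rose (n + 1)) Y\<^sub>B \<iota>) \<or> (\<exists>\<iota>. marking n \<rho> (cage (n + 1)) Y\<^sub>B \<iota>)"
proof -
  obtain d where d: "d \<in> D\<^sub>1" using D1_nonempty by blast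
  have dY: "d \<in> darts Y" using D1(1)[OF d] .
  note op = opp(2)[OF dY] opp(3)[OF dY]
  have D: "D\<^sub>1 = {d, opp Y d}" using d D1(3)[OF d] op(2) assms by (intro D1_subset_eq) auto
  have oD: "org Y ` D\<^sub>1 = {org Y d, org Y (opp Y d)}" unfolding D by simp
  let ?e = "\<lambda>(c::nat) s. if s then d else opp Y d"
  have e: "bij_betw (\<lambda>(c, s). ?e c s) ({1} \<times> UNIV) D\<^sub>1"
    unfolding D bij_betw_def inj_on_def using op(2) by (auto simp: image_iff UNIV_bool)
  show ?thesis
  proof (cases "org Y d = org Y (opp Y d)")
    case True
    have "marking n \<rho> (rose (n + 1)) Y\<^sub>B (\<lambda>_. org Y d, \<lambda>(c, i, s). D.tr i (?e c s))"
    proof (rule markingI[OF _ _ e])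
      show "bij_betw (\<lambda>_. org Y d) (verts (rose (n + 1))) (org Y ` D\<^sub>1)"
        unfolding oD using True by (simp add: rose_def bij_betw_def)
    qed (use True op in \<open>auto simp: rose_def\<close>)
    then show ?thesis by blast
  next
    case False
    \<comment> \<open>In the standard cage the darts with orientation \<open>True\<close> start at
      vertex 1, so vertex 1 has to go to the origin of \<open>d\<close>.\<close>
    have "marking n \<rho> (cage (n + 1)) Y\<^sub>B
        (\<lambda>v. if v = 1 then org Y d else org Y (opp Y d), \<lambda>(c, i, s). D.tr i (?e c s))"
    proof (rule markingI[OF _ _ e])
      show "bij_betw (\<lambda>v. if v = 1 then org Y d else org Y (opp Y d)) (verts (cage (n + 1))) (org Y ` D\<^sub>1)"
        unfolding oD using False by (auto simp: cage_def bij_betw_def inj_on_def)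
    qed (use op in \<open>auto simp: cage_def\<close>)
    then show ?thesis by blast
  qed
qed

text \<open>The two orbits contain 2n + 2 edges, and by \<open>sum_two_vertices\<close> two
  conditions make a chain on them a cycle; this already accounts for genus 2n. Another edge, not
  being separating, would lie in the support of a further independent cycle.\<close>

lemma two_orbits_all_moved:
  assumes D: "D\<^sub>1 = {d\<^sub>1, opp Y d\<^sub>1, d\<^sub>2, opp Y d\<^sub>2}" and c4: "card D\<^sub>1 = 4"
  shows "darts Y = moved_darts"
proof (rule ccontr)
  assume ne: "darts Y \<noteq> moved_darts"
  have mY: "moved_darts \<subseteq> darts Y" by (auto simp: moved_darts_def)
  then obtain e where e: "e \<in> darts Y - moved_darts" using ne by blast
  then obtain z where z: "z \<in> H1 Y" "z e \<noteq> 0"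
    using minimal_action_no_separating_edge[OF fin(1) minimal] by blast
  have dY: "d\<^sub>1 \<in> darts Y" "d\<^sub>2 \<in> darts Y" using D D1(1) by auto
  have dD: "d\<^sub>1 \<in> D\<^sub>1" "d\<^sub>2 \<in> D\<^sub>1" using D by auto
  have "set [d\<^sub>1, opp Y d\<^sub>1, d\<^sub>2, opp Y d\<^sub>2] = D\<^sub>1" by (simp only: list.set D)
  then have "distinct [d\<^sub>1, opp Y d\<^sub>1, d\<^sub>2, opp Y d\<^sub>2]" using c4 by (intro card_distinct) (simp only:, simp)
  then have disj: "{d\<^sub>1, opp Y d\<^sub>1} \<inter> {d\<^sub>2, opp Y d\<^sub>2} = {}" by auto
  define B where "B x = (\<lambda>(i, y). D.tr i y) ` (D.\<Omega> \<times> {x, opp Y x})" for x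
  have BE: "\<exists>i y. i \<in> D.\<Omega> \<and> y \<in> {x, opp Y x} \<and> d = D.tr i y" if "d \<in> B x" for d x
    using that by (auto simp: B_def)
  have BI: "D.tr i y \<in> B x" if "i \<in> D.\<Omega>" "y \<in> {x, opp Y x}" for i y x
    unfolding B_def by (rule image_eqI[of _ _ "(i, y)"]) (use that in auto)
  have B_D1: "y \<in> D\<^sub>1" if "x \<in> D\<^sub>1" "y \<in> {x, opp Y x}" for x y using that D1(3) by blast
  have B_sub: "B x \<subseteq> moved_darts" if "x \<in> D\<^sub>1" for x
    using BE B_D1[OF that] tr_moved by blast
  have B_opp: "opp Y d \<in> B x" if x: "x \<in> D\<^sub>1" and d: "d \<in> B x" for d x
  proof -
    obtain i y where iy: "i \<in> D.\<Omega>" "y \<in> {x, opp Y x}" "d = D.tr i y" using BE[OF d] by blast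
    have "opp Y y \<in> {x, opp Y x}" using iy(2) opp(2)[OF D1(1)[OF x]] by auto
    then show ?thesis using tr_dart(2)[OF B_D1[OF x iy(2)] iy(1)] BI[OF iy(1)] iy(3) by simp
  qed
  have B_org: "org Y ` B x \<subseteq> {org Y x, org Y (opp Y x)}" if x: "x \<in> D\<^sub>1" for x
  proof
    fix v assume "v \<in> org Y ` B x"
    then obtain d where d: "d \<in> B x" "v = org Y d" by blast
    obtain i y where iy: "i \<in> D.\<Omega>" "y \<in> {x, opp Y x}" "d = D.tr i y" using BE[OF d(1)] by blast
    then show "v \<in> {org Y x, org Y (opp Y x)}" using org_tr[OF B_D1[OF x iy(2)] iy(1)] d(2) by auto
  qed
  have B_Un: "moved_darts = B d\<^sub>1 \<union> B d\<^sub>2"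
  proof
    show "moved_darts \<subseteq> B d\<^sub>1 \<union> B d\<^sub>2"
    proof
      fix d assume d: "d \<in> moved_darts"
      obtain i x where ix: "i \<in> D.\<Omega>" "x \<in> D\<^sub>1" "d = D.tr i x" by (rule moved_dart_cases[OF d])
      then have "x \<in> {d\<^sub>1, opp Y d\<^sub>1} \<or> x \<in> {d\<^sub>2, opp Y d\<^sub>2}" using D by blast
      then show "d \<in> B d\<^sub>1 \<union> B d\<^sub>2" using BI[OF ix(1)] ix(3) by blast
    qed
  qed (use B_sub dD in auto)
  have B_disj: "B d\<^sub>1 \<inter> B d\<^sub>2 = {}"
  proof (rule ccontr)
    assume "B d\<^sub>1 \<inter> B d\<^sub>2 \<noteq> {}"
    then obtain d where d: "d \<in> B d\<^sub>1" "d \<in> B d\<^sub>2" by blast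
    obtain i x where ix: "i \<in> D.\<Omega>" "x \<in> {d\<^sub>1, opp Y d\<^sub>1}" "d = D.tr i x" using BE[OF d(1)] by blast
    obtain j y where jy: "j \<in> D.\<Omega>" "y \<in> {d\<^sub>2, opp Y d\<^sub>2}" "d = D.tr j y" using BE[OF d(2)] by blast
    note x = B_D1[OF dD(1) ix(2)] and y = B_D1[OF dD(2) jy(2)]
    have "i = j" using D.labelled_tr(2)[OF x ix(1)] D.labelled_tr(2)[OF y jy(1)] ix(3) jy(3) D.labelled_unique by metis
    then have "x = y" using D.tr_inj[OF x y ix(1)] ix(3) jy(3) by simp
    then show False using ix(2) jy(2) disj by blast
  qed
  have finB: "finite (B x)" for x by (simp add: B_def)
  let ?\<K> = "{{d \<in> B d\<^sub>1. org Y d = org Y d\<^sub>1}, {d \<in> B d\<^sub>2. org Y d = org Y d\<^sub>2}}"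
  have "card (edge Y ` moved_darts) < genus Y + card ?\<K>"
  proof (rule card_edges_le_genus(2)[OF fin(1) mY moved_darts_opp _ _ z(1) e z(2)])
    fix c :: "'e \<Rightarrow> rat" and v
    assume supp: "\<And>d. d \<notin> moved_darts \<Longrightarrow> c d = 0"
      and anti: "\<And>d. d \<in> moved_darts \<Longrightarrow> c (opp Y d) = - c d"
      and K: "\<And>K. K \<in> ?\<K> \<Longrightarrow> (\<Sum>d\<in>K. c d) = 0"
    have B0: "(\<Sum>d | d \<in> B x \<and> org Y d = v. c d) = 0"
      if x: "x \<in> D\<^sub>1" and Kx: "(\<Sum>d | d \<in> B x \<and> org Y d = org Y x. c d) = 0" for x
    proof (rule sum_two_vertices[OF finB _ _ _ B_org[OF x] Kx])
      show "opp Y d \<in> B x" if "d \<in> B x" for d using B_opp[OF x that] .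
      show "opp Y (opp Y d) = d" if "d \<in> B x" for d using that B_sub[OF x] mY opp(2) by blast
      show "c (opp Y d) = - c d" if "d \<in> B x" for d using that B_sub[OF x] anti by blast
    qed
    have "(\<Sum>d | d \<in> darts Y \<and> org Y d = v. c d)
        = (\<Sum>d\<in>{d \<in> B d\<^sub>1. org Y d = v} \<union> {d \<in> B d\<^sub>2. org Y d = v}. c d)"
      using fin(4) mY supp B_Un by (intro sum.mono_neutral_right) auto
    also have "\<dots> = (\<Sum>d | d \<in> B d\<^sub>1 \<and> org Y d = v. c d) + (\<Sum>d | d \<in> B d\<^sub>2 \<and> org Y d = v. c d)"
      using finB B_disj by (intro sum.union_disjoint) auto
    also have "\<dots> = 0" using B0[OF dD(1)] B0[OF dD(2)] K by simp
    finally show "(\<Sum>d | d \<in> darts Y \<and> org Y d = v. c d) = 0" .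
  qed (assumption | intro finite.insertI finite.emptyI)+
  moreover have "card ?\<K> \<le> 2" by (simp add: card_insert_if)
  ultimately show False using genus_le card_moved(1,2) c4 by simp
qed

lemma two_orbits_marking:
  assumes c4: "card D\<^sub>1 = 4" and c3: "3 \<le> card (org Y ` D\<^sub>1)"
  shows "Y\<^sub>B = Y \<and> (\<exists>\<iota>. marking n \<rho> (double_cage (n + 1)) Y\<^sub>B \<iota>)"
proof -
  obtain d where d: "d \<in> D\<^sub>1" using D1_nonempty by blast
  have dY: "d \<in> darts Y" using D1(1)[OF d] .
  have "\<not> D\<^sub>1 \<subseteq> {d, opp Y d}"
    using c4 card_mono[of "{d, opp Y d}" "D\<^sub>1"] opp(3)[OF dY] by auto
  then obtain d' where d': "d' \<in> D\<^sub>1" "d' \<noteq> d" "d' \<noteq> opp Y d" by blast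
  have d'Y: "d' \<in> darts Y" using D1(1)[OF d'(1)] .
  have ne: "opp Y d' \<noteq> d" "opp Y d' \<noteq> opp Y d" using d' opp(2)[OF dY] opp(2)[OF d'Y] by metis+
  have D: "D\<^sub>1 = {d, opp Y d, d', opp Y d'}"
  proof (rule D1_subset_eq)
    show "card {d, opp Y d, d', opp Y d'} = card D\<^sub>1"
      using c4 d' ne opp(3)[OF dY] opp(3)[OF d'Y] by auto
  qed (use d d' D1(3) in auto)
  have all: "darts Y = moved_darts" by (rule two_orbits_all_moved[OF D c4])
  have vY: "verts Y = org Y ` moved_darts"
    using obtain_dart opp(4) unfolding all[symmetric] by blast
  have YB: "Y\<^sub>B = Y" unfolding moved_subgraph_eq vY[symmetric] unfolding all[symmetric] by simp
  \<comment> \<open>Otherwise the ends of the first orbit form a set closed under adjacency, as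
    there are no unmoved edges, and the graph is disconnected.\<close>
  have "\<exists>a\<in>{d, opp Y d}. \<exists>b\<in>{d', opp Y d'}. org Y a = org Y b"
  proof (rule ccontr)
    assume no: "\<not> ?thesis"
    have "org Y d' \<in> org Y ` {d, opp Y d}"
    proof (rule reachable_closed[of "org Y d"])
      fix x assume x: "x \<in> darts Y" "org Y x \<in> org Y ` {d, opp Y d}"
      obtain i y where iy: "i \<in> D.\<Omega>" "y \<in> D\<^sub>1" "x = D.tr i y"
        by (rule moved_dart_cases[of x]) (use x(1) all in auto)
      have "org Y x = org Y y" "org Y (opp Y x) = org Y (opp Y y)"
        using org_tr iy D1(3) tr_dart(2) by metis+
      moreover from this have "y \<in> {d, opp Y d}" using x(2) iy(2) no D by auto
      ultimately show "org Y (opp Y x) \<in> org Y ` {d, opp Y d}" using opp(2)[OF dY] by auto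
    qed (use opp(4) dY d'Y in auto)
    then show False using no by auto
  qed
  then obtain a b where ab: "a \<in> {d, opp Y d}" "b \<in> {d', opp Y d'}" "org Y a = org Y b" by blast
  \<comment> \<open>The reversal makes the shared vertex the end of \<open>x1\<close> and
    \<open>x2\<close>, matching the standard double cage, where darts with orientation
    \<open>True\<close> point towards vertex 0.\<close>
  define x1 x2 where "x1 = opp Y a" and "x2 = opp Y b"
  have abY: "a \<in> darts Y" "b \<in> darts Y" using ab dY d'Y opp(1) by auto
  have ox: "opp Y x1 = a" "opp Y x2 = b" using opp(2) abY by (auto simp: x1_def x2_def)
  have D': "D\<^sub>1 = {x1, opp Y x1, x2, opp Y x2}"
    unfolding ox using ab(1,2) D opp(2)[OF dY] opp(2)[OF d'Y] by (auto simp: x1_def x2_def)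
  have "set [x1, opp Y x1, x2, opp Y x2] = D\<^sub>1" by (simp only: list.set D')
  then have dist: "distinct [x1, opp Y x1, x2, opp Y x2]" using c4 by (intro card_distinct) (simp only:, simp)
  let ?u = "org Y (opp Y x1)"
  have u2: "org Y (opp Y x2) = ?u" using ab(3) ox by simp
  have oD: "org Y ` D\<^sub>1 = {?u, org Y x1, org Y x2}" unfolding D' using u2 by auto
  have vd: "distinct [?u, org Y x1, org Y x2]"
  proof (rule card_distinct)
    have "set [?u, org Y x1, org Y x2] = org Y ` D\<^sub>1" by (simp only: list.set oD)
    then show "card (set [?u, org Y x1, org Y x2]) = length [?u, org Y x1, org Y x2]"
      using c3 card_length[of "[?u, org Y x1, org Y x2]"] by (simp only:) simp
  qed
  let ?e = "\<lambda>(c::nat) s. if c = 1 then (if s then x1 else opp Y x1) else (if s then x2 else opp Y x2)"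
  let ?\<nu> = "\<lambda>v::nat. if v = 0 then ?u else if v = 1 then org Y x1 else org Y x2"
  have e: "bij_betw (\<lambda>(c, s). ?e c s) ({1, 2} \<times> UNIV) D\<^sub>1"
    unfolding bij_betw_def
  proof
    show "inj_on (\<lambda>(c, s). ?e c s) ({1, 2} \<times> UNIV)"
      using dist by (auto simp: inj_on_def split: if_splits)
    show "(\<lambda>(c, s). ?e c s) ` ({1, 2} \<times> UNIV) = D\<^sub>1"
      unfolding D' UNIV_bool by auto
  qed
  have "marking n \<rho> (double_cage (n + 1)) Y\<^sub>B (?\<nu>, \<lambda>(c, i, s). D.tr i (?e c s))"
  proof (rule markingI[OF _ _ e])
    have oo: "opp Y (opp Y x1) = x1" "opp Y (opp Y x2) = x2" using ox by (auto simp: x1_def x2_def)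
    show "?e c (\<not> s) = opp Y (?e c s)" for c s using oo by auto
    show "bij_betw ?\<nu> (verts (double_cage (n + 1))) (org Y ` D\<^sub>1)"
      unfolding oD using vd by (auto simp: double_cage_def bij_betw_def inj_on_def)
    show "?\<nu> (org (double_cage (n + 1)) (c, i, s)) = org Y (?e c s)" if "c \<in> {1, 2}" for c i s
      using that u2 by (auto simp: double_cage_def)
  qed (auto simp: double_cage_def)
  then show ?thesis using YB by blast
qed

theorem moved_subgraph_classification:
  "(\<exists>\<iota>. marking n \<rho> (rose (n + 1)) Y\<^sub>B \<iota>) \<or> (\<exists>\<iota>. marking n \<rho> (cage (n + 1)) Y\<^sub>B \<iota>)
    \<or> (Y\<^sub>B = Y \<and> (\<exists>\<iota>. marking n \<rho> (double_cage (n + 1)) Y\<^sub>B \<iota>))"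
  using orbit_cases no_moved_vertices one_orbit_marking two_orbits_marking by fastforce

lemma moved_darts_act: "g \<in> carrier (Gn n) \<Longrightarrow> d \<in> moved_darts \<Longrightarrow> snd (\<rho> g) d \<in> moved_darts"
  using D.labelled_act[of "fst g" "snd g" d] rho_in(2)[of g d] by (fastforce simp: moved_darts_def)

theorem moved_subgraph_invariant: "invariant_under (\<rho> ` carrier (Gn n)) Y\<^sub>B"
  unfolding invariant_under_def
proof
  fix \<alpha> assume "\<alpha> \<in> \<rho> ` carrier (Gn n)"
  then obtain g where g: "g \<in> carrier (Gn n)" "\<alpha> = \<rho> g" by blast
  have mY: "moved_darts \<subseteq> darts Y" by (auto simp: moved_darts_def)
  have "inj_on (snd (\<rho> g)) moved_darts"
    using rho_bij(2)[OF g(1)] mY by (auto simp: bij_betw_def intro: inj_on_subset)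
  then have d: "snd (\<rho> g) ` moved_darts = moved_darts"
    using moved_darts_act[OF g(1)] fin_D1(4) by (intro card_subset_eq) (auto simp: card_image)
  have "fst (\<rho> g) ` org Y ` moved_darts = org Y ` snd (\<rho> g) ` moved_darts"
    unfolding image_image using rho_org[OF g(1)] mY by (intro image_cong) auto
  then show "fst \<alpha> ` verts Y\<^sub>B = verts Y\<^sub>B \<and> snd \<alpha> ` darts Y\<^sub>B = darts Y\<^sub>B"
    using d org_moved g(2) by simp
qed

section \<open>Extension from the alternating group\<close>

lemma marking_facts:
  assumes "marking n \<rho> M Y\<^sub>B \<iota>"
  shows "bij_betw (fst \<iota>) (verts M) (org Y ` D\<^sub>1)" "bij_betw (snd \<iota>) (darts M) moved_darts"
    and "\<And>d. d \<in> darts M \<Longrightarrow> fst \<iota> (org M d) = org Y (snd \<iota> d)"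
    and "\<And>d. d \<in> darts M \<Longrightarrow> snd \<iota> (opp M d) = opp Y (snd \<iota> d)"
    and "\<And>b d. b \<in> D.A \<Longrightarrow> d \<in> darts M \<Longrightarrow> snd (\<rho> (b, 0)) (snd \<iota> d) = snd \<iota> (snd (std_perm b) d)"
    and "\<And>b v. b \<in> D.A \<Longrightarrow> v \<in> verts M \<Longrightarrow> fst (\<rho> (b, 0)) (fst \<iota> v) = fst \<iota> (fst (std_perm b) v)"
  using assms unfolding marking_def graph_iso_def YB_simps agree_on_def gcomp_def perm_elt_def
    even_perms_alt_group[symmetric] by auto

text \<open>\<open>C\<close> is the set of copies. The bundle allows one extension argument for all
  three graphs; after the facts collected in the next lemma they are told apart only in
  \<open>twist\<close>.\<close>

definition standard_pair :: "std_graph \<Rightarrow> nat set \<Rightarrow> std_map \<Rightarrow> bool" where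
  "standard_pair M C \<tau> \<longleftrightarrow> (M, C, \<tau>) \<in> {(rose (n + 1), {1}, rose_flip), (cage (n + 1), {1}, cage_swap),
     (double_cage (n + 1), {1, 2}, double_cage_swap)}"

lemma standard_pair:
  assumes "standard_pair M C \<tau>"
  shows "darts M = C \<times> D.\<Omega> \<times> UNIV" "opp M (c, i, s) = (c, i, \<not> s)" "1 \<in> C"
    and "d \<in> darts M \<Longrightarrow> org M d \<in> verts M"
    and "v \<in> verts M \<Longrightarrow> \<exists>d\<in>darts M. org M d = v"
    and "d \<in> darts M \<Longrightarrow> snd \<tau> d \<in> darts M"
    and "d \<in> darts M \<Longrightarrow> org M (snd \<tau> d) = fst \<tau> (org M d)"
    and "p permutes D.\<Omega> \<Longrightarrow> d \<in> darts M \<Longrightarrow> snd (std_perm p) d \<in> darts M"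
    and "org M (snd (std_perm p) d) = org M d"
proof -
  have dM: "darts M = C \<times> D.\<Omega> \<times> UNIV"
    using assms by (auto simp: standard_pair_def rose_def cage_def double_cage_def)
  then show "darts M = C \<times> D.\<Omega> \<times> UNIV" .
  show "org M (snd (std_perm p) d) = org M d"
    using assms by (cases d) (auto simp: standard_pair_def rose_def cage_def double_cage_def std_perm_def)
  show "v \<in> verts M \<Longrightarrow> \<exists>d\<in>darts M. org M d = v"
    using assms unfolding standard_pair_def
    by (auto simp: rose_def cage_def double_cage_def intro: bexI[of _ "(1, 1, True)"] bexI[of _ "(1, 1, False)"]
        bexI[of _ "(2, 1, True)"])
  show "p permutes D.\<Omega> \<Longrightarrow> d \<in> darts M \<Longrightarrow> snd (std_perm p) d \<in> darts M"
  proof -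
    assume p: "p permutes D.\<Omega>" and "d \<in> darts M"
    then obtain c i s where d: "d = (c, i, s)" "c \<in> C" "i \<in> D.\<Omega>" unfolding dM by auto
    have "p i \<in> D.\<Omega>" using permutes_in_image[OF p] d(3) by blast
    then show ?thesis unfolding dM using d(1,2) by (simp add: std_perm_def)
  qed
qed (use assms in \<open>auto simp: standard_pair_def rose_def cage_def double_cage_def rose_flip_def
      cage_swap_def double_cage_swap_def std_perm_def split: if_splits\<close>)

section \<open>Elements of the full group in terms of a marking\<close>

context
  fixes M :: std_graph and C \<tau> \<iota>
  assumes sp: "standard_pair M C \<tau>" and mk: "marking n \<rho> M Y\<^sub>B \<iota>"
begin

text \<open>Injectivity of the marking turns being fixed by \<open>b\<close> into
  \<open>b i = i\<close>, so the middle coordinate of a standard dart is the label of its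
  image.\<close>

lemma marked_dart:
  assumes "c \<in> C" "i \<in> D.\<Omega>"
  shows "(c, i, s) \<in> darts M" "snd \<iota> (c, i, s) \<in> moved_darts" "snd \<iota> (c, i, s) \<in> darts Y"
    and "D.labelled (snd \<iota> (c, i, s)) i"
proof -
  show m: "(c, i, s) \<in> darts M" using assms standard_pair(1)[OF sp] by simp
  then show "snd \<iota> (c, i, s) \<in> moved_darts" using bij_betwE[OF marking_facts(2)[OF mk]] by blast
  then show "snd \<iota> (c, i, s) \<in> darts Y" by (simp add: moved_darts_def)
  have "snd (\<rho> (b, 0)) (snd \<iota> (c, i, s)) = snd \<iota> (c, i, s) \<longleftrightarrow> b i = i" if b: "b \<in> D.A" for b
  proof -
    have "(c, b i, s) \<in> darts M" using assms standard_pair(1)[OF sp] D.A_in[OF b] by simp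
    then have "snd \<iota> (c, b i, s) = snd \<iota> (c, i, s) \<longleftrightarrow> b i = i"
      using inj_onD[OF bij_betw_imp_inj_on[OF marking_facts(2)[OF mk]], of "(c, b i, s)" "(c, i, s)"] m by auto
    then show ?thesis using marking_facts(5)[OF mk b m] by (simp add: std_perm_def)
  qed
  then show "D.labelled (snd \<iota> (c, i, s)) i" using assms(2) unfolding D.labelled_def by blast
qed

lemma marked_dart_inj:
  assumes "snd \<iota> x = snd \<iota> y" "x \<in> darts M" "y \<in> darts M"
  shows "x = y"
  using inj_onD[OF bij_betw_imp_inj_on[OF marking_facts(2)[OF mk]]] assms by blast

text \<open>As the alternating group acts transitively on labels, the effect on copies and orientations
  does not depend on the label.\<close>

lemma twist_function:
  assumes g: "(p, k) \<in> carrier (Gn n)"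
  obtains \<phi> where "\<And>c s. c \<in> C \<Longrightarrow> fst (\<phi> (c, s)) \<in> C"
    and "\<And>c i s. c \<in> C \<Longrightarrow> i \<in> D.\<Omega> \<Longrightarrow>
      snd (\<rho> (p, k)) (snd \<iota> (c, i, s)) = snd \<iota> (fst (\<phi> (c, s)), p i, snd (\<phi> (c, s)))"
proof -
  have p: "p permutes D.\<Omega>" "k = 0 \<or> k = 1" using g by (simp_all add: Gn_carrier)
  have p1: "p 1 \<in> D.\<Omega>" using permutes_in_image[OF p(1)] D.one_\<Omega> by blast
  have "\<exists>x. fst x \<in> C \<and> snd (\<rho> (p, k)) (snd \<iota> (c, 1, s)) = snd \<iota> (fst x, p 1, snd x)" if c: "c \<in> C" for c s
  proof -
    let ?d = "snd \<iota> (c, 1, s)"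
    have l: "D.labelled (snd (\<rho> (p, k)) ?d) (p 1)"
      using D.labelled_act[OF g marked_dart(3,4)[OF c D.one_\<Omega>]] .
    then have "snd (\<rho> (p, k)) ?d \<in> moved_darts"
      using rho_in(2)[OF g marked_dart(3)[OF c D.one_\<Omega>]] by (auto simp: moved_darts_def)
    then have "snd (\<rho> (p, k)) ?d \<in> snd \<iota> ` darts M"
      using marking_facts(2)[OF mk] by (simp only: bij_betw_def)
    then obtain c' j s' where "(c', j, s') \<in> darts M" "snd (\<rho> (p, k)) ?d = snd \<iota> (c', j, s')" by auto
    then have e: "c' \<in> C" "j \<in> D.\<Omega>" "snd (\<rho> (p, k)) ?d = snd \<iota> (c', j, s')"
      using standard_pair(1)[OF sp] by auto
    then have "j = p 1" using marked_dart(4)[OF e(1,2)] l D.labelled_unique by metis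
    then show ?thesis using e by (intro exI[of _ "(c', s')"]) simp
  qed
  then have ex: "\<forall>y\<in>C \<times> UNIV. \<exists>x. fst x \<in> C \<and> snd (\<rho> (p, k)) (snd \<iota> (fst y, 1, snd y)) = snd \<iota> (fst x, p 1, snd x)"
    by auto
  obtain \<phi> where "\<forall>y\<in>C \<times> UNIV. fst (\<phi> y) \<in> C \<and>
      snd (\<rho> (p, k)) (snd \<iota> (fst y, 1, snd y)) = snd \<iota> (fst (\<phi> y), p 1, snd (\<phi> y))"
    using bchoice[OF ex] by (elim exE)
  then have \<phi>: "fst (\<phi> (c, s)) \<in> C"
    "snd (\<rho> (p, k)) (snd \<iota> (c, 1, s)) = snd \<iota> (fst (\<phi> (c, s)), p 1, snd (\<phi> (c, s)))" if "c \<in> C" for c s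
    using that by auto
  have "snd (\<rho> (p, k)) (snd \<iota> (c, i, s)) = snd \<iota> (fst (\<phi> (c, s)), p i, snd (\<phi> (c, s)))"
    if c: "c \<in> C" and i: "i \<in> D.\<Omega>" for c i s
  proof -
    let ?b = "D.move 1 i"
    have b: "?b \<in> D.A" "?b 1 = i" using D.move[OF D.one_\<Omega> i] .
    let ?q = "p \<circ> ?b \<circ> inv' p"
    have pinv: "(inv' p, k) \<in> carrier (Gn n)" using permutes_inv[OF p(1)] p(2) by (simp add: Gn_carrier)
    have q: "?q \<in> D.A" using D.act_swap(1)[OF pinv b(1) marked_dart(3)[OF c D.one_\<Omega>]] permutes_inv_inv[OF p(1)] by simp
    have qb: "inv' p \<circ> ?q \<circ> p = ?b"
      using permutes_inverses[OF p(1)] by (simp add: fun_eq_iff)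
    have "snd \<iota> (c, i, s) = snd (\<rho> (?b, 0)) (snd \<iota> (c, 1, s))"
      using marking_facts(5)[OF mk b(1) marked_dart(1)[OF c D.one_\<Omega>]] b(2) by (simp add: std_perm_def)
    then have "snd (\<rho> (p, k)) (snd \<iota> (c, i, s)) = snd (\<rho> (?q, 0)) (snd (\<rho> (p, k)) (snd \<iota> (c, 1, s)))"
      using D.act_swap(2)[OF g q marked_dart(3)[OF c D.one_\<Omega>]] qb by simp
    also have "\<dots> = snd (\<rho> (?q, 0)) (snd \<iota> (fst (\<phi> (c, s)), p 1, snd (\<phi> (c, s))))" using \<phi>(2)[OF c] by simp
    also have "\<dots> = snd \<iota> (fst (\<phi> (c, s)), ?q (p 1), snd (\<phi> (c, s)))"
      using marking_facts(5)[OF mk q marked_dart(1)[OF \<phi>(1)[OF c] p1]] by (simp add: std_perm_def)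
    also have "?q (p 1) = p i" using permutes_inverses[OF p(1)] b(2) by simp
    finally show ?thesis .
  qed
  then show ?thesis using that \<phi>(1) by blast
qed

text \<open>Every vertex of a standard graph is the origin of a dart, so it suffices to compare the
  two maps on darts.\<close>

lemma agree_onI:
  assumes g: "(p, k) \<in> carrier (Gn n)"
    and \<sigma>: "\<And>d. d \<in> darts M \<Longrightarrow> snd \<sigma> d \<in> darts M" "\<And>d. d \<in> darts M \<Longrightarrow> org M (snd \<sigma> d) = fst \<sigma> (org M d)"
    and eq: "\<And>d. d \<in> darts M \<Longrightarrow> snd (\<rho> (p, k)) (snd \<iota> d) = snd \<iota> (snd \<sigma> (snd (std_perm p) d))"
  shows "agree_on M (\<rho> (p, k) \<circ>\<^sub>g \<iota>) ((\<iota> \<circ>\<^sub>g \<sigma>) \<circ>\<^sub>g std_perm p)"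
  unfolding agree_on_def
proof (intro conjI ballI)
  have p: "p permutes D.\<Omega>" using g by (simp add: Gn_carrier)
  fix v assume "v \<in> verts M"
  then obtain d where d: "d \<in> darts M" "v = org M d" using standard_pair(5)[OF sp] by blast
  have dY: "snd \<iota> d \<in> darts Y" using bij_betwE[OF marking_facts(2)[OF mk]] d(1) by (auto simp: moved_darts_def)
  have pd: "snd (std_perm p) d \<in> darts M" using standard_pair(8)[OF sp p d(1)] .
  have "fst (\<rho> (p, k)) (fst \<iota> v) = org Y (snd (\<rho> (p, k)) (snd \<iota> d))"
    using marking_facts(3)[OF mk d(1)] rho_org[OF g dY] d(2) by simp
  also have "\<dots> = fst \<iota> (org M (snd \<sigma> (snd (std_perm p) d)))"
    using eq[OF d(1)] marking_facts(3)[OF mk \<sigma>(1)[OF pd]] by simp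
  also have "\<dots> = fst \<iota> (fst \<sigma> v)" using \<sigma>(2)[OF pd] standard_pair(9)[OF sp] d(2) by simp
  finally show "fst (\<rho> (p, k) \<circ>\<^sub>g \<iota>) v = fst ((\<iota> \<circ>\<^sub>g \<sigma>) \<circ>\<^sub>g std_perm p) v"
    by (simp add: gcomp_def std_perm_def)
qed (simp add: gcomp_def eq)

text \<open>What remains of a group element besides its permutation is a map \<open>\<phi>\<close>
  of pairs (copy, orientation) that is injective, commutes with reversal and respects common
  origins. For one copy this leaves the identity and the reversal. For two copies the shared vertex
  forces orientations to be kept, which leaves the identity and the exchange of copies.\<close>

lemma twist:
  assumes g: "(p, k) \<in> carrier (Gn n)"
  obtains "agree_on M (\<rho> (p, k) \<circ>\<^sub>g \<iota>) (\<iota> \<circ>\<^sub>g std_perm p)"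
    | "agree_on M (\<rho> (p, k) \<circ>\<^sub>g \<iota>) ((\<iota> \<circ>\<^sub>g \<tau>) \<circ>\<^sub>g std_perm p)"
proof -
  have p: "p permutes D.\<Omega>" using g by (simp add: Gn_carrier)
  have p1: "p 1 \<in> D.\<Omega>" using permutes_in_image[OF p] D.one_\<Omega> by blast
  obtain \<phi> where \<phi>C: "\<And>c s. c \<in> C \<Longrightarrow> fst (\<phi> (c, s)) \<in> C"
    and \<phi>: "\<And>c i s. c \<in> C \<Longrightarrow> i \<in> D.\<Omega> \<Longrightarrow>
      snd (\<rho> (p, k)) (snd \<iota> (c, i, s)) = snd \<iota> (fst (\<phi> (c, s)), p i, snd (\<phi> (c, s)))"
    using twist_function[OF g] by blast
  have \<phi>opp: "\<phi> (c, \<not> s) = (fst (\<phi> (c, s)), \<not> snd (\<phi> (c, s)))" if c: "c \<in> C" for c s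
  proof -
    note d = marked_dart[OF c D.one_\<Omega>]
    have "snd \<iota> (fst (\<phi> (c, \<not> s)), p 1, snd (\<phi> (c, \<not> s))) = snd (\<rho> (p, k)) (snd \<iota> (c, 1, \<not> s))"
      using \<phi>[OF c D.one_\<Omega>] by simp
    also have "\<dots> = snd (\<rho> (p, k)) (opp Y (snd \<iota> (c, 1, s)))"
      using marking_facts(4)[OF mk d(1)] standard_pair(2)[OF sp] by simp
    also have "\<dots> = opp Y (snd \<iota> (fst (\<phi> (c, s)), p 1, snd (\<phi> (c, s))))"
      using rho_opp[OF g d(3)] \<phi>[OF c D.one_\<Omega>] by simp
    also have "\<dots> = snd \<iota> (fst (\<phi> (c, s)), p 1, \<not> snd (\<phi> (c, s)))"
      using marking_facts(4)[OF mk marked_dart(1)[OF \<phi>C[OF c] p1]] standard_pair(2)[OF sp] by simp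
    finally have "(fst (\<phi> (c, \<not> s)), p 1, snd (\<phi> (c, \<not> s))) = (fst (\<phi> (c, s)), p 1, \<not> snd (\<phi> (c, s)))"
      by (rule marked_dart_inj) (use marked_dart(1)[OF _ p1] \<phi>C c in auto)
    then show ?thesis by (simp add: prod_eq_iff)
  qed
  have \<phi>inj: "c = c' \<and> s = s'" if c: "c \<in> C" "c' \<in> C" and eq: "\<phi> (c, s) = \<phi> (c', s')" for c c' s s'
  proof -
    have "snd (\<rho> (p, k)) (snd \<iota> (c, 1, s)) = snd (\<rho> (p, k)) (snd \<iota> (c', 1, s'))"
      using \<phi>[OF _ D.one_\<Omega>] c eq by simp
    then have "snd \<iota> (c, 1, s) = snd \<iota> (c', 1, s')"
      using D.act_inj[OF g] marked_dart(3)[OF _ D.one_\<Omega>] c by blast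
    then have "(c, 1::nat, s) = (c', 1, s')"
      by (rule marked_dart_inj) (use marked_dart(1)[OF _ D.one_\<Omega>] c in auto)
    then show ?thesis by simp
  qed
  have std: ?thesis if "\<And>c s. c \<in> C \<Longrightarrow> \<phi> (c, s) = (c, s)"
  proof -
    have "agree_on M (\<rho> (p, k) \<circ>\<^sub>g \<iota>) ((\<iota> \<circ>\<^sub>g (id, id)) \<circ>\<^sub>g std_perm p)"
    proof (rule agree_onI[OF g])
      fix d assume "d \<in> darts M"
      then obtain c i s where "d = (c, i, s)" "c \<in> C" "i \<in> D.\<Omega>" using standard_pair(1)[OF sp] by auto
      then show "snd (\<rho> (p, k)) (snd \<iota> d) = snd \<iota> (snd (id, id) (snd (std_perm p) d))"
        using \<phi> that by (simp add: std_perm_def)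
    qed auto
    then show ?thesis using \<open>agree_on M (\<rho> (p, k) \<circ>\<^sub>g \<iota>) (\<iota> \<circ>\<^sub>g std_perm p) \<Longrightarrow> thesis\<close> by (simp add: gcomp_def)
  qed
  have twi: ?thesis
    if tw: "\<And>c i s. c \<in> C \<Longrightarrow> snd \<tau> (c, i, s) = (fst (\<phi> (c, s)), i, snd (\<phi> (c, s)))"
  proof -
    have "agree_on M (\<rho> (p, k) \<circ>\<^sub>g \<iota>) ((\<iota> \<circ>\<^sub>g \<tau>) \<circ>\<^sub>g std_perm p)"
    proof (rule agree_onI[OF g standard_pair(6)[OF sp] standard_pair(7)[OF sp]])
      fix d assume "d \<in> darts M"
      then obtain c i s where d: "d = (c, i, s)" "c \<in> C" "i \<in> D.\<Omega>" using standard_pair(1)[OF sp] by auto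
      then show "snd (\<rho> (p, k)) (snd \<iota> d) = snd \<iota> (snd \<tau> (snd (std_perm p) d))"
        using \<phi>[OF d(2,3)] tw[OF d(2)] by (simp add: std_perm_def)
    qed
    then show ?thesis using \<open>agree_on M (\<rho> (p, k) \<circ>\<^sub>g \<iota>) ((\<iota> \<circ>\<^sub>g \<tau>) \<circ>\<^sub>g std_perm p) \<Longrightarrow> thesis\<close> by simp
  qed
  \<comment> \<open>The group element acts on vertices by a function, so equality of origins
    survives it; the marking, injective on vertices, brings the equality back to
    \<open>M\<close>.\<close>
  have orgM: "org M (\<phi>' c, p 1, s) = org M (\<phi>' c', p 1, s')"
    if "c \<in> C" "c' \<in> C" "org M (c, 1, t) = org M (c', 1, t')"
      "(\<phi>' c, s) = \<phi> (c, t)" "(\<phi>' c', s') = \<phi> (c', t')" for \<phi>' c c' s s' t t'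
  proof -
    have a: "fst \<iota> (org M (fst (\<phi> (c, t)), p 1, snd (\<phi> (c, t)))) = fst (\<rho> (p, k)) (fst \<iota> (org M (c, 1, t)))"
      if c: "c \<in> C" for c t
      using marking_facts(3)[OF mk marked_dart(1)[OF \<phi>C[OF c] p1]] marking_facts(3)[OF mk marked_dart(1)[OF c D.one_\<Omega>]]
        \<phi>[OF c D.one_\<Omega>] rho_org[OF g marked_dart(3)[OF c D.one_\<Omega>]] by simp
    have "fst \<iota> (org M (\<phi>' c, p 1, s)) = fst \<iota> (org M (\<phi>' c', p 1, s'))"
      using a[OF that(1), of t] a[OF that(2), of t'] that(3) that(4,5)[symmetric] by simp
    moreover have "org M (\<phi>' c, p 1, s) \<in> verts M" "org M (\<phi>' c', p 1, s') \<in> verts M"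
      using standard_pair(4)[OF sp marked_dart(1)[OF _ p1]] \<phi>C[OF that(1), of t] \<phi>C[OF that(2), of t']
        that(4,5)[symmetric] by simp_all
    ultimately show ?thesis using bij_betw_imp_inj_on[OF marking_facts(1)[OF mk]] by (blast dest: inj_onD)
  qed
  consider "C = {1}" "M = rose (n + 1) \<and> \<tau> = rose_flip \<or> M = cage (n + 1) \<and> \<tau> = cage_swap"
    | "C = {1, 2}" "M = double_cage (n + 1)" "\<tau> = double_cage_swap"
    using sp unfolding standard_pair_def by auto
  then show ?thesis
  proof cases
    case 1
    have f: "fst (\<phi> (1, s)) = 1" for s using \<phi>C[of 1 s] 1(1) by simp
    show ?thesis
    proof (cases "snd (\<phi> (1, True))")
      case True
      then have "\<phi> (1, s) = (1, s)" for s using f \<phi>opp[of 1 True] 1(1) by (cases s) (auto simp: prod_eq_iff)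
      then show ?thesis using 1(1) by (intro std) auto
    next
      case False
      then have "\<phi> (1, s) = (1, \<not> s)" for s using f \<phi>opp[of 1 True] 1(1) by (cases s) (auto simp: prod_eq_iff)
      then show ?thesis using 1 by (intro twi) (auto simp: rose_flip_def cage_swap_def)
    qed
  next
    case 2
    obtain c1 s1 c2 s2 where e: "\<phi> (1, False) = (c1, s1)" "\<phi> (2, False) = (c2, s2)" by (cases "\<phi> (1, False)"; cases "\<phi> (2, False)")
    have c12: "c1 \<in> {1, 2}" "c2 \<in> {1, 2}" using \<phi>C[of 1 False] \<phi>C[of 2 False] e 2(1) by auto
    have "org M (c1, p 1, s1) = org M (c2, p 1, s2)"
      using orgM[of 1 2 False False "\<lambda>c. if c = 1 then c1 else c2" s1 s2] e 2(1,2) by (simp add: double_cage_def)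
    then have "(if s1 then c1 else 0) = (if s2 then c2 else 0)" using 2(2) by (simp add: double_cage_def)
    moreover have "(c1, s1) \<noteq> (c2, s2)" using \<phi>inj[of 1 2 False False] e 2(1) by auto
    \<comment> \<open>Mixed orientations would equate 0 with the number of a copy, and twice
      \<open>True\<close> would give c1 = c2, against injectivity of \<open>\<phi>\<close>.\<close>
    ultimately have s: "s1 = False" "s2 = False" "c1 \<noteq> c2" using c12 by (auto split: if_splits)
    have t: "\<phi> (1, s) = (c1, s)" "\<phi> (2, s) = (c2, s)" for s
      using e s \<phi>opp[of 1 False] \<phi>opp[of 2 False] 2(1) by (cases s; simp)+
    consider "c1 = 1" "c2 = 2" | "c1 = 2" "c2 = 1" using c12 s(3) by auto
    then show ?thesis
    proof cases
      case 1
      then show ?thesis using t 2(1) by (intro std) auto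
    next
      case sw: 2
      then show ?thesis using t 2 by (intro twi) (auto simp: double_cage_swap_def)
    qed
  qed
qed

lemma Delta_acts_by_twist:
  assumes "\<not> acts_trivially_on (\<rho> Delta) Y\<^sub>B"
  shows "agree_on M (\<rho> Delta \<circ>\<^sub>g \<iota>) (\<iota> \<circ>\<^sub>g \<tau>)"
proof -
  have id: "\<kappa> \<circ>\<^sub>g std_perm id = \<kappa>" for \<kappa> :: "(nat, nat \<times> nat \<times> bool, 'v, 'e) gmap"
    by (cases \<kappa>) (auto simp: gcomp_def std_perm_def fun_eq_iff)
  have "(id, 1) \<in> carrier (Gn n)" by (simp add: Gn_carrier)
  then show ?thesis
  proof (cases rule: twist)
    case 1
    then have t: "agree_on M (\<rho> Delta \<circ>\<^sub>g \<iota>) \<iota>" by (simp add: id Delta_def)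
    have "acts_trivially_on (\<rho> Delta) Y\<^sub>B"
      unfolding acts_trivially_on_def agree_on_def YB_simps
    proof (intro conjI ballI)
      fix v assume "v \<in> org Y ` D\<^sub>1"
      then have "v \<in> fst \<iota> ` verts M" using marking_facts(1)[OF mk] by (simp only: bij_betw_def)
      then obtain w where "w \<in> verts M" "v = fst \<iota> w" by blast
      then show "fst (\<rho> Delta) v = fst (id, id) v" using t by (simp add: agree_on_def gcomp_def)
    next
      fix d assume "d \<in> moved_darts"
      then have "d \<in> snd \<iota> ` darts M" using marking_facts(2)[OF mk] by (simp only: bij_betw_def)
      then obtain x where "x \<in> darts M" "d = snd \<iota> x" by blast
      then show "snd (\<rho> Delta) d = snd (id, id) d" using t by (simp add: agree_on_def gcomp_def)
    qed
    then show ?thesis using assms by simp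
  next
    case 2
    then show ?thesis by (simp add: id Delta_def)
  qed
qed

text \<open>Two odd permutations differ by an even one, which acts in the standard way. So a single
  odd permutation decides between the alternatives for all of them at once.\<close>

lemma odd_perms_agree:
  assumes p0: "p\<^sub>0 \<in> odd_perms n" and p: "p \<in> odd_perms n"
    and ag: "agree_on M (\<rho> (p\<^sub>0, 0) \<circ>\<^sub>g \<iota>) (\<kappa> \<circ>\<^sub>g std_perm p\<^sub>0)"
  shows "agree_on M (\<rho> (perm_elt p) \<circ>\<^sub>g \<iota>) (\<kappa> \<circ>\<^sub>g std_perm p)"
proof -
  have o: "p\<^sub>0 permutes D.\<Omega>" "\<not> evenperm p\<^sub>0" "p permutes D.\<Omega>" "\<not> evenperm p"
    using p0 p by (auto simp: odd_perms_def sym_group_carrier alt_group_carrier)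
  have pm: "permutation p\<^sub>0" "permutation p" "permutation (inv' p\<^sub>0)"
    using o permutes_imp_permutation[of "D.\<Omega>"] permutes_inv[OF o(1)] by auto
  let ?b = "inv' p\<^sub>0 \<circ> p"
  have b: "?b \<in> D.A"
    using o pm permutes_compose[OF o(3) permutes_inv[OF o(1)]]
    by (simp add: even_perms_def evenperm_comp evenperm_inv)
  have pb: "p = p\<^sub>0 \<circ> ?b" using permutes_inverses[OF o(1)] by (simp add: fun_eq_iff)
  have G: "(p\<^sub>0, 0) \<in> carrier (Gn n)" "(?b, 0) \<in> carrier (Gn n)" using o(1) D.A_G[OF b] by (auto simp: Gn_carrier)
  have m: "(p\<^sub>0, 0) \<otimes>\<^bsub>Gn n\<^esub> (?b, 0) = (p, 0)" using pb by (simp add: Gn_mult)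
  show ?thesis
    unfolding agree_on_def
  proof (intro conjI ballI)
    fix v assume v: "v \<in> verts M"
    have vY: "fst \<iota> v \<in> verts Y"
      using bij_betwE[OF marking_facts(1)[OF mk]] v opp(4) D1(1) by fastforce
    have "fst (\<rho> (p, 0)) (fst \<iota> v) = fst (\<rho> (p\<^sub>0, 0)) (fst \<iota> v)"
      using rho_mult(1)[OF G vY] marking_facts(6)[OF mk b v] unfolding m by (simp add: std_perm_def)
    then show "fst (\<rho> (perm_elt p) \<circ>\<^sub>g \<iota>) v = fst (\<kappa> \<circ>\<^sub>g std_perm p) v"
      using ag v by (simp add: agree_on_def gcomp_def std_perm_def perm_elt_def)
  next
    fix d assume d: "d \<in> darts M"
    have dY: "snd \<iota> d \<in> darts Y"
      using bij_betwE[OF marking_facts(2)[OF mk]] d by (auto simp: moved_darts_def)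
    have bd: "snd (std_perm ?b) d \<in> darts M"
      using standard_pair(8)[OF sp _ d] b by (simp add: even_perms_def)
    have "snd (std_perm p\<^sub>0) (snd (std_perm ?b) d) = snd (std_perm p) d"
      using permutes_inverses[OF o(1)] by (cases d) (simp add: std_perm_def)
    then have "snd (\<rho> (p, 0)) (snd \<iota> d) = snd \<kappa> (snd (std_perm p) d)"
      using rho_mult(2)[OF G dY] marking_facts(5)[OF mk b d] ag bd unfolding m by (simp add: agree_on_def gcomp_def)
    then show "snd (\<rho> (perm_elt p) \<circ>\<^sub>g \<iota>) d = snd (\<kappa> \<circ>\<^sub>g std_perm p) d"
      by (simp add: gcomp_def perm_elt_def)
  qed
qed

lemma odd_std_or_twisted_\<tau>: "odd_std_or_twisted n \<rho> M \<iota> (\<iota> \<circ>\<^sub>g \<tau>)"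
proof (cases "odd_perms n = {}")
  case False
  then obtain p0 where p0: "p0 \<in> odd_perms n" by blast
  have "(p0, 0) \<in> carrier (Gn n)" using p0 by (simp add: odd_perms_def sym_group_carrier Gn_carrier)
  then show ?thesis
    by (cases rule: twist) (use odd_perms_agree[OF p0] in \<open>auto simp: odd_std_or_twisted_def\<close>)
qed (simp add: odd_std_or_twisted_def)

text \<open>A non-trivial central action equals \<open>\<tau>\<close> along the marking, so the two
  descriptions of the twist coincide on \<open>M\<close>.\<close>

lemma odd_std_or_twisted_Delta:
  assumes "\<not> acts_trivially_on (\<rho> Delta) Y\<^sub>B"
  shows "odd_std_or_twisted n \<rho> M \<iota> (\<rho> Delta \<circ>\<^sub>g \<iota>)"
proof -
  have "agree_on M \<alpha> ((\<rho> Delta \<circ>\<^sub>g \<iota>) \<circ>\<^sub>g std_perm p) \<longleftrightarrow> agree_on M \<alpha> ((\<iota> \<circ>\<^sub>g \<tau>) \<circ>\<^sub>g std_perm p)"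
    if "p \<in> odd_perms n" for p \<alpha>
  proof -
    have p: "p permutes D.\<Omega>" using that by (simp add: odd_perms_def sym_group_carrier)
    have "fst (std_perm p) v = v" for v by (simp add: std_perm_def)
    then show ?thesis
      using Delta_acts_by_twist[OF assms] standard_pair(8)[OF sp p] by (simp add: agree_on_def gcomp_def)
  qed
  then show ?thesis using odd_std_or_twisted_\<tau> by (simp add: odd_std_or_twisted_def)
qed

end

end

text \<open>The case distinction at the end reflects that the central element can supply the twist
  only if it acts non-trivially; when it acts trivially, the possible twist is named by
  \<open>\<tau>\<close>.\<close>

theorem proposition6p12:
  fixes n :: nat
    and Y Y\<^sub>B :: "('v, 'e) pregraph"
    and \<rho> :: "(nat \<Rightarrow> nat) \<times> int \<Rightarrow> ('v, 'e, 'v, 'e) gmap"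
  assumes "n > 7"
    and "admissible Y"
    and "minimal_action (Gn n) Y \<rho>"
    and "genus Y \<le> 2 * n"
    and "Y\<^sub>B = moved_subgraph Y \<rho> (Bn n)"
  shows "((\<exists>\<iota>. marking n \<rho> (rose (n + 1)) Y\<^sub>B \<iota>) \<or> (\<exists>\<iota>. marking n \<rho> (cage (n + 1)) Y\<^sub>B \<iota>)
            \<or> (Y\<^sub>B = Y \<and> (\<exists>\<iota>. marking n \<rho> (double_cage (n + 1)) Y\<^sub>B \<iota>)))
       \<and> invariant_under (\<rho> ` carrier (Gn n)) Y\<^sub>B
       \<and> (\<not> acts_trivially_on (\<rho> Delta) Y\<^sub>B \<longrightarrow>
            (\<forall>\<iota>. marking n \<rho> (rose (n + 1)) Y\<^sub>B \<iota>
               \<longrightarrow> agree_on (rose (n + 1)) (\<rho> Delta \<circ>\<^sub>g \<iota>) (\<iota> \<circ>\<^sub>g rose_flip)) \<and>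
            (\<forall>\<iota>. marking n \<rho> (cage (n + 1)) Y\<^sub>B \<iota>
               \<longrightarrow> agree_on (cage (n + 1)) (\<rho> Delta \<circ>\<^sub>g \<iota>) (\<iota> \<circ>\<^sub>g cage_swap)) \<and>
            (\<forall>\<iota>. marking n \<rho> (double_cage (n + 1)) Y\<^sub>B \<iota>
               \<longrightarrow> agree_on (double_cage (n + 1)) (\<rho> Delta \<circ>\<^sub>g \<iota>) (\<iota> \<circ>\<^sub>g double_cage_swap)))
       \<and> (\<forall>(M, \<tau>) \<in> {(rose (n + 1), rose_flip), (cage (n + 1), cage_swap),
                       (double_cage (n + 1), double_cage_swap)}.
            \<forall>\<iota>. marking n \<rho> M Y\<^sub>B \<iota> \<longrightarrow>
              (if acts_trivially_on (\<rho> Delta) Y\<^sub>B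
               then odd_std_or_twisted n \<rho> M \<iota> (\<iota> \<circ>\<^sub>g \<tau>)
               else odd_std_or_twisted n \<rho> M \<iota> (\<rho> Delta \<circ>\<^sub>g \<iota>)))"
proof -
  interpret Gn_minimal_graph n Y \<rho>
    using assms(1-4) by unfold_locales auto
  have pairs: "\<exists>C. standard_pair M C \<tau>"
    if "(M, \<tau>) \<in> {(rose (n + 1), rose_flip), (cage (n + 1), cage_swap),
          (double_cage (n + 1), double_cage_swap)}" for M \<tau>
    using that by (auto simp: standard_pair_def)
  have twist: "agree_on M (\<rho> Delta \<circ>\<^sub>g \<iota>) (\<iota> \<circ>\<^sub>g \<tau>)"
    if "\<not> acts_trivially_on (\<rho> Delta) Y\<^sub>B" "marking n \<rho> M Y\<^sub>B \<iota>"
      "(M, \<tau>) \<in> {(rose (n + 1), rose_flip), (cage (n + 1), cage_swap),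
          (double_cage (n + 1), double_cage_swap)}" for M \<tau> \<iota>
    using pairs[OF that(3)] Delta_acts_by_twist that(1,2) unfolding assms(5) by blast
  have odd: "if acts_trivially_on (\<rho> Delta) Y\<^sub>B then odd_std_or_twisted n \<rho> M \<iota> (\<iota> \<circ>\<^sub>g \<tau>)
      else odd_std_or_twisted n \<rho> M \<iota> (\<rho> Delta \<circ>\<^sub>g \<iota>)"
    if mk: "marking n \<rho> M Y\<^sub>B \<iota>"
      and M: "(M, \<tau>) \<in> {(rose (n + 1), rose_flip), (cage (n + 1), cage_swap),
          (double_cage (n + 1), double_cage_swap)}" for M \<tau> \<iota>
  proof -
    obtain C where "standard_pair M C \<tau>" using pairs[OF M] by blast
    then show ?thesis
      using odd_std_or_twisted_\<tau>[of M C \<tau> \<iota>] odd_std_or_twisted_Delta[of M C \<tau> \<iota>] mk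
      unfolding assms(5) by (simp del: insert_iff)
  qed
  show ?thesis
  proof (intro conjI impI allI ballI, goal_cases)
    case 1
    show ?case using moved_subgraph_classification unfolding assms(5) .
  next
    case 2
    show ?case using moved_subgraph_invariant unfolding assms(5) .
  next
    case (3 \<iota>)
    then show ?case by (intro twist) auto
  next
    case (4 \<iota>)
    then show ?case by (intro twist) auto
  next
    case (5 \<iota>)
    then show ?case by (intro twist) auto
  next
    case (6 x)
    obtain M \<tau> where x: "x = (M, \<tau>)" by (cases x)
    show ?case unfolding x prod.case using odd[of M _ \<tau>] 6 unfolding x by blast
  qed
qed

end
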